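(* There is a constant $c>0$ such that every simple, pairwise intersecting arrangement $\mathcal{A}$ of $n$ pseudocircles satisfies $p_3(\mathcal{A})\le \tfrac{2}{3}n^2+cn$.
   Context: A pseudocircle is a simple closed curve on the sphere. An arrangement of pseudocircles is a finite collection of pseudocircles such that any two are either disjoint or intersect in exactly two points, at which they cross; it is simple if no three pseudocircles share a point, and pairwise intersecting if every two pseudocircles intersect. $p_3(\mathcal{A})$ is the number of triangles, i.e., cells of the induced decomposition of the sphere with exactly $3$ crossings on their boundary. *)

theory Defs
  imports "HOL-Analysis.Analysis"
begin

abbreviation S2 :: "(real^3) set" where
  "S2 \<equiv> sphere (0::real^3) 1"

definition pseudocircle :: "(real^3) set \<Rightarrow> bool" where
  "pseudocircle C \<longleftrightarrow> C \<subseteq> S2 \<and>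
     (\<exists>g. simple_path g \<and> pathfinish g = pathstart g \<and> path_image g = C)"

text \<open>Two pseudocircles meeting in exactly two points cross there iff the two arcs
  of D minus C lie on different sides of C, i.e. D - C is not contained in a single
  connected component of S2 - C.\<close>
definition crosses :: "(real^3) set \<Rightarrow> (real^3) set \<Rightarrow> bool" where
  "crosses C D \<longleftrightarrow> \<not> (\<exists>K \<in> components (S2 - C). D - C \<subseteq> K)"

definition arrangement :: "(real^3) set set \<Rightarrow> bool" where
  "arrangement A \<longleftrightarrow> finite A \<and> (\<forall>C\<in>A. pseudocircle C) \<and>
     (\<forall>C\<in>A. \<forall>D\<in>A. C \<noteq> D \<longrightarrow>
        C \<inter> D = {} \<or> (card (C \<inter> D) = 2 \<and> crosses C D))"

definition simple_arrangement :: "(real^3) set set \<Rightarrow> bool" where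
  "simple_arrangement A \<longleftrightarrow>
     (\<forall>C\<in>A. \<forall>D\<in>A. \<forall>E\<in>A. C \<noteq> D \<and> C \<noteq> E \<and> D \<noteq> E \<longrightarrow> C \<inter> D \<inter> E = {})"

definition pairwise_intersecting :: "(real^3) set set \<Rightarrow> bool" where
  "pairwise_intersecting A \<longleftrightarrow> (\<forall>C\<in>A. \<forall>D\<in>A. C \<noteq> D \<longrightarrow> C \<inter> D \<noteq> {})"

definition crossings :: "(real^3) set set \<Rightarrow> (real^3) set" where
  "crossings A = \<Union>{C \<inter> D | C D. C \<in> A \<and> D \<in> A \<and> C \<noteq> D}"

definition cells :: "(real^3) set set \<Rightarrow> (real^3) set set" where
  "cells A = components (S2 - \<Union>A)"

definition p3 :: "(real^3) set set \<Rightarrow> nat" where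
  "p3 A = card {F \<in> cells A. card (frontier F \<inter> crossings A) = 3}"

end

theory Submission
  imports Defs "HOL-Complex_Analysis.Winding_Numbers"
begin

text \<open>
  Stereographic projection from a point off the curves moves the arrangement to the plane and
  affects only one cell. In the plane count incidences between triangles and crossings. There are
  at most \<open>n (n - 1)\<close> crossings and each lies on at most four cells, so it suffices that only
  \<open>O(n)\<close> crossings lie on three or four triangles.

  If \<open>v \<in> C \<inter> D\<close> is such a crossing, then two triangles at \<open>v\<close> share an edge on \<open>D\<close>, both have the
  same third pseudocircle \<open>E\<close>, and \<open>D\<close> is the only other pseudocircle that meets \<open>E\<close> inside \<open>C\<close>
  or \<open>C\<close> inside \<open>E\<close> (for suitable sides of \<open>C\<close> and \<open>E\<close>). Fix a pseudocircle \<open>Z\<close>, and delete every other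
  one or choose a side of it, at random. With probability at least \<open>1/27\<close>, \<open>D\<close> is deleted and the chosen sides of
  \<open>C\<close> and \<open>E\<close> look nested from every remaining pseudocircle. Take the points where \<open>Z\<close> enters the
  chosen sides as vertices and the surviving pairs \<open>C\<close>, \<open>E\<close> as edges. This graph has a drawing
  along \<open>Z\<close> in which vertex-disjoint edges cross evenly: an edge passes a vertex on the one or
  the other side according to which of \<open>C\<close>, \<open>E\<close> is met first along the pseudocircle of that vertex.
  Evenly drawn graphs are closed under edge contraction and contain no \<open>K\<^sub>5\<close>, hence they
  have linearly many edges.
\<close>

section \<open>Evenly crossing drawings on a line\<close>

text \<open>No drawing in the plane is ever built. Pulling an edge across a vertex flips its
  crossing parity with every edge ending there, so up to parity a drawing is a Boolean function
  \<open>\<phi>\<close>, and topology enters only through pairs of contacts on four distinct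
  pseudocircles. If both entries of one contact lie between those of the other, their two loops meet
  the outer pair in the same order (\<open>parallel_first_hit\<close>). If the entries interleave,
  the two comparisons are opposite (\<open>interleaving_first_hit\<close>). In both cases a path
  along two of the curves would otherwise have to cross an arc that cuts a lune in two.

  "Met first" depends on a direction of travel. It is tied to the chosen side: each loop starts at
  its entry and keeps that side on its left. So the side of a pseudocircle must be fixed once for
  all contacts that use it, which is why sides are chosen at random beforehand. \<open>D\<close> has
  to be deleted because it meets \<open>C\<close> at \<open>v\<close> on the wrong side of
  \<open>E\<close> and thus spoils the nesting. Deleted, inside or outside makes three values,
  prescribed at the three curves \<open>C\<close>, \<open>D\<close>, \<open>E\<close>: hence the
  factor 27.\<close>

definition btw :: "real \<Rightarrow> real \<Rightarrow> real \<Rightarrow> bool" where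
  "btw a b x \<longleftrightarrow> min a b < x \<and> x < max a b"

text \<open>Read \<open>\<phi> e x\<close> as the parity with which the edge \<open>e\<close> passes over the vertex \<open>x\<close>, relative to
  drawing all edges as half circles above a line that carries the vertices. Half circles cross iff their
  ends interleave, so the condition says that vertex-disjoint edges cross an even number of times.\<close>

definition even_drawing :: "(real set \<Rightarrow> real \<Rightarrow> bool) \<Rightarrow> real set set \<Rightarrow> bool" where
  "even_drawing \<phi> E \<longleftrightarrow> (\<forall>a b c d. {a,b} \<in> E \<longrightarrow> {c,d} \<in> E \<longrightarrow> distinct [a,b,c,d] \<longrightarrow>
     ((btw a b c \<noteq> btw a b d) \<longleftrightarrow>
       ((\<phi> {a,b} c \<noteq> \<phi> {a,b} d) \<noteq> (\<phi> {c,d} a \<noteq> \<phi> {c,d} b))))"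

lemma even_drawingD:
  assumes "even_drawing \<phi> E" "{a,b} \<in> E" "{c,d} \<in> E" "distinct [a,b,c,d]"
  shows "(btw a b c \<noteq> btw a b d) \<longleftrightarrow>
       ((\<phi> {a,b} c \<noteq> \<phi> {a,b} d) \<noteq> (\<phi> {c,d} a \<noteq> \<phi> {c,d} b))"
  using assms unfolding even_drawing_def by blast

lemma even_drawing_mono: "even_drawing \<phi> E \<Longrightarrow> F \<subseteq> E \<Longrightarrow> even_drawing \<phi> F"
  unfolding even_drawing_def by blast

lemma btw_sym: "btw a b x = btw b a x"
  by (auto simp: btw_def min_def max_def)

lemma interleave_sym:
  assumes "distinct [a,b,c,d]"
  shows "(btw a b c \<noteq> btw a b d) = (btw c d a \<noteq> btw c d b)"
  using assms by (auto simp: btw_def min_def max_def)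

text \<open>Apices are adjacent to each other and to all of \<open>V\<close>, so each of them
  supplies one vertex of a complete graph. Three of them turn any edge of \<open>E\<close> into a
  \<open>K_5\<close>.\<close>

definition apex_join :: "'a set \<Rightarrow> 'a set \<Rightarrow> 'a set set \<Rightarrow> 'a set set" where
  "apex_join U V E = E \<union> {{x,y} | x y. x \<in> U \<and> y \<in> U \<union> V \<and> x \<noteq> y}"

lemma xor_odd: "((p \<noteq> q) \<noteq> (r \<noteq> s)) = odd (of_bool p + of_bool q + of_bool r + of_bool s :: int)"
  by auto

lemma odd_split: "(b = odd n) \<Longrightarrow> \<exists>k::int. n = 2 * k + of_bool b"
  by (cases b) (auto elim!: oddE evenE)

lemma even_drawingD_int:
  assumes "even_drawing \<phi> E" "{a,b} \<in> E" "{c,d} \<in> E" "distinct [a,b,c,d]"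
  shows "\<exists>k::int. of_bool (\<phi> {a,b} c) + of_bool (\<phi> {a,b} d) + of_bool (\<phi> {c,d} a) + of_bool (\<phi> {c,d} b)
           = 2 * k + of_bool (btw a b c \<noteq> btw a b d)"
proof -
  have "(btw a b c \<noteq> btw a b d) =
        odd (of_bool (\<phi> {a,b} c) + of_bool (\<phi> {a,b} d) + of_bool (\<phi> {c,d} a) + of_bool (\<phi> {c,d} b) :: int)"
    using even_drawingD[OF assms] xor_odd by metis
  then show ?thesis by (rule odd_split)
qed

text \<open>Among the pairs of disjoint edges of \<open>K\<^sub>5\<close> exactly five interleave, while each value of \<open>\<phi>\<close>
  enters the sum of all conditions twice.\<close>

lemma K5_not_even_sorted:
  assumes g: "even_drawing \<phi> E"
    and lt: "x1 < x2" "x2 < x3" "x3 < x4" "x4 < (x5::real)"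
    and E: "\<And>a b. a \<in> {x1,x2,x3,x4,x5} \<Longrightarrow> b \<in> {x1,x2,x3,x4,x5} \<Longrightarrow> a < b \<Longrightarrow> {a,b} \<in> E"
  shows False
proof -
  define f where "f a b c = (of_bool (\<phi> {a,b} c) :: int)" for a b c
  have *: "\<exists>k::int. f a b c + f a b d + f c d a + f c d b = 2 * k + of_bool (btw a b c \<noteq> btw a b d)"
    if "a \<in> {x1,x2,x3,x4,x5}" "b \<in> {x1,x2,x3,x4,x5}" "c \<in> {x1,x2,x3,x4,x5}" "d \<in> {x1,x2,x3,x4,x5}"
      "a < b" "c < d" "a \<noteq> c" "a \<noteq> d" "b \<noteq> c" "b \<noteq> d" for a b c d
    unfolding f_def using that by (intro even_drawingD_int[OF g] E) auto
  have l: "x1 < x3" "x1 < x4" "x1 < x5" "x2 < x4" "x2 < x5" "x3 < x5"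
    using lt by auto
  note L = lt l
  obtain k1 where k1: "f x1 x2 x3 + f x1 x2 x4 + f x3 x4 x1 + f x3 x4 x2 = 2 * k1"
    using *[of x1 x2 x3 x4] L by (auto simp: btw_def)
  obtain k2 where k2: "f x1 x3 x2 + f x1 x3 x4 + f x2 x4 x1 + f x2 x4 x3 = 2 * k2 + 1"
    using *[of x1 x3 x2 x4] L by (auto simp: btw_def)
  obtain k3 where k3: "f x1 x4 x2 + f x1 x4 x3 + f x2 x3 x1 + f x2 x3 x4 = 2 * k3"
    using *[of x1 x4 x2 x3] L by (auto simp: btw_def)
  obtain k4 where k4: "f x1 x2 x3 + f x1 x2 x5 + f x3 x5 x1 + f x3 x5 x2 = 2 * k4"
    using *[of x1 x2 x3 x5] L by (auto simp: btw_def)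
  obtain k5 where k5: "f x1 x3 x2 + f x1 x3 x5 + f x2 x5 x1 + f x2 x5 x3 = 2 * k5 + 1"
    using *[of x1 x3 x2 x5] L by (auto simp: btw_def)
  obtain k6 where k6: "f x1 x5 x2 + f x1 x5 x3 + f x2 x3 x1 + f x2 x3 x5 = 2 * k6"
    using *[of x1 x5 x2 x3] L by (auto simp: btw_def)
  obtain k7 where k7: "f x1 x2 x4 + f x1 x2 x5 + f x4 x5 x1 + f x4 x5 x2 = 2 * k7"
    using *[of x1 x2 x4 x5] L by (auto simp: btw_def)
  obtain k8 where k8: "f x1 x4 x2 + f x1 x4 x5 + f x2 x5 x1 + f x2 x5 x4 = 2 * k8 + 1"
    using *[of x1 x4 x2 x5] L by (auto simp: btw_def)
  obtain k9 where k9: "f x1 x5 x2 + f x1 x5 x4 + f x2 x4 x1 + f x2 x4 x5 = 2 * k9"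
    using *[of x1 x5 x2 x4] L by (auto simp: btw_def)
  obtain m1 where m1: "f x1 x3 x4 + f x1 x3 x5 + f x4 x5 x1 + f x4 x5 x3 = 2 * m1"
    using *[of x1 x3 x4 x5] L by (auto simp: btw_def)
  obtain m2 where m2: "f x1 x4 x3 + f x1 x4 x5 + f x3 x5 x1 + f x3 x5 x4 = 2 * m2 + 1"
    using *[of x1 x4 x3 x5] L by (auto simp: btw_def)
  obtain m3 where m3: "f x1 x5 x3 + f x1 x5 x4 + f x3 x4 x1 + f x3 x4 x5 = 2 * m3"
    using *[of x1 x5 x3 x4] L by (auto simp: btw_def)
  obtain m4 where m4: "f x2 x3 x4 + f x2 x3 x5 + f x4 x5 x2 + f x4 x5 x3 = 2 * m4"
    using *[of x2 x3 x4 x5] L by (auto simp: btw_def)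
  obtain m5 where m5: "f x2 x4 x3 + f x2 x4 x5 + f x3 x5 x2 + f x3 x5 x4 = 2 * m5 + 1"
    using *[of x2 x4 x3 x5] L by (auto simp: btw_def)
  obtain m6 where m6: "f x2 x5 x3 + f x2 x5 x4 + f x3 x4 x2 + f x3 x4 x5 = 2 * m6"
    using *[of x2 x5 x3 x4] L by (auto simp: btw_def)
  \<comment> \<open>The three pairings of four vertices use each of their triples with every choice
    of the vertex that is passed. So the sums are grouped by triples; each triple lies in two of the
    five quadruples.\<close>
  define t where "t a b c = f a b c + f a c b + f b c a" for a b c
  have q1: "t x1 x2 x3 + t x1 x2 x4 + t x1 x3 x4 + t x2 x3 x4 = 2 * k1 + (2 * k2 + 1 + 2 * k3)"
    using arg_cong2[OF k1 arg_cong2[OF k2 k3, of "(+)"], of "(+)"] unfolding t_def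
    by (simp only: ac_simps)
  have q2: "t x1 x2 x3 + t x1 x2 x5 + t x1 x3 x5 + t x2 x3 x5 = 2 * k4 + (2 * k5 + 1 + 2 * k6)"
    using arg_cong2[OF k4 arg_cong2[OF k5 k6, of "(+)"], of "(+)"] unfolding t_def
    by (simp only: ac_simps)
  have q3: "t x1 x2 x4 + t x1 x2 x5 + t x1 x4 x5 + t x2 x4 x5 = 2 * k7 + (2 * k8 + 1 + 2 * k9)"
    using arg_cong2[OF k7 arg_cong2[OF k8 k9, of "(+)"], of "(+)"] unfolding t_def
    by (simp only: ac_simps)
  have q4: "t x1 x3 x4 + t x1 x3 x5 + t x1 x4 x5 + t x3 x4 x5 = 2 * m1 + (2 * m2 + 1 + 2 * m3)"
    using arg_cong2[OF m1 arg_cong2[OF m2 m3, of "(+)"], of "(+)"] unfolding t_def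
    by (simp only: ac_simps)
  have q5: "t x2 x3 x4 + t x2 x3 x5 + t x2 x4 x5 + t x3 x4 x5 = 2 * m4 + (2 * m5 + 1 + 2 * m6)"
    using arg_cong2[OF m4 arg_cong2[OF m5 m6, of "(+)"], of "(+)"] unfolding t_def
    by (simp only: ac_simps)
  define S where "S = t x1 x2 x3 + t x1 x2 x4 + t x1 x2 x5 + t x1 x3 x4 + t x1 x3 x5 + t x1 x4 x5
    + t x2 x3 x4 + t x2 x3 x5 + t x2 x4 x5 + t x3 x4 x5"
  have "S + S = 2 * k1 + (2 * k2 + 1 + 2 * k3) + (2 * k4 + (2 * k5 + 1 + 2 * k6) + (2 * k7 + (2 * k8 + 1 + 2 * k9)
     + (2 * m1 + (2 * m2 + 1 + 2 * m3) + (2 * m4 + (2 * m5 + 1 + 2 * m6)))))"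
    using arg_cong2[OF q1 arg_cong2[OF q2 arg_cong2[OF q3 arg_cong2[OF q4 q5, of "(+)"], of "(+)"], of "(+)"], of "(+)"]
    unfolding S_def by (simp only: ac_simps)
  then show False by presburger
qed

lemma K5_not_even:
  assumes g: "even_drawing \<phi> E" and W: "card W = 5"
    and E: "\<And>a b. a \<in> W \<Longrightarrow> b \<in> W \<Longrightarrow> a \<noteq> b \<Longrightarrow> {a,b} \<in> E"
  shows False
proof -
  define xs where "xs = sorted_list_of_set W"
  have fin: "finite W" using W by (metis card.infinite zero_neq_numeral)
  have len: "length xs = 5" and set: "set xs = W" and sd: "sorted_wrt (<) xs"
    using W fin by (auto simp: xs_def)
  from len obtain x1 x2 x3 x4 x5 where xs: "xs = [x1,x2,x3,x4,x5]"
    by (auto simp: numeral_eq_Suc length_Suc_conv)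
  show False
    by (rule K5_not_even_sorted[OF g, of x1 x2 x3 x4 x5]) (use sd set E in \<open>auto simp: xs\<close>)
qed

section \<open>Contraction and the linear edge bound\<close>

definition linear_bound :: "nat \<Rightarrow> nat \<Rightarrow> bool" where
  "linear_bound k A \<longleftrightarrow> (\<forall>\<phi> U V E. finite V \<longrightarrow> card U = k \<longrightarrow> U \<inter> V = {} \<longrightarrow>
     E \<subseteq> {e. e \<subseteq> V \<and> card e = 2} \<longrightarrow> even_drawing \<phi> (apex_join U V E) \<longrightarrow> card E \<le> A * card V)"

lemma linear_boundD:
  assumes "linear_bound k A" "finite V" "card U = k" "U \<inter> V = {}"
    "E \<subseteq> {e. e \<subseteq> V \<and> card e = 2}" "even_drawing \<phi> (apex_join U V E)"
  shows "card E \<le> A * card V"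
  using assms unfolding linear_bound_def by blast

text \<open>Three apices and the two ends of an edge of \<open>E\<close> are five mutually adjacent
  vertices, which an even drawing excludes. Hence \<open>E\<close> is empty and the recursion can
  start with the constant 0.\<close>

lemma linear_bound_3: "linear_bound 3 0"
proof -
  have False if fin: "finite V" and U: "card U = 3" and UV: "U \<inter> V = {}"
    and E: "E \<subseteq> {e. e \<subseteq> V \<and> card e = 2}" and g: "even_drawing \<phi> (apex_join U V E)" and e: "e \<in> E"
  for \<phi> U V E and e :: "real set"
  proof -
    have c: "card e = 2" "e \<subseteq> V" using E e by auto
    have "finite U" using U by (metis card.infinite zero_neq_numeral)
    moreover have "finite e" using c(1) by (metis card.infinite zero_neq_numeral)
    ultimately have "card (U \<union> e) = 5" using c U UV by (subst card_Un_disjoint) auto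
    then show False
    proof (rule K5_not_even[OF g])
      fix a b assume ab: "a \<in> U \<union> e" "b \<in> U \<union> e" "a \<noteq> b"
      consider "a \<in> U" | "b \<in> U" | "a \<in> e" "b \<in> e" using ab by auto
      then show "{a,b} \<in> apex_join U V E"
      proof cases
        case 1 then show ?thesis using ab c by (auto simp: apex_join_def)
      next
        case 2
        then have "{b,a} \<in> apex_join U V E" using ab c by (auto simp: apex_join_def)
        then show ?thesis by (simp add: insert_commute)
      next
        case 3
        then have "{a,b} = e" using c(1) ab(3) by (auto simp: card_2_iff)
        then show ?thesis using e by (auto simp: apex_join_def)
      qed
    qed
  qed
  then have "E = {}" if "finite V" "card U = 3" "U \<inter> V = {}"
    "E \<subseteq> {e. e \<subseteq> V \<and> card e = 2}" "even_drawing \<phi> (apex_join U V E)" for \<phi> U V and E :: "real set set"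
    using that by blast
  then show ?thesis unfolding linear_bound_def by (metis card.empty le0 mult_0)
qed

text \<open>The new edge \<open>vw\<close> runs along \<open>uv\<close> and then along \<open>uw\<close>, so that the parities add up.\<close>

lemma even_drawing_contract:
  assumes g: "even_drawing \<phi> (apex_join U V E)" and UV: "U \<inter> V = {}"
    and uv: "{u,v} \<in> E" "u \<noteq> v" and EV: "E \<subseteq> {e. e \<subseteq> V \<and> card e = 2}"
    and E': "E' = {e\<in>E. u \<notin> e} \<union> {{v,w} | w. {u,w} \<in> E \<and> w \<noteq> v}"
  shows "\<exists>\<phi>'. even_drawing \<phi>' (apex_join U (V - {u}) E')"
proof -
  define J where "J = apex_join U V E"
  \<comment> \<open>A pair that was an edge before keeps its values, also when \<open>v\<close> and
    \<open>w\<close> were already adjacent. For a new pair, \<open>insert u (e - {v})\<close>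
    recovers the edge from \<open>u\<close> to \<open>w\<close>.\<close>
  define \<phi>' where "\<phi>' e x = (if e \<in> J then \<phi> e x else (\<phi> (insert u (e - {v})) x \<noteq> \<phi> {u,v} x))" for e x
  have uvV: "u \<in> V" "v \<in> V" using uv EV by auto
  have J': "e \<in> J \<and> u \<notin> e \<or> e \<notin> J \<and> (\<exists>w. w \<in> V \<and> e = {v,w} \<and> {u,w} \<in> E \<and> w \<noteq> v \<and> w \<noteq> u)"
    if e: "e \<in> apex_join U (V - {u}) E'" for e
  proof -
    consider "e \<in> E" "u \<notin> e" | w where "e = {v,w}" "{u,w} \<in> E" "w \<noteq> v"
      | x y where "e = {x,y}" "x \<in> U" "y \<in> U \<union> (V - {u})" "x \<noteq> y"
      using e unfolding apex_join_def E' by blast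
    then show ?thesis
    proof cases
      case 1 then show ?thesis by (auto simp: J_def apex_join_def)
    next
      case 2
      then have "card {u,w} = 2" "{u,w} \<subseteq> V" using EV by auto
      then have "w \<in> V" "w \<noteq> u" by auto
      then show ?thesis using 2 uv by (cases "e \<in> J") auto
    next
      case 3
      then show ?thesis using UV uvV by (auto simp: J_def apex_join_def)
    qed
  qed
  have sym: "((btw a b c \<noteq> btw a b d) \<longleftrightarrow>
       ((\<phi>' {a,b} c \<noteq> \<phi>' {a,b} d) \<noteq> (\<phi>' {c,d} a \<noteq> \<phi>' {c,d} b)))"
    if d: "distinct [a,b,c,d]" and r: "((btw c d a \<noteq> btw c d b) \<longleftrightarrow>
       ((\<phi>' {c,d} a \<noteq> \<phi>' {c,d} b) \<noteq> (\<phi>' {a,b} c \<noteq> \<phi>' {a,b} d)))" for a b c d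
    using interleave_sym[OF d] r by argo
  \<comment> \<open>The conditions of \<open>{u,w}\<close> and of \<open>{u,v}\<close> against
    \<open>{c,d}\<close> are added; the terms that belong to \<open>u\<close> cancel.\<close>
  have new: "(btw c d a \<noteq> btw c d b) \<longleftrightarrow>
       ((\<phi>' {c,d} a \<noteq> \<phi>' {c,d} b) \<noteq> (\<phi>' {a,b} c \<noteq> \<phi>' {a,b} d))"
    if ab: "{a,b} \<notin> J" "{a,b} = {v,w}" "{u,w} \<in> E" "w \<noteq> v" "w \<noteq> u"
      and cd: "{c,d} \<in> J" "u \<notin> {c,d}" and dis: "distinct [a,b,c,d]" for a b c d w
  proof -
    have J: "{u,w} \<in> J" "{u,v} \<in> J" using ab uv by (auto simp: J_def apex_join_def)
    have vw: "a = v \<and> b = w \<or> a = w \<and> b = v" using ab(2) by (auto simp: doubleton_eq_iff)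
    have e1: "(btw c d u \<noteq> btw c d w) \<longleftrightarrow>
       ((\<phi> {c,d} u \<noteq> \<phi> {c,d} w) \<noteq> (\<phi> {u,w} c \<noteq> \<phi> {u,w} d))"
      by (rule even_drawingD[OF g]) (use J cd dis vw ab(5) in \<open>auto simp: J_def\<close>)
    have e2: "(btw c d u \<noteq> btw c d v) \<longleftrightarrow>
       ((\<phi> {c,d} u \<noteq> \<phi> {c,d} v) \<noteq> (\<phi> {u,v} c \<noteq> \<phi> {u,v} d))"
      by (rule even_drawingD[OF g]) (use J cd dis vw uv(2) in \<open>auto simp: J_def\<close>)
    have i: "insert u ({a,b} - {v}) = {u,w}" using vw ab(4) by auto
    have p: "\<phi>' {a,b} x = (\<phi> {u,w} x \<noteq> \<phi> {u,v} x)" for x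
      unfolding \<phi>'_def i using ab(1) by simp
    have q: "\<phi>' {c,d} x = \<phi> {c,d} x" for x unfolding \<phi>'_def using cd by simp
    show ?thesis unfolding p q using vw e1 e2 by (elim disjE conjE; hypsubst; argo)
  qed
  have "even_drawing \<phi>' (apex_join U (V - {u}) E')"
    unfolding even_drawing_def
  proof (intro allI impI)
    fix a b c d assume ab: "{a,b} \<in> apex_join U (V - {u}) E'" and cd: "{c,d} \<in> apex_join U (V - {u}) E'"
      and dis: "distinct [a,b,c,d]"
    have dis': "distinct [c,d,a,b]" using dis by auto
    show "(btw a b c \<noteq> btw a b d) \<longleftrightarrow>
       ((\<phi>' {a,b} c \<noteq> \<phi>' {a,b} d) \<noteq> (\<phi>' {c,d} a \<noteq> \<phi>' {c,d} b))"
    proof (cases "{a,b} \<in> J")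
      case True
      show ?thesis
      proof (cases "{c,d} \<in> J")
        case T: True
        then show ?thesis using even_drawingD[OF g _ _ dis] True unfolding J_def \<phi>'_def by simp
      next
        case False
        then obtain w where "{c,d} = {v,w}" "{u,w} \<in> E" "w \<noteq> v" "w \<noteq> u" using J'[OF cd] by blast
        moreover have "u \<notin> {a,b}" using J'[OF ab] True by blast
        ultimately show ?thesis using new[of c d w a b] False True dis' by blast
      qed
    next
      case False
      then obtain w where w: "{a,b} = {v,w}" "{u,w} \<in> E" "w \<noteq> v" "w \<noteq> u" using J'[OF ab] by blast
      \<comment> \<open>Two new edges share the vertex \<open>v\<close>, so they are never
        compared.\<close>
      have "{c,d} \<in> J"
      proof (rule ccontr)
        assume "{c,d} \<notin> J"
        then obtain w' where "{c,d} = {v,w'}" using J'[OF cd] by blast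
        then show False using w(1) dis by (auto simp: doubleton_eq_iff)
      qed
      moreover have "u \<notin> {c,d}" using J'[OF cd] calculation by blast
      ultimately show ?thesis using sym[OF dis] new[of a b w c d] False w dis by blast
    qed
  qed
  then show ?thesis by blast
qed

text \<open>Besides \<open>uv\<close> itself, contraction loses an edge only where \<open>uw\<close>
  and \<open>vw\<close> are merged, that is, once for each common neighbour
  \<open>w\<close>.\<close>

lemma card_contract:
  assumes fin: "finite E" and uv: "{u,v} \<in> E" "u \<noteq> v"
    and c2: "\<And>e. e \<in> E \<Longrightarrow> card e = 2"
    and E': "E' = {e\<in>E. u \<notin> e} \<union> {{v,w} | w. {u,w} \<in> E \<and> w \<noteq> v}"
  shows "card E \<le> card E' + 1 + card {w. {u,w} \<in> E \<and> {v,w} \<in> E}"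
proof -
  define C where "C = {w. {u,w} \<in> E \<and> {v,w} \<in> E}"
  define N where "N = {w. {u,w} \<in> E \<and> w \<noteq> v \<and> w \<notin> C}"
  have fW: "finite {w. {u,w} \<in> E}"
    by (rule finite_subset[of _ "\<Union>E"])
      (use fin c2 in \<open>auto intro!: finite_Union intro: card_ge_0_finite\<close>)
  have fC: "finite C" "finite N" using fW by (auto simp: C_def N_def)
  have sub: "{e\<in>E. u \<in> e} \<subseteq> (\<lambda>w. {u,w}) ` (N \<union> C \<union> {v})"
  proof
    fix e assume "e \<in> {e\<in>E. u \<in> e}"
    then have "e \<in> E" "u \<in> e" by auto
    moreover obtain w where "e = {u,w}" using c2[OF \<open>e \<in> E\<close>] \<open>u \<in> e\<close> by (auto simp: card_2_iff)
    ultimately show "e \<in> (\<lambda>w. {u,w}) ` (N \<union> C \<union> {v})" by (auto simp: N_def)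
  qed
  have 1: "card {e\<in>E. u \<in> e} \<le> card N + card C + 1"
  proof -
    have "card {e\<in>E. u \<in> e} \<le> card (N \<union> C \<union> {v})"
      using surj_card_le[OF _ sub] fC by simp
    also have "\<dots> \<le> card N + card C + 1"
      by (metis card_Un_le le_trans add_le_mono1 is_singletonI is_singleton_altdef)
    finally show ?thesis .
  qed
  have inj: "inj_on (\<lambda>w. {v,w}) N" by (auto simp: inj_on_def doubleton_eq_iff)
  have disj: "{e\<in>E. u \<notin> e} \<inter> (\<lambda>w. {v,w}) ` N = {}" by (auto simp: N_def C_def)
  have "finite E'"
  proof -
    have "{{v,w} | w. {u,w} \<in> E \<and> w \<noteq> v} \<subseteq> (\<lambda>w. {v,w}) ` {w. {u,w} \<in> E}" by auto
    then show ?thesis unfolding E' using fin fW by (auto intro: finite_subset)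
  qed
  moreover have "{e\<in>E. u \<notin> e} \<union> (\<lambda>w. {v,w}) ` N \<subseteq> E'" unfolding E' by (auto simp: N_def)
  ultimately have "card ({e\<in>E. u \<notin> e} \<union> (\<lambda>w. {v,w}) ` N) \<le> card E'" by (rule card_mono)
  then have 2: "card {e\<in>E. u \<notin> e} + card N \<le> card E'"
    using disj fin fC by (subst (asm) card_Un_disjoint) (auto simp: card_image[OF inj])
  have "E = {e\<in>E. u \<notin> e} \<union> {e\<in>E. u \<in> e}" by auto
  then have "card E \<le> card {e\<in>E. u \<notin> e} + card {e\<in>E. u \<in> e}" by (metis card_Un_le)
  then show ?thesis using 1 2 unfolding C_def by linarith
qed

lemma min_degree_card_edges:
  assumes fin: "finite N" and H: "H \<subseteq> {e. e \<subseteq> N \<and> card e = 2}"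
    and deg: "\<And>v. v \<in> N \<Longrightarrow> A \<le> card {w. {v,w} \<in> H}"
  shows "A * card N \<le> 2 * card H"
proof -
  have fH: "finite H" using H fin by (auto intro: finite_subset[of _ "Pow N"])
  define P where "P = (SIGMA v:N. {w. {v,w} \<in> H})"
  have fw: "finite {w. {v,w} \<in> H}" for v
    by (rule finite_subset[OF _ fin]) (use H in auto)
  have "card P = (\<Sum>v\<in>N. card {w. {v,w} \<in> H})"
    unfolding P_def using fin fw by (subst card_SigmaI) auto
  also have "\<dots> \<ge> (\<Sum>v\<in>N. A)" by (rule sum_mono) (use deg in auto)
  finally have 1: "A * card N \<le> card P" by (simp add: mult.commute)
  have "P \<subseteq> (\<Union>e\<in>H. {(a,b). e = {a,b}})" by (auto simp: P_def)
  moreover have b: "finite {(a,b). e = {a,b}} \<and> card {(a,b). e = {a,b}} \<le> 2" if "e \<in> H" for e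
  proof -
    have "card e = 2" using H that by auto
    then obtain x y where "e = {x,y}" by (auto simp: card_2_iff)
    then have s: "{(a,b). e = {a,b}} \<subseteq> {(x,y),(y,x)}" by (auto simp: doubleton_eq_iff)
    show ?thesis
    proof
      show "finite {(a,b). e = {a,b}}" by (rule finite_subset[OF s]) simp
      have "card {(x,y),(y,x)} \<le> 2" by (cases "x = y") auto
      then show "card {(a,b). e = {a,b}} \<le> 2" by (rule le_trans[OF card_mono[OF _ s], rotated]) simp
    qed
  qed
  ultimately have "card P \<le> card (\<Union>e\<in>H. {(a,b). e = {a,b}})"
    using fH by (intro card_mono) auto
  also have "\<dots> \<le> (\<Sum>e\<in>H. card {(a,b). e = {a,b}})" by (rule card_UN_le[OF fH])
  also have "\<dots> \<le> (\<Sum>e\<in>H. 2)" by (rule sum_mono) (use b in auto)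
  finally show ?thesis using 1 by simp
qed

text \<open>In a minimal counterexample contraction shows that each edge lies in at least \<open>A\<close> triangles. Then the
  neighbourhood of a vertex \<open>u\<close> is a graph of minimum degree \<open>A\<close>, and \<open>u\<close> serves as a
  further apex vertex for it.\<close>

lemma linear_bound_step:
  assumes b: "linear_bound (Suc k) a" and A: "2 * a < A"
  shows "linear_bound k A"
proof -
  have "card E \<le> A * card V"
    if fin: "finite V" and U: "card U = k" and UV: "U \<inter> V = {}"
      and EV: "E \<subseteq> {e. e \<subseteq> V \<and> card e = 2}" and g: "even_drawing \<phi> (apex_join U V E)" and "finite U"
    for \<phi> U V E
    using that
  proof (induction "card V" arbitrary: V E \<phi> rule: less_induct)
    case less
    show ?case
    proof (rule ccontr)
      assume "\<not> ?thesis"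
      then have big: "card E > A * card V" by simp
      have fE: "finite E" using less.prems by (auto intro: finite_subset[of _ "Pow V"])
      have common: "A \<le> card {w. {u,w} \<in> E \<and> {v,w} \<in> E}" if uv: "{u,v} \<in> E" for u v
      proof -
        have ne: "u \<noteq> v" using uv less.prems(4) by auto
        have uV: "u \<in> V" "v \<in> V" using uv less.prems(4) by auto
        define E' where "E' = {e\<in>E. u \<notin> e} \<union> {{v,w} | w. {u,w} \<in> E \<and> w \<noteq> v}"
        obtain \<phi>' where p: "even_drawing \<phi>' (apex_join U (V - {u}) E')"
          using even_drawing_contract[OF less.prems(5,3) uv ne less.prems(4) E'_def] by blast
        have "card E' \<le> A * card (V - {u})"
        proof (rule less.hyps)
          show "card (V - {u}) < card V" using uV less.prems(1) by (metis card_Diff1_less)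
          show "E' \<subseteq> {e. e \<subseteq> V - {u} \<and> card e = 2}"
          proof
            fix e assume "e \<in> E'"
            then consider "e \<in> E" "u \<notin> e" | w where "e = {v,w}" "{u,w} \<in> E" "w \<noteq> v"
              unfolding E'_def by blast
            then show "e \<in> {e. e \<subseteq> V - {u} \<and> card e = 2}"
            proof cases
              case 1 then show ?thesis using less.prems(4) by auto
            next
              case 2
              then have "{u,w} \<subseteq> V" "card {u,w} = 2" using less.prems(4) by auto
              then show ?thesis using 2 uV ne by auto
            qed
          qed
        qed (use less.prems p in auto)
        moreover have "card V > 0" using uV less.prems(1) by (auto simp: card_gt_0_iff)
        moreover have "card (V - {u}) = card V - 1" using uV less.prems(1) by simp
        moreover have "card E \<le> card E' + 1 + card {w. {u,w} \<in> E \<and> {v,w} \<in> E}"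
          by (rule card_contract[OF fE uv ne _ E'_def]) (use less.prems(4) in auto)
        moreover have "A * card V = A * (card V - 1) + A"
          using \<open>card V > 0\<close> by (metis Suc_diff_1 mult_Suc_right add.commute)
        ultimately show ?thesis using big by simp
      qed
      obtain e where e: "e \<in> E" using big by (metis all_not_in_conv card.empty not_less_zero)
      then have "card e = 2" using less.prems(4) by auto
      then obtain u v where uv: "e = {u,v}" "u \<noteq> v" by (auto simp: card_2_iff)
      define N where "N = {w. {u,w} \<in> E}"
      define H where "H = {e\<in>E. e \<subseteq> N}"
      have NV: "N \<subseteq> V" using less.prems(4) by (auto simp: N_def)
      have uN: "u \<notin> N" using less.prems(4) by (auto simp: N_def)
      have uV: "u \<in> V" using e uv less.prems(4) by auto
      have fN: "finite N" using NV less.prems(1) finite_subset by blast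
      have "card H \<le> a * card N"
      proof -
        have J: "apex_join (insert u U) N H \<subseteq> apex_join U V E"
        proof
          fix f assume "f \<in> apex_join (insert u U) N H"
          then consider "f \<in> E" | x y where "f = {x,y}" "x \<in> insert u U" "y \<in> insert u U \<union> N" "x \<noteq> y"
            unfolding apex_join_def H_def by blast
          then show "f \<in> apex_join U V E"
          proof cases
            case 1 then show ?thesis by (auto simp: apex_join_def)
          next
            case 2
            consider "x \<in> U" | "y \<in> U" | "x = u" "y \<in> N" using 2 by auto
            then show ?thesis
            proof cases
              case 1 then show ?thesis using 2 NV uV by (auto simp: apex_join_def)
            next
              case a: 2
              have "f = {y,x}" using 2 by auto
              then show ?thesis using a 2 uV by (auto simp: apex_join_def)
            next
              case 3 then show ?thesis using 2 by (auto simp: apex_join_def N_def)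
            qed
          qed
        qed
        have "u \<notin> U" using uV less.prems(3) by auto
        then have "card (insert u U) = Suc k" using less.prems by simp
        moreover have "insert u U \<inter> N = {}" using uN NV less.prems(3) by auto
        moreover have "H \<subseteq> {e. e \<subseteq> N \<and> card e = 2}" using less.prems(4) by (auto simp: H_def)
        ultimately show ?thesis
          using b fN even_drawing_mono[OF less.prems(5) J] unfolding linear_bound_def by blast
      qed
      moreover have "A * card N \<le> 2 * card H"
      proof (rule min_degree_card_edges[OF fN])
        show "H \<subseteq> {e. e \<subseteq> N \<and> card e = 2}" using less.prems(4) by (auto simp: H_def)
        fix w assume w: "w \<in> N"
        then have "A \<le> card {x. {u,x} \<in> E \<and> {w,x} \<in> E}" using common by (auto simp: N_def)
        also have "{x. {u,x} \<in> E \<and> {w,x} \<in> E} = {x. {w,x} \<in> H}"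
          using w by (auto simp: H_def N_def)
        finally show "A \<le> card {x. {w,x} \<in> H}" .
      qed
      moreover have "v \<in> N" using e uv by (simp add: N_def)
      then have "card N > 0" using fN by (auto simp: card_gt_0_iff)
      ultimately have "A * card N \<le> (2 * a) * card N" by linarith
      then show False using A \<open>card N > 0\<close> by simp
    qed
  qed
  note * = this
  have "card E \<le> A * card V"
    if "finite V" "card U = k" "U \<inter> V = {}"
      "E \<subseteq> {e. e \<subseteq> V \<and> card e = 2}" "even_drawing \<phi> (apex_join U V E)" for \<phi> U V E
  proof (cases "finite U")
    case True then show ?thesis using * that by blast
  next
    case False
    \<comment> \<open>An infinite \<open>U\<close> has cardinality 0 by convention and would slip
      through as "no apices". Evenness passes to fewer edges, so \<open>U\<close> may be replaced by
      the empty set.\<close>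
    then have "k = 0" using that by auto
    moreover have "even_drawing \<phi> (apex_join {} V E)"
      by (rule even_drawing_mono[OF that(5)]) (auto simp: apex_join_def)
    ultimately show ?thesis using *[of V "{}" E \<phi>] that by auto
  qed
  then show ?thesis unfolding linear_bound_def by blast
qed

theorem even_drawing_card_edges:
  assumes "finite V" "E \<subseteq> {e. e \<subseteq> V \<and> card e = 2}" "even_drawing \<phi> E"
  shows "card E \<le> 7 * card V"
proof -
  \<comment> \<open>Each new constant has to exceed twice the preceding one, which gives 0, 1, 3, 7
    as the apices are used up.\<close>
  have "linear_bound 2 1" using linear_bound_step[of 2 0 1] linear_bound_3 by (simp add: numeral_3_eq_3 numeral_2_eq_2)
  then have "linear_bound 1 3" using linear_bound_step[of 1 1 3] by (simp add: numeral_2_eq_2)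
  then have "linear_bound 0 7" using linear_bound_step[of 0 3 7] by simp
  then have "card E \<le> 7 * card V"
    if "even_drawing \<phi> (apex_join {} V E)"
    using linear_boundD[OF _ assms(1) _ _ assms(2) that, of 0 7] by simp
  moreover have "apex_join {} V E = E" by (auto simp: apex_join_def)
  ultimately show ?thesis using assms(3) by simp
qed

section \<open>Arcs and Jordan curves\<close>

definition is_arc :: "complex set \<Rightarrow> complex \<Rightarrow> complex \<Rightarrow> bool" where
  "is_arc S a b \<longleftrightarrow> (\<exists>g. arc g \<and> path_image g = S \<and> pathstart g = a \<and> pathfinish g = b)"

definition jordan :: "complex set \<Rightarrow> bool" where
  "jordan C \<longleftrightarrow> (\<exists>g. simple_path g \<and> pathfinish g = pathstart g \<and> path_image g = C)"

text \<open>With sides indexed by a Boolean, complementing is negation, and inside and outside are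
  treated by the same arguments. Boundedness matters only where theta curves or winding numbers
  enter.\<close>

definition side :: "bool \<Rightarrow> complex set \<Rightarrow> complex set" where
  "side b C = (if b then inside C else outside C)"

text \<open>Both curves are required to change sides, which makes the relation symmetric at once. On
  the sphere this is available because crossing is demanded for both orders of a pair.\<close>

definition cross :: "complex set \<Rightarrow> complex set \<Rightarrow> bool" where
  "cross C D \<longleftrightarrow> jordan C \<and> jordan D \<and> card (C \<inter> D) = 2 \<and>
     (\<forall>b. \<not> C - D \<subseteq> side b D) \<and> (\<forall>b. \<not> D - C \<subseteq> side b C)"

lemma cross_sym: "cross C D \<Longrightarrow> cross D C"
  unfolding cross_def by (auto simp: Int_commute)

lemma is_arc_interval:
  fixes g :: "real \<Rightarrow> complex"
  assumes "x < y" "continuous_on {x..y} g" "inj_on g {x..y}"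
  shows "is_arc (g ` {x..y}) (g x) (g y)"
proof -
  define h where "h t = g (x + (y - x) * t)" for t :: real
  have im: "(\<lambda>t. x + (y - x) * t) ` {0..1} = {x..y}"
    using image_affinity_atLeastAtMost[of "y - x" x 0 1] assms(1) by (simp add: add.commute)
  have "continuous_on {0..1} h"
    unfolding h_def
    by (rule continuous_on_compose2[OF assms(2)]) (use im in \<open>auto intro!: continuous_intros\<close>)
  moreover have "inj_on h {0..1}"
    unfolding h_def
    using comp_inj_on[of "\<lambda>t. x + (y - x) * t" "{0..1}" g] assms im
    by (auto simp: inj_on_def o_def)
  moreover have "h ` {0..1} = g ` {x..y}"
    unfolding h_def using im by (metis image_image)
  moreover have "h 0 = g x" "h 1 = g y" by (auto simp: h_def)
  ultimately show ?thesis
    unfolding is_arc_def arc_def path_def path_image_def pathstart_def pathfinish_def by blast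
qed

lemma is_arcE:
  assumes "is_arc S a b"
  obtains g where "continuous_on {0..1::real} g" "inj_on g {0..1}" "g ` {0..1} = S" "g 0 = a" "g 1 = b"
  using assms unfolding is_arc_def arc_def path_def path_image_def pathstart_def pathfinish_def by blast

lemma is_arc_sym: "is_arc S a b \<Longrightarrow> is_arc S b a"
  unfolding is_arc_def by (metis arc_reversepath path_image_reversepath pathfinish_reversepath pathstart_reversepath)

lemma is_arc_ends: "is_arc S a b \<Longrightarrow> a \<in> S \<and> b \<in> S \<and> a \<noteq> b"
  unfolding is_arc_def by (metis arc_distinct_ends pathfinish_in_path_image pathstart_in_path_image)

lemma is_arc_compact: "is_arc S a b \<Longrightarrow> compact S"
  unfolding is_arc_def by (metis arc_imp_path compact_path_image)

lemma is_arc_connected: "is_arc S a b \<Longrightarrow> connected S"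
  unfolding is_arc_def by (metis arc_imp_path connected_path_image)

lemma is_arc_join:
  assumes "is_arc S a b" "is_arc T b c" "S \<inter> T = {b}"
  shows "is_arc (S \<union> T) a c"
proof -
  obtain g h where g: "arc g" "path_image g = S" "pathstart g = a" "pathfinish g = b"
    and h: "arc h" "path_image h = T" "pathstart h = b" "pathfinish h = c"
    using assms unfolding is_arc_def by blast
  have "arc (g +++ h)" by (rule arc_join) (use g h assms in auto)
  moreover have "path_image (g +++ h) = S \<union> T" by (subst path_image_join) (use g h in auto)
  ultimately show ?thesis unfolding is_arc_def using g h by (metis pathfinish_join pathstart_join)
qed

lemma is_arc_minus_connected:
  assumes "is_arc S a b"
  shows "connected (S - {a})" "connected (S - {b})" "connected (S - {a,b})"
proof -
  obtain g where g: "continuous_on {0..1::real} g" "inj_on g {0..1}" "g ` {0..1} = S" "g 0 = a" "g 1 = b"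
    using is_arcE[OF assms] by blast
  have *: "g ` (({0..1}) - X) = S - g ` X" if "X \<subseteq> {0..1}" for X
    using g(2,3) that by (metis inj_on_image_set_diff order_refl Diff_subset)
  have "{0..1} - {0} = {0<..1::real}" "{0..1} - {1} = {0..<1::real}" "{0..1} - {0,1} = {0<..<1::real}"
    by auto
  then have "g ` {0<..1} = S - {a}" "g ` {0..<1} = S - {b}" "g ` {0<..<1} = S - {a,b}"
    using *[of "{0}"] *[of "{1}"] *[of "{0,1}"] g(4,5) by simp_all
  moreover have "connected (g ` {0<..1})" "connected (g ` {0..<1})" "connected (g ` {0<..<1})"
    by (intro connected_continuous_image continuous_on_subset[OF g(1)]; auto)+
  ultimately show "connected (S - {a})" "connected (S - {b})" "connected (S - {a,b})" by simp_all
qed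

lemma is_arc_split:
  assumes "is_arc S a b" "m \<in> S" "m \<noteq> a" "m \<noteq> b"
  obtains X Y where "is_arc X a m" "is_arc Y m b" "X \<union> Y = S" "X \<inter> Y = {m}"
proof -
  obtain g where g: "continuous_on {0..1::real} g" "inj_on g {0..1}" "g ` {0..1} = S" "g 0 = a" "g 1 = b"
    using is_arcE[OF assms(1)] by blast
  obtain t where t: "t \<in> {0..1}" "m = g t" using g assms(2) by auto
  have t': "0 < t" "t < 1" using t g assms(3,4) by (auto simp: less_le)
  show ?thesis
  proof (rule that[of "g ` {0..t}" "g ` {t..1}"])
    have "continuous_on {0..t} g" "continuous_on {t..1} g" "inj_on g {0..t}" "inj_on g {t..1}"
      using t' by (auto intro: continuous_on_subset[OF g(1)] inj_on_subset[OF g(2)])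
    then show "is_arc (g ` {0..t}) a m" "is_arc (g ` {t..1}) m b"
      using is_arc_interval[of 0 t g] is_arc_interval[of t 1 g] t' t g(4,5) by auto
    show "g ` {0..t} \<union> g ` {t..1} = S" using t' g(3) by (auto simp flip: image_Un simp: ivl_disj_un)
    have "g ` ({0..t} \<inter> {t..1}) = g ` {0..t} \<inter> g ` {t..1}"
      by (rule inj_on_image_Int[OF g(2)]) (use t' in auto)
    moreover have "{0..t} \<inter> {t..1} = {t}" using t' by auto
    ultimately show "g ` {0..t} \<inter> g ` {t..1} = {m}" using t by simp
  qed
qed

text \<open>A point of \<open>Y\<close> missing from \<open>X\<close> would cut \<open>Y\<close>
  into two closed pieces, each containing an end of the connected set \<open>X\<close>, with no
  common point in \<open>X\<close>.\<close>

lemma is_arc_subset_eq: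
  assumes "is_arc X p q" "is_arc Y p q" "X \<subseteq> Y"
  shows "X = Y"
proof (rule ccontr)
  assume "X \<noteq> Y"
  then obtain m where m: "m \<in> Y" "m \<notin> X" using assms(3) by auto
  have "m \<noteq> p" "m \<noteq> q" using m is_arc_ends[OF assms(1)] by auto
  then obtain U V where UV: "is_arc U p m" "is_arc V m q" "U \<union> V = Y" "U \<inter> V = {m}"
    using is_arc_split[OF assms(2)] m by metis
  have "closed U" "closed V" using UV is_arc_compact compact_imp_closed by blast+
  moreover have "X \<subseteq> U \<union> V" "U \<inter> V \<inter> X = {}" using UV m assms(3) by auto
  ultimately have "U \<inter> X = {} \<or> V \<inter> X = {}"
    using is_arc_connected[OF assms(1)] unfolding connected_closed by blast
  then show False using is_arc_ends[OF assms(1)] is_arc_ends[OF UV(1)] is_arc_ends[OF UV(2)] by auto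
qed

lemma jordan_two_arcs:
  assumes "jordan C" "p \<in> C" "q \<in> C" "p \<noteq> q"
  obtains X Y where "is_arc X p q" "is_arc Y p q" "X \<union> Y = C" "X \<inter> Y = {p,q}"
proof -
  obtain g where g: "simple_path g" "pathfinish g = pathstart g" "path_image g = C"
    using assms(1) unfolding jordan_def by blast
  obtain u d where ud: "arc u" "arc d" "pathstart u = p" "pathfinish u = q" "pathstart d = q" "pathfinish d = p"
    "(path_image u) \<inter> (path_image d) = {p,q}" "(path_image u) \<union> (path_image d) = path_image g"
    by (rule exists_double_arc[OF g(1,2), of p q]) (use assms g(3) in auto)
  then have "is_arc (path_image u) p q" "is_arc (path_image d) q p" unfolding is_arc_def by auto
  then show ?thesis using that[of "path_image u" "path_image d"] is_arc_sym ud g(3) by auto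
qed

lemma jordan_join:
  assumes "is_arc X p q" "is_arc Y p q" "X \<inter> Y = {p,q}"
  shows "jordan (X \<union> Y)"
proof -
  obtain g h where g: "arc g" "path_image g = X" "pathstart g = p" "pathfinish g = q"
    and h: "arc h" "path_image h = Y" "pathstart h = q" "pathfinish h = p"
    using assms(1) is_arc_sym[OF assms(2)] unfolding is_arc_def by blast
  have "simple_path (g +++ h)" by (rule simple_path_join_loop) (use g h assms in auto)
  moreover have "path_image (g +++ h) = X \<union> Y" by (subst path_image_join) (use g h in auto)
  ultimately show ?thesis unfolding jordan_def using g h by (metis pathfinish_join pathstart_join)
qed

lemma jordan_compact: "jordan C \<Longrightarrow> compact C"
  unfolding jordan_def by (metis compact_path_image simple_path_imp_path)

lemma jordan_connected: "jordan C \<Longrightarrow> connected C"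
  unfolding jordan_def by (metis connected_path_image simple_path_imp_path)

lemma side_Un: "side b C \<union> side (\<not> b) C = - C"
  by (cases b) (auto simp: side_def inside_Un_outside Un_commute)

lemma side_Int: "side b C \<inter> side (\<not> b) C = {}"
  by (cases b) (auto simp: side_def inside_Int_outside Int_commute)

lemma side_disjoint: "side b C \<inter> C = {}"
  by (auto simp: side_def inside_no_overlap outside_no_overlap)

lemma not_in_side: "x \<notin> C \<Longrightarrow> x \<notin> side b C \<longleftrightarrow> x \<in> side (\<not> b) C"
  using side_Un[of b C] side_Int[of b C] by auto

lemma in_side_not: "x \<in> side b C \<Longrightarrow> x \<notin> C" "x \<in> side b C \<Longrightarrow> x \<notin> side (\<not> b) C"
  using side_disjoint[of b C] side_Int[of b C] by auto

lemma side_cases: obtains "x \<in> C" | b where "x \<in> side b C"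
  using side_Un[of True C] by auto

lemma jordan_side:
  assumes "jordan C"
  shows "open (side b C)" "connected (side b C)" "side b C \<noteq> {}" "frontier (side b C) = C"
    "closure (side b C) = side b C \<union> C" "closed (side b C \<union> C)"
proof -
  obtain g where g: "simple_path g" "pathfinish g = pathstart g" "path_image g = C"
    using assms unfolding jordan_def by blast
  show 1: "open (side b C)" "connected (side b C)" "side b C \<noteq> {}" "frontier (side b C) = C"
    using Jordan_inside_outside[OF g(1,2)] g(3) by (auto simp: side_def)
  show "closure (side b C) = side b C \<union> C" using 1 by (simp add: closure_Un_frontier)
  then show "closed (side b C \<union> C)" by (metis closed_closure)
qed

lemma connected_subset_side:
  assumes "jordan C" "connected T" "T \<inter> C = {}" "x \<in> T" "x \<in> side b C"
  shows "T \<subseteq> side b C"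
proof -
  have "T \<subseteq> side b C \<union> side (\<not> b) C" using assms(3) side_Un[of b C] by auto
  then have "side b C \<inter> T = {} \<or> side (\<not> b) C \<inter> T = {}"
    using assms(2) jordan_side(1)[OF assms(1)] side_Int[of b C] unfolding connected_def by blast
  then show ?thesis using assms(4,5) \<open>T \<subseteq> _\<close> by auto
qed

lemma connected_in_some_side:
  assumes "jordan C" "connected T" "T \<inter> C = {}"
  shows "\<exists>b. T \<subseteq> side b C"
proof (cases "T = {}")
  case False
  then obtain x where "x \<in> T" by auto
  moreover obtain b where "x \<in> side b C" using side_cases[of x C] assms(3) \<open>x \<in> T\<close> by auto
  ultimately show ?thesis using connected_subset_side[OF assms] by blast
qed auto

lemma crossD:
  assumes "cross A D"
  shows "jordan A" "jordan D" "\<not> A - D \<subseteq> side b D" "A \<inter> side b D \<noteq> {}"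
proof -
  show *: "jordan A" "jordan D" "\<not> A - D \<subseteq> side b D" for b using assms unfolding cross_def by blast+
  show "A \<inter> side b D \<noteq> {}" using *(3)[of "\<not> b"] side_Un[of b D] by auto
qed

lemma card2E: assumes "card S = 2" "p \<in> S" obtains q where "S = {p,q}" "p \<noteq> q"
  using assms by (metis card_2_iff doubleton_eq_iff insert_iff singletonD)

lemma cross_points: assumes "cross A D" obtains p q where "A \<inter> D = {p,q}" "p \<noteq> q"
  using assms unfolding cross_def by (metis card_2_iff)

text \<open>Each of the two arcs of \<open>A\<close> between \<open>p\<close> and \<open>q\<close>
  avoids \<open>D\<close> in its interior and so stays on one side. They cannot share a side because
  \<open>A\<close> crosses \<open>D\<close>; hence each closed side receives exactly one of
  them.\<close>

lemma cross_arc: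
  assumes c: "cross A D" and pq: "A \<inter> D = {p,q}"
  shows "is_arc (A \<inter> (side b D \<union> D)) p q"
proof -
  note J = crossD[OF c]
  have ne: "p \<noteq> q" using c pq unfolding cross_def by auto
  obtain X Y where XY: "is_arc X p q" "is_arc Y p q" "X \<union> Y = A" "X \<inter> Y = {p,q}"
    using jordan_two_arcs[OF J(1), of p q] pq ne by blast
  have *: "\<exists>b. Z - {p,q} \<subseteq> side b D" if "is_arc Z p q" "Z \<subseteq> A" for Z
    using connected_in_some_side[OF J(2) is_arc_minus_connected(3)[OF that(1)]] pq that(2) by blast
  obtain x y where x: "X - {p,q} \<subseteq> side x D" and y: "Y - {p,q} \<subseteq> side y D" using *[OF XY(1)] *[OF XY(2)] XY(3) by blast
  have "x \<noteq> y"
  proof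
    assume "x = y"
    have "z \<in> side x D" if "z \<in> A - D" for z
    proof -
      have "z \<in> X \<union> Y" "z \<notin> {p,q}" using that unfolding XY(3) pq[symmetric] by simp_all
      then show ?thesis using x y unfolding \<open>x = y\<close> by auto
    qed
    then have "A - D \<subseteq> side x D" by blast
    then show False using J(3) by blast
  qed
  have m: "A \<inter> (side z D \<union> D) = Z"
    if "Z - {p,q} \<subseteq> side z D" "W - {p,q} \<subseteq> side (\<not> z) D" "Z \<union> W = A" "Z \<inter> W = {p,q}" for z Z W
  proof
    show "A \<inter> (side z D \<union> D) \<subseteq> Z"
    proof
      fix v assume v: "v \<in> A \<inter> (side z D \<union> D)"
      show "v \<in> Z"
      proof (rule ccontr)
        assume n: "v \<notin> Z"
        then have "v \<in> W" "v \<notin> {p,q}" using v that(3,4) by auto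
        then have "v \<in> side (\<not> z) D" using that(2) by auto
        then show False using v in_side_not[of v "\<not> z" D] by auto
      qed
    qed
    show "Z \<subseteq> A \<inter> (side z D \<union> D)"
    proof
      fix v assume v: "v \<in> Z"
      have "v \<in> A" using v that(3) by auto
      moreover have "v \<in> side z D \<union> D"
      proof (cases "v \<in> {p,q}")
        case True then show ?thesis using pq by (metis IntD2 UnI2)
      next
        case False then show ?thesis using that(1) v by auto
      qed
      ultimately show "v \<in> A \<inter> (side z D \<union> D)" by simp
    qed
  qed
  have "b = x \<or> b = y" using \<open>x \<noteq> y\<close> by auto
  then show ?thesis
  proof
    assume b: "b = x"
    then have "y = (\<not> b)" using \<open>x \<noteq> y\<close> by auto
    then have "A \<inter> (side b D \<union> D) = X" using m[of X b Y] x y b XY(3,4) by simp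
    then show ?thesis using XY(1) by simp
  next
    assume b: "b = y"
    then have "x = (\<not> b)" using \<open>x \<noteq> y\<close> by auto
    then have "A \<inter> (side b D \<union> D) = Y" using m[of Y b X] x y b XY(3,4) by (simp add: Un_commute Int_commute)
    then show ?thesis using XY(2) by simp
  qed
qed

lemma closure_side_Un: "A \<inter> (side b D \<union> D) \<union> A \<inter> (side (\<not> b) D \<union> D) = A"
  using side_Un[of b D] by auto

lemma closure_side_Int: "A \<inter> (side b D \<union> D) \<inter> (A \<inter> (side (\<not> b) D \<union> D)) = A \<inter> D"
  using side_Int[of b D] by auto

section \<open>Theta curves and lunes\<close>

definition "theta c1 c2 c a b \<longleftrightarrow> is_arc c1 a b \<and> is_arc c2 a b \<and> is_arc c a b \<and>
   c1 \<inter> c2 = {a,b} \<and> c1 \<inter> c = {a,b} \<and> c2 \<inter> c = {a,b}"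

lemma thetaD:
  assumes "theta c1 c2 c a b"
  shows "is_arc c1 a b" "is_arc c2 a b" "is_arc c a b" "c1 \<inter> c2 = {a,b}" "c1 \<inter> c = {a,b}" "c2 \<inter> c = {a,b}"
    "jordan (c1 \<union> c2)" "jordan (c1 \<union> c)" "jordan (c2 \<union> c)"
  using assms jordan_join unfolding theta_def by auto

lemma is_arc_third_point: assumes "is_arc c a b" shows "c - {a,b} \<noteq> {}"
proof -
  obtain g where g: "continuous_on {0..1::real} g" "inj_on g {0..1}" "g ` {0..1} = c" "g 0 = a" "g 1 = b"
    using is_arcE[OF assms] by blast
  have "g (1/2) \<in> c" using g(3) by auto
  moreover have "g (1/2) \<noteq> a" "g (1/2) \<noteq> b" using inj_onD[OF g(2), of "1/2" 0] inj_onD[OF g(2), of "1/2" 1] g(4,5) by auto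
  ultimately show ?thesis by auto
qed

lemma theta_split_inside:
  assumes th: "theta c1 c2 c a b" and cin: "c - {a,b} \<subseteq> inside (c1 \<union> c2)"
  shows "inside (c1 \<union> c) \<inter> inside (c2 \<union> c) = {}"
    "inside (c1 \<union> c) \<union> inside (c2 \<union> c) \<union> (c - {a,b}) = inside (c1 \<union> c2)"
proof -
  note t = thetaD[OF th]
  obtain p1 where p1: "arc p1" "path_image p1 = c1" "pathstart p1 = a" "pathfinish p1 = b"
    using t(1) unfolding is_arc_def by blast
  obtain p2 where p2: "arc p2" "path_image p2 = c2" "pathstart p2 = a" "pathfinish p2 = b"
    using t(2) unfolding is_arc_def by blast
  obtain p where p: "arc p" "path_image p = c" "pathstart p = a" "pathfinish p = b"
    using t(3) unfolding is_arc_def by blast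
  have ne: "path_image p \<inter> inside (path_image p1 \<union> path_image p2) \<noteq> {}"
    using is_arc_third_point[OF t(3)] cin p1 p2 p by blast
  have ab: "a \<noteq> b" using is_arc_ends[OF t(1)] by auto
  have "inside (c1 \<union> c) \<inter> inside (c2 \<union> c) = {} \<and>
    inside (c1 \<union> c) \<union> inside (c2 \<union> c) \<union> (c - {a,b}) = inside (c1 \<union> c2)"
    by (rule split_inside_simple_closed_curve[of p1 a b p2 p])
      (use p1 p2 p t ne ab in \<open>auto simp: arc_imp_simple_path\<close>)
  then show "inside (c1 \<union> c) \<inter> inside (c2 \<union> c) = {}"
    "inside (c1 \<union> c) \<union> inside (c2 \<union> c) \<union> (c - {a,b}) = inside (c1 \<union> c2)" by auto
qed

text \<open>The closed regions bounded by \<open>c1 \<union> c\<close> and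
  \<open>c2 \<union> c\<close> cover the closed region of \<open>c1 \<union> c2\<close> and overlap
  only in \<open>c\<close>. A connected set off \<open>c\<close> stays in one of them.\<close>

lemma theta_separates_inside:
  assumes th: "theta c1 c2 c a b" and cin: "c - {a,b} \<subseteq> inside (c1 \<union> c2)"
    and T: "connected T" "T \<subseteq> inside (c1 \<union> c2) \<union> c1 \<union> c2" "T \<inter> c = {}" "T \<inter> c1 \<noteq> {}"
  shows "T \<inter> c2 = {}"
proof -
  note t = thetaD[OF th]
  note s = theta_split_inside[OF th cin]
  define A where "A = inside (c1 \<union> c) \<union> (c1 \<union> c)"
  define B where "B = inside (c2 \<union> c) \<union> (c2 \<union> c)"
  have cl: "closed A" "closed B"
    using jordan_side(6)[OF t(8), of True] jordan_side(6)[OF t(9), of True] by (auto simp: side_def A_def B_def)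
  have "T \<subseteq> A \<union> B" using T(2) s(2) unfolding A_def B_def by blast
  moreover have "A \<inter> B \<inter> T = {}"
  proof -
    have "inside (c1 \<union> c) \<inter> c2 = {}" "inside (c2 \<union> c) \<inter> c1 = {}"
      using s(2) inside_no_overlap[of "c1 \<union> c2"] by blast+
    then have "A \<inter> B \<subseteq> c" using s(1) t(4,5) unfolding A_def B_def by blast
    then show ?thesis using T(3) by blast
  qed
  ultimately have "A \<inter> T = {} \<or> B \<inter> T = {}"
    using T(1) cl unfolding connected_closed by blast
  moreover have "A \<inter> T \<noteq> {}" using T(4) by (auto simp: A_def)
  ultimately show ?thesis by (auto simp: B_def)
qed

lemma is_arc_image:
  assumes "is_arc X a b" "continuous_on X f" "inj_on f X"
  shows "is_arc (f ` X) (f a) (f b)"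
proof -
  obtain g where g: "arc g" "path_image g = X" "pathstart g = a" "pathfinish g = b"
    using assms(1) unfolding is_arc_def by blast
  have "arc (f \<circ> g)"
    using g assms(2,3) continuous_on_compose[of "{0..1}" g f] comp_inj_on[of g "{0..1}" f]
    unfolding arc_def path_def path_image_def by simp
  moreover have "path_image (f \<circ> g) = f ` X" using g(2) by (auto simp: path_image_def)
  ultimately show ?thesis unfolding is_arc_def using g by (metis pathfinish_compose pathstart_compose)
qed

text \<open>The punctured inside has a pole, so its image is unbounded and goes to the outside. If
  the old outside went there too, the new inside could contain only 0, the one value that the
  inversion omits; but it is open and nonempty.\<close>

lemma inversion_outside:
  fixes w :: complex
  assumes J: "jordan C" and w: "w \<in> inside C" and J': "jordan ((\<lambda>z. inverse (z - w)) ` C)"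
  shows "(\<lambda>z. inverse (z - w)) ` outside C \<subseteq> inside ((\<lambda>z. inverse (z - w)) ` C)"
proof -
  define f where "f z = inverse (z - w)" for z
  have wC: "w \<notin> C" "w \<notin> outside C" using w inside_no_overlap inside_Int_outside by blast+
  have cont: "continuous_on S f" if "w \<notin> S" for S
    unfolding f_def using that by (intro continuous_intros) auto
  have inj: "f x = f y \<Longrightarrow> x = y" for x y unfolding f_def by auto
  have im: "y \<in> f ` (- {w})" if "y \<noteq> 0" for y
  proof
    show "y = f (w + inverse y)" by (simp add: f_def)
    show "w + inverse y \<in> - {w}" using that by simp
  qed
  have split: "- C = inside C \<union> outside C" by (simp add: inside_Un_outside)
  have Cf: "jordan (f ` C)" using J' unfolding f_def .
  have conn: "connected (f ` outside C)" "connected (f ` (inside C - {w}))"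
  proof -
    show "connected (f ` outside C)"
      using jordan_side(2)[OF J, of False] cont[OF wC(2)] connected_continuous_image by (auto simp: side_def)
    have "connected (inside C - {w})"
      using jordan_side(1,2)[OF J, of True] connected_open_delete[of "inside C" w] by (simp add: side_def)
    then show "connected (f ` (inside C - {w}))" using cont[of "inside C - {w}"] connected_continuous_image by auto
  qed
  have disj: "f ` outside C \<inter> f ` C = {}" "f ` (inside C - {w}) \<inter> f ` C = {}"
    using inj inside_no_overlap[of C] outside_no_overlap[of C] by blast+
  obtain b where b: "f ` outside C \<subseteq> side b (f ` C)" using connected_in_some_side[OF Cf conn(1) disj(1)] by blast
  obtain e where e: "f ` (inside C - {w}) \<subseteq> side e (f ` C)" using connected_in_some_side[OF Cf conn(2) disj(2)] by blast
  have "\<not> bounded (f ` (inside C - {w}))"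
  proof
    assume "bounded (f ` (inside C - {w}))"
    then obtain B where B: "B > 0" "\<And>x. x \<in> inside C - {w} \<Longrightarrow> norm (f x) \<le> B"
      unfolding bounded_pos by auto
    obtain r where r: "r > 0" "ball w r \<subseteq> inside C"
      using jordan_side(1)[OF J, of True] w unfolding side_def by (auto elim: openE)
    \<comment> \<open>Small enough to stay inside \<open>C\<close>, while the image of the point at
      distance \<open>d\<close> has norm at least \<open>2*B\<close>.\<close>
    define d where "d = min (r/2) (1/(2*B))"
    have d: "d > 0" "d < r" "d \<le> 1/(2*B)" using r(1) B(1) by (auto simp: d_def)
    have "w + of_real d \<in> inside C - {w}" using r d by (auto simp: dist_norm)
    from B(2)[OF this] have "norm (f (w + of_real d)) \<le> B" .
    moreover have "f (w + of_real d) = of_real (1 / d)" unfolding f_def by (simp add: inverse_eq_divide)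
    ultimately have "1 / d \<le> B" using d(1) by (simp only: norm_of_real)
    then have "1 \<le> B * d" using d(1) by (simp add: pos_divide_le_eq)
    also have "\<dots> \<le> B * (1/(2*B))" using d(3) B(1) by (intro mult_left_mono) auto
    also have "\<dots> < 1" using B(1) by simp
    finally show False by simp
  qed
  moreover have "bounded (inside (f ` C))"
    using Cf Jordan_inside_outside unfolding jordan_def by metis
  ultimately have "e = False" using e bounded_subset unfolding side_def by (cases e) auto
  have "b = True"
  proof (rule ccontr)
    assume "b \<noteq> True"
    then have bb: "f ` outside C \<subseteq> outside (f ` C)" using b by (simp add: side_def)
    have ee: "f ` (inside C - {w}) \<subseteq> outside (f ` C)" using e \<open>e = False\<close> by (simp add: side_def)
    have "inside (f ` C) \<subseteq> {0}"
    proof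
      fix y assume y: "y \<in> inside (f ` C)"
      show "y \<in> {0}"
      proof (rule ccontr)
        assume "y \<notin> {0}"
        then obtain x where x: "x \<noteq> w" "y = f x" using im[of y] by auto
        have "x \<in> C \<or> x \<in> outside C \<or> x \<in> inside C - {w}" using split x(1) by blast
        then have "y \<in> f ` C \<union> outside (f ` C)" using bb ee x(2) by blast
        then show False using y inside_no_overlap[of "f ` C"] inside_Int_outside[of "f ` C"] by blast
      qed
    qed
    moreover have "open (inside (f ` C))" "inside (f ` C) \<noteq> {}" using jordan_side(1,3)[OF Cf, of True] by (auto simp: side_def)
    ultimately show False by (metis subset_singletonD not_open_singleton)
  qed
  then show ?thesis using b by (simp add: side_def f_def)
qed

text \<open>An inversion about a point inside \<open>c1 \<union> c2\<close> turns the case of the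
  outside into that of the inside, so unbounded lunes need no separate treatment later.\<close>

lemma theta_separates:
  assumes th: "theta c1 c2 c a b" and cin: "c - {a,b} \<subseteq> side e (c1 \<union> c2)"
    and T: "connected T" "T \<subseteq> side e (c1 \<union> c2) \<union> c1 \<union> c2" "T \<inter> c = {}" "T \<inter> c1 \<noteq> {}"
  shows "T \<inter> c2 = {}"
proof (cases e)
  case True
  then show ?thesis using theta_separates_inside[OF th] cin T by (simp add: side_def)
next
  case False
  note t = thetaD[OF th]
  obtain w where w: "w \<in> inside (c1 \<union> c2)" using jordan_side(3)[OF t(7), of True] by (auto simp: side_def)
  define f where "f z = inverse (z - w)" for z
  have out: "side e (c1 \<union> c2) = outside (c1 \<union> c2)" using False by (simp add: side_def)
  have wn: "w \<notin> c1" "w \<notin> c2" "w \<notin> outside (c1 \<union> c2)"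
    using w inside_no_overlap inside_Int_outside by blast+
  have ab: "{a,b} \<subseteq> c1" using t(4) by blast
  have wc: "w \<notin> c" "w \<notin> T" using cin T(2) wn ab out by blast+
  have cont: "continuous_on S f" if "w \<notin> S" for S
    unfolding f_def using that by (intro continuous_intros) auto
  have inj: "f x = f y \<Longrightarrow> x = y" for x y unfolding f_def by auto
  have injf: "inj_on f S" for S by (meson inj inj_onI)
  have I: "f ` X \<inter> f ` Y = f ` (X \<inter> Y)" for X Y using inj by auto
  have th': "theta (f ` c1) (f ` c2) (f ` c) (f a) (f b)"
    unfolding theta_def I t(4,5,6)
    using is_arc_image[OF t(1) cont injf] is_arc_image[OF t(2) cont injf] is_arc_image[OF t(3) cont injf] wn wc by simp
  have J': "jordan (f ` (c1 \<union> c2))" using thetaD(7)[OF th'] by (simp add: image_Un)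
  have sub: "f ` outside (c1 \<union> c2) \<subseteq> inside (f ` c1 \<union> f ` c2)"
    using inversion_outside[OF t(7) w] J' unfolding f_def by (simp add: image_Un)
  have "f ` T \<inter> f ` c2 = {}"
  proof (rule theta_separates_inside[OF th'])
    show "f ` c - {f a, f b} \<subseteq> inside (f ` c1 \<union> f ` c2)" using cin out sub inj by blast
    show "connected (f ` T)" using T(1) cont[OF wc(2)] connected_continuous_image by blast
    show "f ` T \<subseteq> inside (f ` c1 \<union> f ` c2) \<union> f ` c1 \<union> f ` c2" using T(2) out sub by blast
    show "f ` T \<inter> f ` c = {}" unfolding I T(3) by simp
    show "f ` T \<inter> f ` c1 \<noteq> {}" unfolding I using T(4) by simp
  qed
  then show ?thesis unfolding I by simp
qed

text \<open>The two sides opposite to the lune overlap, since \<open>A\<close> reaches the other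
  side of \<open>D\<close> and each of its points is a limit of both sides of \<open>A\<close>. So
  their union is connected and lies on one side of \<open>G\<close>. That side, being connected,
  contains nothing of the lune, and what lies on the other side can only be the lune.\<close>

lemma lune_side:
  fixes a d :: bool
  assumes c: "cross A D"
  defines "G \<equiv> (D \<inter> (side a A \<union> A)) \<union> (A \<inter> (side d D \<union> D))"
  shows "jordan G" "\<exists>e. side d D \<inter> side a A = side e G"
proof -
  obtain p q where pq: "A \<inter> D = {p,q}" using cross_points[OF c] by blast
  have DA: "D \<inter> A = {p,q}" using pq by blast
  have a1: "is_arc (D \<inter> (side a A \<union> A)) p q" by (rule cross_arc[OF cross_sym[OF c] DA])
  have a2: "is_arc (A \<inter> (side d D \<union> D)) p q" by (rule cross_arc[OF c pq])
  have int: "(D \<inter> (side a A \<union> A)) \<inter> (A \<inter> (side d D \<union> D)) = {p,q}" using pq by blast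
  show J: "jordan G" unfolding G_def by (rule jordan_join[OF a1 a2 int])
  note JA = crossD(1)[OF c] and JD = crossD(2)[OF c]
  define W where "W = side (\<not> d) D \<union> side (\<not> a) A"
  define L where "L = side d D \<inter> side a A"
  have oW: "open W" "open L" unfolding W_def L_def using jordan_side(1) JA JD by auto
  have "side (\<not> d) D \<inter> side (\<not> a) A \<noteq> {}"
  proof -
    obtain x where x: "x \<in> A" "x \<in> side (\<not> d) D" using crossD(4)[OF c, of "\<not> d"] by blast
    have "x \<in> closure (side (\<not> a) A)" using jordan_side(5)[OF JA] x(1) by simp
    then show ?thesis using jordan_side(1)[OF JD, of "\<not> d"] x(2) open_Int_closure_eq_empty by blast
  qed
  then have cW: "connected W" unfolding W_def using jordan_side(2)[OF JA] jordan_side(2)[OF JD] by (intro connected_Un) auto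
  have WG: "W \<inter> G = {}" unfolding W_def G_def
    using side_Int[of d D] side_Int[of a A] side_disjoint[of "\<not> d" D] side_disjoint[of "\<not> a" A] by blast
  have WL: "W \<inter> L = {}" unfolding W_def L_def using side_Int[of d D] side_Int[of a A] by blast
  have cov: "- G \<subseteq> W \<union> L"
    unfolding W_def L_def G_def using side_Un[of d D] side_Un[of a A] by blast
  obtain e where e: "W \<subseteq> side e G" using connected_in_some_side[OF J cW WG] by blast
  have 1: "side (\<not> e) G \<subseteq> L" using cov e side_Int[of e G] side_disjoint[of "\<not> e" G] by blast
  have "side e G \<subseteq> W \<union> L" using cov side_disjoint[of e G] by blast
  moreover have "W \<noteq> {}" unfolding W_def using jordan_side(3)[OF JA] by blast
  then have "W \<inter> side e G \<noteq> {}" using e by blast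
  ultimately have "L \<inter> side e G = {}"
    using jordan_side(2)[OF J, of e] oW WL unfolding connected_def by blast
  moreover have "L \<inter> G = {}" unfolding L_def G_def using side_disjoint[of d D] side_disjoint[of a A] by blast
  ultimately have "L \<subseteq> side (\<not> e) G" using side_Un[of e G] by blast
  then have "side d D \<inter> side a A = side (\<not> e) G" using 1 unfolding L_def by blast
  then show "\<exists>e. side d D \<inter> side a A = side e G" by blast
qed

section \<open>Loops and their orientation\<close>

definition loop :: "(real \<Rightarrow> complex) \<Rightarrow> complex set \<Rightarrow> bool" where
  "loop g F \<longleftrightarrow> simple_path g \<and> pathfinish g = pathstart g \<and> path_image g = F"

lemma loopD:
  assumes "loop g F"
  shows "simple_path g" "g 1 = g 0" "g ` {0..1} = F" "continuous_on {0..1} g" "path g" "jordan F"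
    "path_image g = F" "pathfinish g = pathstart g"
  using assms unfolding loop_def jordan_def
  by (auto simp: pathfinish_def pathstart_def path_image_def simple_path_def path_def)

lemma loop_inj:
  assumes "loop g F" "x \<in> {0..1}" "y \<in> {0..1}" "g x = g y" "x < y"
  shows "x = 0 \<and> y = 1"
  using loopD(1)[OF assms(1)] assms(2-) unfolding simple_path_def loop_free_def by force

lemma loop_inj_open:
  assumes l: "loop g F" and x: "x \<in> {0..1}" and y: "0 < y" "y < 1" and e: "g x = g y"
  shows "x = y"
proof (rule ccontr)
  assume "x \<noteq> y"
  then consider "x < y" | "y < x" by linarith
  then show False
  proof cases
    case 1 then show False using loop_inj[OF l x _ e] y by auto
  next
    case 2 then show False using loop_inj[OF l _ x e[symmetric]] y by auto
  qed
qed

lemma loop_base_notin: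
  assumes l: "loop g F" and st: "0 < s" "s < 1" "0 < t" "t < 1" "F \<inter> G = {g s, g t}"
  shows "g 0 \<notin> G"
proof
  assume "g 0 \<in> G"
  moreover have "g 0 \<in> F" using loopD(3)[OF l] by auto
  ultimately have "g 0 = g s \<or> g 0 = g t" using st(5) by blast
  then show False using loop_inj_open[OF l, of 0 s] loop_inj_open[OF l, of 0 t] st(1-4) by auto
qed

lemma loop_reverse: "loop g F \<Longrightarrow> loop (reversepath g) F"
  unfolding loop_def by (auto simp: simple_path_reversepath)

lemma loop_arc:
  assumes l: "loop g F" and xy: "0 \<le> x" "x < y" "y \<le> 1" "\<not> (x = 0 \<and> y = 1)"
  shows "is_arc (g ` {x..y}) (g x) (g y)"
proof (rule is_arc_interval[OF xy(2)])
  show "continuous_on {x..y} g" by (rule continuous_on_subset[OF loopD(4)[OF l]]) (use xy in auto)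
  show "inj_on g {x..y}"
  proof (rule inj_onI)
    fix u v assume uv: "u \<in> {x..y}" "v \<in> {x..y}" "g u = g v"
    show "u = v"
      using loop_inj[OF l, of u v] loop_inj[OF l, of v u] uv xy by fastforce
  qed
qed

lemma loop_points:
  assumes l: "loop g F" and c: "cross F G" and v: "g 0 \<notin> G"
  obtains s t where "0 < s" "s < t" "t < 1" "F \<inter> G = {g s, g t}"
proof -
  obtain p q where pq: "F \<inter> G = {p,q}" "p \<noteq> q" using cross_points[OF c] by blast
  obtain x y where xy: "x \<in> {0..1}" "p = g x" "y \<in> {0..1}" "q = g y"
    using pq loopD(3)[OF l] by (metis IntD1 image_iff insertCI)
  have "p \<in> G" "q \<in> G" using pq(1) by blast+
  then have "x \<noteq> 0" "x \<noteq> 1" "y \<noteq> 0" "y \<noteq> 1" using v xy loopD(2)[OF l] by metis+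
  moreover have "x \<noteq> y" using pq xy by auto
  ultimately have "0 < x \<and> x < y \<and> y < 1 \<or> 0 < y \<and> y < x \<and> x < 1" using xy by auto
  then show ?thesis
  proof
    assume "0 < x \<and> x < y \<and> y < 1"
    then show ?thesis using that[of x y] pq(1) xy(2,4) by simp
  next
    assume "0 < y \<and> y < x \<and> x < 1"
    then show ?thesis using that[of y x] pq(1) xy(2,4) by (simp add: insert_commute)
  qed
qed

text \<open>The two crossing parameters cut the loop into two connected stretches off
  \<open>G\<close>, one of them through the base point. Crossing forces them onto different
  sides.\<close>

lemma loop_sides:
  assumes l: "loop g F" and c: "cross F G" and b: "g 0 \<in> side b G"
    and st: "0 < s" "s < t" "t < 1" "F \<inter> G = {g s, g t}"
  shows "\<And>x. x \<in> {0..1} \<Longrightarrow> x < s \<or> t < x \<Longrightarrow> g x \<in> side b G"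
    "\<And>x. s < x \<Longrightarrow> x < t \<Longrightarrow> g x \<in> side (\<not> b) G"
proof -
  have notG: "g x \<notin> G" if "x \<in> {0..1}" "x \<noteq> s" "x \<noteq> t" for x
  proof
    assume "g x \<in> G"
    then have "g x = g s \<or> g x = g t" using st(4) loopD(3)[OF l] that(1) by auto
    then have "x = s \<or> x = t"
      using loop_inj_open[OF l that(1), of s] loop_inj_open[OF l that(1), of t] st(1,2,3) by auto
    then show False using that by simp
  qed
  have JG: "jordan G" by (rule crossD(2)[OF c])
  have co: "connected (g ` S)" if "connected S" "S \<subseteq> {0..1}" for S
    by (rule connected_continuous_image[OF continuous_on_subset[OF loopD(4)[OF l] that(2)] that(1)])
  have "connected (g ` {0..<s} \<union> g ` {t<..1})"
  proof (rule connected_Un)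
    show "connected (g ` {0..<s})" "connected (g ` {t<..1})" using st by (auto intro!: co)
    have "g 0 \<in> g ` {0..<s}" "g 1 \<in> g ` {t<..1}" using st by auto
    then show "g ` {0..<s} \<inter> g ` {t<..1} \<noteq> {}" using loopD(2)[OF l] by auto
  qed
  moreover have "(g ` {0..<s} \<union> g ` {t<..1}) \<inter> G = {}"
  proof -
    have "g x \<notin> G" if "x \<in> {0..<s} \<union> {t<..1}" for x using notG[of x] that st(1,2,3) by auto
    then show ?thesis by blast
  qed
  moreover have "g 0 \<in> g ` {0..<s} \<union> g ` {t<..1}" using st by auto
  ultimately have 1: "g ` {0..<s} \<union> g ` {t<..1} \<subseteq> side b G"
    using connected_subset_side[OF JG] b by blast
  then show "g x \<in> side b G" if "x \<in> {0..1}" "x < s \<or> t < x" for x using that by auto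
  have "connected (g ` {s<..<t})" using st by (auto intro!: co)
  moreover have "g ` {s<..<t} \<inter> G = {}"
  proof -
    have "g x \<notin> G" if "x \<in> {s<..<t}" for x using notG[of x] that st(1,2,3) by auto
    then show ?thesis by blast
  qed
  ultimately obtain e where e: "g ` {s<..<t} \<subseteq> side e G" using connected_in_some_side[OF JG] by blast
  have "e \<noteq> b"
  proof
    assume eb: "e = b"
    have "F - G \<subseteq> side b G"
    proof
      fix z assume z: "z \<in> F - G"
      then obtain x where x: "x \<in> {0..1}" "z = g x" using loopD(3)[OF l] by auto
      have "x \<noteq> s" "x \<noteq> t" using z x(2) st(4) by auto
      then have "x \<in> {0..<s} \<or> x \<in> {t<..1} \<or> x \<in> {s<..<t}" using x(1) by auto
      then show "z \<in> side b G" using x(2) 1 e eb by blast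
    qed
    then show False using crossD(3)[OF c] by blast
  qed
  then have eb: "e = (\<not> b)" by auto
  show "g x \<in> side (\<not> b) G" if "s < x" "x < t" for x using e that unfolding eb by auto
qed

text \<open>Counterclockwise for the inside, clockwise for the outside: in either case
  \<open>g\<close> keeps \<open>side f F\<close> on its left.\<close>

definition oriented :: "bool \<Rightarrow> complex set \<Rightarrow> (real \<Rightarrow> complex) \<Rightarrow> bool" where
  "oriented f F g \<longleftrightarrow> loop g F \<and> (\<forall>y\<in>inside F. winding_number g y = (if f then 1 else -1))"

lemma oriented_reverse:
  assumes "oriented f F g" shows "oriented (\<not> f) F (reversepath g)"
proof -
  have l: "loop g F" using assms by (simp add: oriented_def)
  have "winding_number (reversepath g) y = - winding_number g y" if "y \<in> inside F" for y
    using winding_number_reversepath[OF loopD(5)[OF l]] loopD(7)[OF l] that inside_no_overlap by blast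
  then show ?thesis using assms loop_reverse unfolding oriented_def by auto
qed

lemma oriented_exists:
  assumes "jordan F" "v \<in> F"
  obtains g where "oriented f F g" "g 0 = v"
proof -
  obtain h where h: "loop h F" using assms(1) unfolding jordan_def loop_def by blast
  obtain a where a: "a \<in> {0..1}" "h a = v" using loopD(3)[OF h] assms(2) by auto
  define k where "k = shiftpath a h"
  have k: "loop k F"
    using h a unfolding loop_def k_def
    by (auto simp: simple_path_shiftpath pathfinish_shiftpath pathstart_shiftpath path_image_shiftpath)
  have k0: "k 0 = v" using a by (simp add: k_def shiftpath_def)
  have k1: "reversepath k 0 = v" using k0 loopD(2)[OF k] by (simp add: reversepath_def)
  have "oriented True F k \<or> oriented False F k"
    using simple_closed_path_winding_number_inside[OF loopD(1)[OF k]] loopD(7)[OF k] k unfolding oriented_def by auto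
  then show ?thesis
    using that[of k] that[of "reversepath k"] k0 k1 oriented_reverse[of True F k] oriented_reverse[of False F k]
    by (cases f) auto
qed

text \<open>\<open>p\<close> is the passage of the loop through \<open>side b G\<close> and starts
  where \<open>g\<close> enters that side. If the base point lies there, the passage runs through
  it, hence the case distinction on the ends.\<close>

lemma loop_two_paths:
  assumes l: "loop g F" and c: "cross F G" and st: "0 < s" "s < t" "t < 1" "F \<inter> G = {g s, g t}"
  obtains p q where "path p" "path q" "path_image p = F \<inter> (side b G \<union> G)" "path_image q = F \<inter> (side (\<not> b) G \<union> G)"
    "pathstart p = (if g 0 \<in> side b G then g t else g s)" "pathfinish p = (if g 0 \<in> side b G then g s else g t)"
    "pathstart q = pathfinish p" "pathfinish q = pathstart p"
    "\<And>y. y \<notin> F \<Longrightarrow> winding_number g y = winding_number p y + winding_number q y"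
proof -
  have v: "g 0 \<notin> G" by (rule loop_base_notin[OF l, of s t]) (use st in auto)
  define p where "p = subpath s t g"
  define q where "q = subpath t 1 g +++ subpath 0 s g"
  have P: "path p" "path_image p = g ` {s..t}" "pathstart p = g s" "pathfinish p = g t"
    unfolding p_def using st loopD(5)[OF l] by (auto simp: path_image_subpath)
  have g10: "g 1 = g 0" using loopD(2)[OF l] .
  have Q: "path q" "path_image q = g ` {t..1} \<union> g ` {0..s}" "pathstart q = g t" "pathfinish q = g s"
    unfolding q_def using st loopD(5)[OF l] g10 by (auto simp: path_image_subpath path_image_join)
  have W: "winding_number g y = winding_number p y + winding_number q y" if y: "y \<notin> F" for y
  proof -
    have pi: "y \<notin> path_image g" using y loopD(7)[OF l] by simp
    have 1: "winding_number (subpath 0 s g) y + winding_number (subpath s t g) y = winding_number (subpath 0 t g) y"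
      by (rule winding_number_subpath_combine[OF loopD(5)[OF l] pi]) (use st in auto)
    have 2: "winding_number (subpath 0 t g) y + winding_number (subpath t 1 g) y = winding_number (subpath 0 1 g) y"
      by (rule winding_number_subpath_combine[OF loopD(5)[OF l] pi]) (use st in auto)
    have "path_image (subpath t 1 g) \<subseteq> F" "path_image (subpath 0 s g) \<subseteq> F"
      using st loopD(3)[OF l] by (auto simp: path_image_subpath)
    then have "winding_number q y = winding_number (subpath t 1 g) y + winding_number (subpath 0 s g) y"
      unfolding q_def using st loopD(5)[OF l] g10 y by (intro winding_number_join) auto
    then show ?thesis using 1 2 by (simp add: p_def) (metis add.assoc add.commute)
  qed
  have main: "path_image q = F \<inter> (side e G \<union> G) \<and> path_image p = F \<inter> (side (\<not> e) G \<union> G)"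
    if e: "g 0 \<in> side e G" for e
  proof -
    note S = loop_sides[OF l c e st]
    have gs: "g s \<in> G" "g t \<in> G" using st(4) by auto
    have cov: "z \<in> path_image p \<union> path_image q" if "z \<in> F" for z
    proof -
      have "z \<in> g ` {0..1}" using that loopD(3)[OF l] by simp
      then obtain x where x: "x \<in> {0..1}" "z = g x" by (rule imageE)
      have "x \<in> {0..s} \<or> x \<in> {s..t} \<or> x \<in> {t..1}" using x(1) by auto
      then show ?thesis unfolding P(2) Q(2) x(2) by blast
    qed
    have inp: "z \<in> F \<inter> (side (\<not> e) G \<union> {g s, g t})" if z: "z \<in> path_image p" for z
    proof -
      obtain x where x: "x \<in> {s..t}" "z = g x" using z P(2) by auto
      then have "x \<in> {0..1}" using st(1-3) by auto
      then have "z \<in> F" using loopD(3)[OF l] x(2) by blast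
      moreover have "x = s \<or> x = t \<or> s < x \<and> x < t" using x(1) by auto
      ultimately show ?thesis using S(2)[of x] x(2) by auto
    qed
    have inq: "z \<in> F \<inter> (side e G \<union> {g s, g t})" if z: "z \<in> path_image q" for z
    proof -
      have "z \<in> g ` ({t..1} \<union> {0..s})" using z unfolding Q(2) image_Un .
      then obtain x where x: "x \<in> {t..1} \<union> {0..s}" "z = g x" by blast
      then have "x \<in> {0..1}" using st(1-3) by auto
      then have "z \<in> F" using loopD(3)[OF l] x(2) by blast
      moreover have "x = s \<or> x = t \<or> x \<in> {0..1} \<and> (x < s \<or> t < x)" using x(1) st by auto
      ultimately show ?thesis using S(1)[of x] x(2) by auto
    qed
    have ends: "{g s, g t} \<subseteq> path_image p" "{g s, g t} \<subseteq> path_image q" unfolding P Q using st by auto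
    have q1: "z \<in> path_image q" if z: "z \<in> F \<inter> (side e G \<union> G)" for z
    proof (rule ccontr)
      assume n: "z \<notin> path_image q"
      then have "z \<in> path_image p" using cov z by auto
      then have "z \<in> side (\<not> e) G" using inp[of z] n ends by auto
      then show False using z in_side_not[of z "\<not> e" G] by auto
    qed
    have p1: "z \<in> path_image p" if z: "z \<in> F \<inter> (side (\<not> e) G \<union> G)" for z
    proof (rule ccontr)
      assume n: "z \<notin> path_image p"
      then have "z \<in> path_image q" using cov z by auto
      then have "z \<in> side e G" using inq[of z] n ends by auto
      then show False using z in_side_not[of z e G] by auto
    qed
    show ?thesis using q1 p1 inp inq gs by blast
  qed
  show ?thesis
  proof (cases "g 0 \<in> side b G")
    case True
    then show ?thesis using that[of q p] P Q W main[OF True] by (simp add: add.commute)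
  next
    case False
    then have "g 0 \<in> side (\<not> b) G" using v not_in_side by blast
    from main[OF this] show ?thesis using that[of p q] P Q W False by simp
  qed
qed

text \<open>Between positively oriented curves, \<open>F\<close> enters the inside of
  \<open>G\<close> where \<open>G\<close> leaves the inside of \<open>F\<close>. Otherwise the two
  inner arcs run in parallel, and exchanging them yields two closed paths that leave a point
  \<open>y\<close> of the common region outside. Their winding numbers around \<open>y\<close> are
  0, yet they add up to those of \<open>F\<close> and \<open>G\<close>, which give 2.\<close>

lemma orientation_base:
  assumes F: "oriented True F g" and G: "oriented True G h" and c: "cross F G"
    and st: "0 < s" "s < t" "t < 1" "F \<inter> G = {g s, g t}"
    and st': "0 < s'" "s' < t'" "t' < 1" "F \<inter> G = {h s', h t'}"
  shows "(if g 0 \<in> inside G then g t else g s) = (if h 0 \<in> inside F then h s' else h t')"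
proof (rule ccontr)
  assume ne: "\<not> ?thesis"
  have lF: "loop g F" and lG: "loop h G" using F G unfolding oriented_def by auto
  have c': "cross G F" using cross_sym[OF c] .
  have GF: "G \<inter> F = {h s', h t'}" using st'(4) by blast
  obtain p q where pq: "path p" "path q" "path_image p = F \<inter> (side True G \<union> G)" "path_image q = F \<inter> (side False G \<union> G)"
    "pathstart p = (if g 0 \<in> side True G then g t else g s)" "pathfinish p = (if g 0 \<in> side True G then g s else g t)"
    "pathstart q = pathfinish p" "pathfinish q = pathstart p"
    "\<And>y. y \<notin> F \<Longrightarrow> winding_number g y = winding_number p y + winding_number q y"
    by (rule loop_two_paths[OF lF c st, of True]) auto
  obtain u w where uw: "path u" "path w" "path_image u = G \<inter> (side True F \<union> F)" "path_image w = G \<inter> (side False F \<union> F)"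
    "pathstart u = (if h 0 \<in> side True F then h t' else h s')" "pathfinish u = (if h 0 \<in> side True F then h s' else h t')"
    "pathstart w = pathfinish u" "pathfinish w = pathstart u"
    "\<And>y. y \<notin> G \<Longrightarrow> winding_number h y = winding_number u y + winding_number w y"
    by (rule loop_two_paths[OF lG c' st'(1-3) GF, of True]) auto
  define P where "P = pathstart p"
  define Q where "Q = pathfinish p"
  have PQ: "{P,Q} = F \<inter> G" "P \<noteq> Q"
  proof -
    show "{P,Q} = F \<inter> G" unfolding P_def Q_def pq st(4) by auto
    have "card (F \<inter> G) = 2" using c by (simp add: cross_def)
    then show "P \<noteq> Q" using \<open>{P,Q} = F \<inter> G\<close> by (metis card_2_iff doubleton_eq_iff insert_absorb2)
  qed
  have UW: "{pathstart u, pathfinish u} = F \<inter> G" unfolding uw st'(4) by auto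
  have "P \<noteq> pathfinish u" using ne unfolding P_def pq uw by (simp add: side_def)
  then have U: "pathstart u = P" "pathfinish u = Q" using UW PQ by (auto simp: doubleton_eq_iff)
  have FG: "F \<inter> G = {P,Q}" "G \<inter> F = {P,Q}" using PQ by auto
  define Fi where "Fi = path_image p"
  define Fo where "Fo = path_image q"
  define Gi where "Gi = path_image u"
  define Go where "Go = path_image w"
  note defs = Fi_def Fo_def Gi_def Go_def pq(3,4) uw(3,4)
  have ar: "is_arc Fi P Q" "is_arc Fo P Q" "is_arc Gi P Q" "is_arc Go P Q"
    unfolding defs using cross_arc[OF c FG(1)] cross_arc[OF c' FG(2)] by auto
  have F_eq: "Fi \<union> Fo = F" "Fi \<inter> Fo = {P,Q}" "Gi \<union> Go = G" "Gi \<inter> Go = {P,Q}"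
    unfolding defs using closure_side_Un[of F True G] closure_side_Int[of F True G]
      closure_side_Un[of G True F] closure_side_Int[of G True F] FG by simp_all
  have subs: "Fi \<subseteq> F" "Fo \<subseteq> F" "Gi \<subseteq> G" "Go \<subseteq> G" using F_eq by auto
  have e: "{P,Q} \<subseteq> Fi" "{P,Q} \<subseteq> Fo" "{P,Q} \<subseteq> Gi" "{P,Q} \<subseteq> Go"
    using is_arc_ends[OF ar(1)] is_arc_ends[OF ar(2)] is_arc_ends[OF ar(3)] is_arc_ends[OF ar(4)] by auto
  have X: "X \<inter> Y = {P,Q} \<and> Y \<inter> X = {P,Q}" if "X \<subseteq> F" "Y \<subseteq> G" "{P,Q} \<subseteq> X" "{P,Q} \<subseteq> Y" for X Y
    using that FG(1) by blast
  have xi: "Fi \<inter> Gi = {P,Q}" "Fo \<inter> Gi = {P,Q}" "Fi \<inter> Go = {P,Q}" "Gi \<inter> Fi = {P,Q}" "Go \<inter> Fi = {P,Q}"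
    using X[OF subs(1,3) e(1,3)] X[OF subs(2,3) e(2,3)] X[OF subs(1,4) e(1,4)] by auto
  have th1: "theta Fi Fo Gi P Q" unfolding theta_def using ar F_eq xi by simp
  have th2: "theta Gi Go Fi P Q" unfolding theta_def using ar F_eq xi by simp
  have in1: "Gi - {P,Q} \<subseteq> inside (Fi \<union> Fo)"
    unfolding F_eq using FG unfolding defs by (auto simp: side_def)
  have in2: "Fi - {P,Q} \<subseteq> inside (Gi \<union> Go)"
    unfolding F_eq using FG unfolding defs by (auto simp: side_def)
  note s1 = theta_split_inside[OF th1 in1, unfolded F_eq]
  note s2 = theta_split_inside[OF th2 in2, unfolded F_eq]
  obtain y where y: "y \<in> inside (Fi \<union> Gi)"
    using jordan_side(3)[OF thetaD(8)[OF th1], of True] by (auto simp: side_def)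
  have yF: "y \<in> inside F" "y \<in> inside G" using y s1(2) s2(2) by (auto simp: Un_commute)
  have y1: "y \<notin> inside (Fo \<union> Gi)" "y \<notin> inside (Go \<union> Fi)" using y s1(1) s2(1) by (auto simp: Un_commute)
  have y2: "y \<notin> F" "y \<notin> G" using yF inside_no_overlap by blast+
  \<comment> \<open>These joins close up only because, under the negated claim, \<open>p\<close> and
    \<open>u\<close> both run from \<open>P\<close> to \<open>Q\<close>.\<close>
  have ip: "path_image (u +++ q) = Gi \<union> Fo" "path_image (p +++ w) = Fi \<union> Go"
    using U pq(7) uw(7) P_def Q_def by (auto simp: path_image_join Fi_def Fo_def Gi_def Go_def)
  have out: "y \<in> outside (Gi \<union> Fo)" "y \<in> outside (Fi \<union> Go)"
  proof -
    have "y \<notin> Gi \<union> Fo" "y \<notin> Fi \<union> Go" using y2 subs by auto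
    moreover have "y \<notin> inside (Gi \<union> Fo)" "y \<notin> inside (Fi \<union> Go)" using y1 by (simp_all add: Un_commute)
    ultimately show "y \<in> outside (Gi \<union> Fo)" "y \<in> outside (Fi \<union> Go)"
      using inside_Un_outside by blast+
  qed
  have "winding_number (u +++ q) y = 0"
    by (rule winding_number_zero_in_outside)
      (use out ip U pq uw P_def Q_def in \<open>auto\<close>)
  moreover have "winding_number (u +++ q) y = winding_number u y + winding_number q y"
    by (rule winding_number_join)
      (use y2 subs U pq(1,2,7) uw(1,2) Q_def Gi_def Fo_def in \<open>auto\<close>)
  moreover have "winding_number (p +++ w) y = 0"
    by (rule winding_number_zero_in_outside)
      (use out ip U pq uw P_def Q_def in \<open>auto\<close>)
  moreover have "winding_number (p +++ w) y = winding_number p y + winding_number w y"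
    by (rule winding_number_join)
      (use y2 subs U pq(1,2) uw(1,2,7) Q_def Fi_def Go_def in \<open>auto\<close>)
  moreover have "winding_number g y = 1" "winding_number h y = 1" using F G yF unfolding oriented_def by auto
  ultimately have "winding_number u y + winding_number q y = 0" "winding_number p y + winding_number w y = 0"
    "winding_number p y + winding_number q y = 1" "winding_number u y + winding_number w y = 1"
    using pq(9)[OF y2(1)] uw(9)[OF y2(2)] by simp_all
  moreover have "(winding_number p y + winding_number q y) + (winding_number u y + winding_number w y)
      = (winding_number u y + winding_number q y) + (winding_number p y + winding_number w y)"
    by (simp only: ac_simps)
  ultimately have "1 + 1 = (0::complex)" by simp
  then show False by simp
qed

text \<open>Reversing \<open>g\<close> exchanges its entries and exits, and replacing the inside of
  \<open>F\<close> by its outside exchanges those of \<open>h\<close>. The two effects cancel, so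
  the rule holds whenever each loop has its chosen side on the left.\<close>

lemma orientation_base_bool:
  assumes F: "oriented f F g" and G: "oriented e G h" and c: "cross F G"
    and st: "0 < s" "s < t" "t < 1" "F \<inter> G = {g s, g t}"
    and st': "0 < s'" "s' < t'" "t' < 1" "F \<inter> G = {h s', h t'}"
  shows "(if g 0 \<in> side e G then g t else g s) = (if h 0 \<in> side f F then h s' else h t')"
proof -
  have lF: "loop g F" and lG: "loop h G" using F G unfolding oriented_def by auto
  have v: "g 0 \<notin> G" "h 0 \<notin> F"
  proof -
    show "g 0 \<notin> G" by (rule loop_base_notin[OF lF, of s t]) (use st in auto)
    show "h 0 \<notin> F" by (rule loop_base_notin[OF lG, of s' t']) (use st' in auto)
  qed
  have two: "card (F \<inter> G) = 2" using c by (simp add: cross_def)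
  have nn: "g s \<noteq> g t" "h s' \<noteq> h t'" using two unfolding st(4) apply auto using two unfolding st'(4) by auto
  define g' where "g' = (if f then g else reversepath g)"
  define h' where "h' = (if e then h else reversepath h)"
  define a where "a = (if f then s else 1 - t)" define b where "b = (if f then t else 1 - s)"
  define a' where "a' = (if e then s' else 1 - t')" define b' where "b' = (if e then t' else 1 - s')"
  have og: "oriented True F g'" using F oriented_reverse[OF F] by (auto simp: g'_def)
  have oh: "oriented True G h'" using G oriented_reverse[OF G] by (auto simp: h'_def)
  have g0: "g' 0 = g 0" "h' 0 = h 0" using loopD(2)[OF lF] loopD(2)[OF lG] by (auto simp: g'_def h'_def reversepath_def)
  have "(if g' 0 \<in> inside G then g' b else g' a) = (if h' 0 \<in> inside F then h' a' else h' b')"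
    by (rule orientation_base[OF og oh c])
      (use st st' in \<open>auto simp: a_def b_def a'_def b'_def g'_def h'_def reversepath_def insert_commute\<close>)
  moreover have "g' a = (if f then g s else g t)" "g' b = (if f then g t else g s)"
    "h' a' = (if e then h s' else h t')" "h' b' = (if e then h t' else h s')"
    by (auto simp: a_def b_def a'_def b'_def g'_def h'_def reversepath_def)
  moreover have "g 0 \<in> side e G \<longleftrightarrow> (g 0 \<in> inside G) = e"
    using not_in_side[OF v(1), of True] by (cases e) (auto simp: side_def)
  moreover have "h 0 \<in> side f F \<longleftrightarrow> (h 0 \<in> inside F) = f"
    using not_in_side[OF v(2), of True] by (cases f) (auto simp: side_def)
  moreover have "{g s, g t} = {h s', h t'}" using st(4) st'(4) by simp
  ultimately show ?thesis using nn unfolding g0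
    by (smt (verit, best) doubleton_eq_iff)
qed

section \<open>Walls between two crossing curves\<close>

lemma arc_connected_subset:
  fixes g :: "real \<Rightarrow> complex"
  assumes g: "continuous_on {0..1} g" "inj_on g {0..1}" and S: "connected S" "S \<subseteq> g ` {0..1}"
    and xy: "g x \<in> S" "g y \<in> S" "x \<in> {0..1}" "y \<in> {0..1}"
  shows "g ` {x..y} \<subseteq> S"
proof -
  define h where "h = inv_into {0..1} g"
  have h: "h (g z) = z" if "z \<in> {0..1}" for z using g(2) that by (simp add: h_def)
  have "continuous_on (g ` {0..1}) h"
    by (rule continuous_on_inv[OF g(1)]) (use h in auto)
  then have "connected (h ` S)" using S continuous_on_subset connected_continuous_image by blast
  moreover have "x \<in> h ` S" "y \<in> h ` S" using xy h by (metis image_eqI)+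
  ultimately have "{x..y} \<subseteq> h ` S" by (rule connected_contains_Icc)
  moreover have "g (h z) = z" if "z \<in> S" for z using S(2) that unfolding h_def by (meson f_inv_into_f subsetD)
  ultimately show ?thesis by force
qed

text \<open>A point of \<open>S\<close> between \<open>p\<close> and \<open>v\<close> that is
  missing from \<open>d\<close> would disconnect \<open>d\<close>. So \<open>d\<close> is the whole
  piece between them, and the rest of \<open>S\<close> is an arc.\<close>

lemma arc_initial_part:
  assumes b: "is_arc S p q" and v: "is_arc d v p" "d \<subseteq> S" "v \<noteq> q"
  obtains d' where "is_arc d' v q" "d \<union> d' = S" "d \<inter> d' = {v}"
proof -
  have vS: "v \<in> S" "v \<noteq> p" using is_arc_ends[OF v(1)] v(2) by auto
  obtain X Y where XY: "is_arc X p v" "is_arc Y v q" "X \<union> Y = S" "X \<inter> Y = {v}"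
    using is_arc_split[OF b vS v(3)] by blast
  have "X \<subseteq> d"
  proof
    fix m assume m: "m \<in> X"
    show "m \<in> d"
    proof (rule ccontr)
      assume n: "m \<notin> d"
      then have mm: "m \<noteq> p" "m \<noteq> v" using is_arc_ends[OF v(1)] by auto
      obtain X1 X2 where X: "is_arc X1 p m" "is_arc X2 m v" "X1 \<union> X2 = X" "X1 \<inter> X2 = {m}"
        using is_arc_split[OF XY(1) m mm] by blast
      have cl: "closed X1" "closed (X2 \<union> Y)"
        using X(1,2) XY(2) is_arc_compact compact_imp_closed by blast+
      have "X1 \<inter> (X2 \<union> Y) \<subseteq> {m} \<union> {v}" using X(3,4) XY(4) by blast
      moreover have "v \<notin> X1" using X(4) mm(2) is_arc_ends[OF X(2)] by auto
      ultimately have "X1 \<inter> (X2 \<union> Y) \<inter> d = {}" using n by blast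
      moreover have "d \<subseteq> X1 \<union> (X2 \<union> Y)" using v(2) XY(3) X(3) by blast
      ultimately have "X1 \<inter> d = {} \<or> (X2 \<union> Y) \<inter> d = {}"
        using is_arc_connected[OF v(1)] cl unfolding connected_closed by blast
      then show False using is_arc_ends[OF v(1)] is_arc_ends[OF X(1)] is_arc_ends[OF X(2)] by blast
    qed
  qed
  then have "X = d" by (rule is_arc_subset_eq[OF is_arc_sym[OF XY(1)] v(1)])
  then show ?thesis using that[of Y] XY by simp
qed

lemma two_elements: "S = {p,x} \<Longrightarrow> q \<in> S \<Longrightarrow> q \<noteq> p \<Longrightarrow> S = {p,q}"
  by auto

lemma Int_singletonD: "X \<inter> Y = {v} \<Longrightarrow> x \<in> X \<Longrightarrow> x \<noteq> v \<Longrightarrow> x \<notin> Y"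
  "X \<inter> Y = {v} \<Longrightarrow> x \<in> Y \<Longrightarrow> x \<noteq> v \<Longrightarrow> x \<notin> X"
  by auto

lemma Int_eq_singletonI: "X \<inter> Y \<subseteq> {p,q} \<Longrightarrow> p \<in> X \<Longrightarrow> p \<in> Y \<Longrightarrow> q \<notin> X \<or> q \<notin> Y \<Longrightarrow> X \<inter> Y = {p}"
  by auto

lemma Int_eq_emptyI: "X \<inter> Y \<subseteq> {p,q} \<Longrightarrow> p \<notin> X \<or> p \<notin> Y \<Longrightarrow> q \<notin> X \<or> q \<notin> Y \<Longrightarrow> X \<inter> Y = {}"
  by auto

text \<open>The part \<open>L\<close> of \<open>C\<close> beyond \<open>V\<close> is a single arc
  that avoids \<open>U\<close>. Hence it meets at most one of the two pieces into which
  \<open>w\<close> cuts the arc of \<open>C\<close> in the closed side \<open>a\<close> of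
  \<open>U\<close>; the other piece leads from \<open>w\<close> to an end.\<close>

lemma reach_endpoint:
  assumes c: "cross C U" "cross C V" and rs: "C \<inter> U \<subseteq> side d V"
    and w: "w \<in> C" "w \<in> side a U" "w \<in> side d V"
  obtains T r where "connected T" "w \<in> T" "r \<in> T" "r \<in> C \<inter> U" "T \<subseteq> C \<inter> (side a U \<union> U) \<inter> side d V"
proof -
  obtain r s where pq: "C \<inter> U = {r,s}" using cross_points[OF c(1)] by blast
  obtain l l' where ll: "C \<inter> V = {l,l'}" using cross_points[OF c(2)] by blast
  define L where "L = C \<inter> (side (\<not> d) V \<union> V)"
  have aL: "is_arc L l l'" unfolding L_def by (rule cross_arc[OF c(2) ll])
  define R where "R = C \<inter> (side a U \<union> U)"
  have aR: "is_arc R r s" unfolding R_def by (rule cross_arc[OF c(1) pq])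
  have LU: "L \<inter> U = {}" unfolding L_def using rs side_Int[of d V] side_disjoint[of d V] by blast
  have wR: "w \<in> R" "w \<noteq> r" "w \<noteq> s" using w pq side_disjoint[of a U] unfolding R_def by blast+
  have notL: "z \<in> side d V" if "z \<in> C" "z \<notin> L" for z
    using that not_in_side[of z V "\<not> d"] unfolding L_def by auto
  have wL: "w \<notin> L" using w(3) side_Int[of d V] side_disjoint[of d V] unfolding L_def by blast
  obtain X Y where XY: "is_arc X r w" "is_arc Y w s" "X \<union> Y = R" "X \<inter> Y = {w}"
    using is_arc_split[OF aR wR] by blast
  have "X \<inter> L = {} \<or> Y \<inter> L = {}"
  proof (cases "L \<subseteq> R")
    case True
    have "closed X" "closed Y" using XY(1,2) is_arc_compact compact_imp_closed by blast+
    moreover have "L \<subseteq> X \<union> Y" using True XY(3) by simp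
    moreover have "X \<inter> Y \<inter> L = {}" unfolding XY(4) using wL by simp
    ultimately show ?thesis using is_arc_connected[OF aL] unfolding connected_closed by blast
  next
    case False
    obtain b where b: "L \<subseteq> side b U"
      using connected_in_some_side[OF crossD(2)[OF c(1)] is_arc_connected[OF aL] LU] by blast
    have "b \<noteq> a" using False b unfolding R_def L_def by blast
    then have "b = (\<not> a)" by auto
    then have "L \<inter> R = {}" using b LU side_Int[of a U] unfolding R_def by blast
    then show ?thesis using XY(3) by blast
  qed
  then show ?thesis
  proof
    assume "X \<inter> L = {}"
    then have "X \<subseteq> C \<inter> (side a U \<union> U) \<inter> side d V" using XY(3) notL unfolding R_def by blast
    then show ?thesis using that[of X r] is_arc_connected[OF XY(1)] is_arc_ends[OF XY(1)] pq by blast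
  next
    assume "Y \<inter> L = {}"
    then have "Y \<subseteq> C \<inter> (side a U \<union> U) \<inter> side d V" using XY(3) notL unfolding R_def by blast
    then show ?thesis using that[of Y s] is_arc_connected[OF XY(2)] is_arc_ends[OF XY(2)] pq by blast
  qed
qed

lemma cross_ne: assumes "cross A D" shows "A \<inter> D \<noteq> {}"
  using cross_points[OF assms] by blast

text \<open>If \<open>p\<close> and \<open>q\<close> differed, \<open>\<zeta>\<close> would cut the
  lune of \<open>A\<close> and \<open>D\<close> into two parts, one bordered by the wall
  \<open>\<delta>\<close> and the rest of the arc of \<open>A\<close>, the other by the wall
  \<open>\<eta>\<close> and the rest of the arc of \<open>D\<close>. A point of
  \<open>B \<inter> C\<close> lies in the lune. From it, \<open>C\<close> leads to the arc of
  \<open>A\<close> but not to \<open>\<eta>\<close>, and \<open>B\<close> leads to the arc of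
  \<open>D\<close> but not to \<open>\<delta>\<close>. Together they join the two parts without
  meeting \<open>\<zeta>\<close>.\<close>

lemma walls_meet:
  assumes c: "cross A D" "cross C A" "cross C D" "cross B C" "cross B D" "cross B A"
    and h1: "C \<inter> A \<subseteq> side d D" and h2: "B \<inter> D \<subseteq> side (\<not> a) A"
    and h3: "B \<inter> C \<subseteq> side d D" and h4: "B \<inter> C \<subseteq> side (\<not> a) A"
    and D1: "is_arc \<delta> vD p" "\<delta> \<subseteq> D \<inter> (side (\<not> a) A \<union> A)" "\<delta> \<inter> B = {}" "vD \<notin> A" "p \<in> A"
    and A1: "is_arc \<eta> vA q" "\<eta> \<subseteq> A \<inter> (side d D \<union> D)" "\<eta> \<inter> C = {}" "vA \<notin> D" "q \<in> D"
    and Z: "is_arc \<zeta> vD vA" "\<zeta> - {vD,vA} \<subseteq> side d D \<inter> side (\<not> a) A" "\<zeta> \<inter> B = {}" "\<zeta> \<inter> C = {}"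
  shows "p = q"
proof (rule ccontr)
  assume ne: "p \<noteq> q"
  have pD: "p \<in> D" "vD \<in> D" using is_arc_ends[OF D1(1)] D1(2) by blast+
  have qA: "q \<in> A" "vA \<in> A" using is_arc_ends[OF A1(1)] A1(2) by blast+
  have AD: "A \<inter> D = {p,q}"
  proof -
    obtain x where "A \<inter> D = {p,x}" using card2E[of "A \<inter> D" p] c(1) D1(5) pD unfolding cross_def by blast
    then show ?thesis by (rule two_elements) (use ne qA(1) A1(5) in auto)
  qed
  then have DA: "D \<inter> A = {p,q}" by (simp add: Int_commute)
  define be where "be = D \<inter> (side (\<not> a) A \<union> A)"
  define al where "al = A \<inter> (side d D \<union> D)"
  have ab: "is_arc be p q" unfolding be_def by (rule cross_arc[OF cross_sym[OF c(1)] DA])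
  have aa: "is_arc al p q" unfolding al_def by (rule cross_arc[OF c(1) AD])
  have vn: "vD \<noteq> q" "vA \<noteq> p" using D1(4) qA(1) A1(4) pD(1) by auto
  obtain \<delta>' where d': "is_arc \<delta>' vD q" "\<delta> \<union> \<delta>' = be" "\<delta> \<inter> \<delta>' = {vD}"
    using arc_initial_part[OF ab D1(1) _ vn(1)] D1(2) unfolding be_def by blast
  obtain \<eta>' where e': "is_arc \<eta>' vA p" "\<eta> \<union> \<eta>' = al" "\<eta> \<inter> \<eta>' = {vA}"
    using arc_initial_part[OF is_arc_sym[OF aa] A1(1) _ vn(2)] A1(2) unfolding al_def by blast
  have ends: "p \<in> \<delta>" "vD \<in> \<delta>" "q \<in> \<delta>'" "vD \<in> \<delta>'" "q \<in> \<eta>" "vA \<in> \<eta>" "p \<in> \<eta>'" "vA \<in> \<eta>'" "vD \<in> \<zeta>" "vA \<in> \<zeta>"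
    using is_arc_ends[OF D1(1)] is_arc_ends[OF d'(1)] is_arc_ends[OF A1(1)] is_arc_ends[OF e'(1)] is_arc_ends[OF Z(1)] by auto
  have sub: "\<delta> \<subseteq> D" "\<delta>' \<subseteq> D" "\<eta> \<subseteq> A" "\<eta>' \<subseteq> A" using d'(2) e'(2) unfolding be_def al_def by blast+
  have nv: "p \<noteq> vD" "q \<noteq> vA" using D1(4,5) A1(4,5) by auto
  have nin: "q \<notin> \<delta>" "p \<notin> \<delta>'" "p \<notin> \<eta>" "q \<notin> \<eta>'"
    using Int_singletonD[OF d'(3)] Int_singletonD[OF e'(3)] ends vn nv by auto
  have S: "x \<inter> y \<subseteq> {p,q}" if "x \<subseteq> D" "y \<subseteq> A" for x y using that DA by blast
  have I: "\<delta> \<inter> \<eta>' = {p}" "\<delta>' \<inter> \<eta> = {q}" "\<delta> \<inter> \<eta> = {}" "\<delta>' \<inter> \<eta>' = {}"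
    using Int_eq_singletonI[OF S[OF sub(1,4)]] Int_eq_singletonI[OF S[OF sub(2,3), unfolded insert_commute[of p q]]]
      Int_eq_emptyI[OF S[OF sub(1,3)]] Int_eq_emptyI[OF S[OF sub(2,4)]] nin ends by simp_all
  have ac1: "is_arc (\<delta> \<union> \<eta>') vD vA" by (rule is_arc_join[OF D1(1) is_arc_sym[OF e'(1)] I(1)])
  have ac2: "is_arc (\<delta>' \<union> \<eta>) vD vA" by (rule is_arc_join[OF d'(1) is_arc_sym[OF A1(1)] I(2)])
  have disj: "side d D \<inter> side (\<not> a) A \<inter> (D \<union> A) = {}" using side_disjoint[of d D] side_disjoint[of "\<not> a" A] by blast
  have int12: "(\<delta> \<union> \<eta>') \<inter> (\<delta>' \<union> \<eta>) = {vD,vA}" using d'(3) e'(3) I(3,4) by blast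
  have int1: "(\<delta> \<union> \<eta>') \<inter> \<zeta> = {vD,vA}" using Z(2) disj sub ends by blast
  have int2: "(\<delta>' \<union> \<eta>) \<inter> \<zeta> = {vD,vA}" using Z(2) disj sub ends by blast
  have th: "theta (\<delta> \<union> \<eta>') (\<delta>' \<union> \<eta>) \<zeta> vD vA" unfolding theta_def using ac1 ac2 Z(1) int12 int1 int2 by simp
  have G: "(\<delta> \<union> \<eta>') \<union> (\<delta>' \<union> \<eta>) = be \<union> al" using d'(2) e'(2) by blast
  obtain e where e: "side d D \<inter> side (\<not> a) A = side e (be \<union> al)"
    using lune_side(2)[OF c(1), where a = "\<not> a" and d = d] unfolding be_def al_def by blast
  obtain w where w: "w \<in> B" "w \<in> C" using cross_ne[OF c(4)] by blast
  have ws: "w \<in> side d D" "w \<in> side (\<not> a) A" using w h3 h4 by blast+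
  obtain T1 r where T1: "connected T1" "w \<in> T1" "r \<in> T1" "r \<in> C \<inter> A" "T1 \<subseteq> C \<inter> (side (\<not> a) A \<union> A) \<inter> side d D"
    by (rule reach_endpoint[OF c(2,3) h1 w(2) ws(2,1)])
  obtain T2 t where T2: "connected T2" "w \<in> T2" "t \<in> T2" "t \<in> B \<inter> D" "T2 \<subseteq> B \<inter> (side d D \<union> D) \<inter> side (\<not> a) A"
    by (rule reach_endpoint[OF c(5,6) h2 w(1) ws])
  have "(T1 \<union> T2) \<inter> (\<delta>' \<union> \<eta>) = {}"
  proof (rule theta_separates[OF th, unfolded G])
    show "\<zeta> - {vD,vA} \<subseteq> side e (be \<union> al)" using Z(2) e by simp
    show "connected (T1 \<union> T2)" using T1 T2 by (intro connected_Un) auto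
    show "T1 \<union> T2 \<subseteq> side e (be \<union> al) \<union> (\<delta> \<union> \<eta>') \<union> (\<delta>' \<union> \<eta>)"
    proof -
      have "T1 \<subseteq> (side d D \<inter> side (\<not> a) A) \<union> al" using T1(5) unfolding al_def by blast
      moreover have "T2 \<subseteq> (side d D \<inter> side (\<not> a) A) \<union> be" using T2(5) unfolding be_def by blast
      ultimately show ?thesis unfolding e Un_assoc using G by blast
    qed
    show "(T1 \<union> T2) \<inter> \<zeta> = {}" using T1(5) T2(5) Z(3,4) by blast
    have "r \<in> al" using T1(4) h1 unfolding al_def by blast
    then have "r \<in> \<eta>'" using e'(2) A1(3) T1(4) by blast
    then show "(T1 \<union> T2) \<inter> (\<delta> \<union> \<eta>') \<noteq> {}" using T1(3) by blast
  qed
  moreover have "t \<in> be" using T2(4) h2 unfolding be_def by blast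
  then have "t \<in> \<delta>'" using d'(2) D1(3) T2(4) by blast
  ultimately show False using T2(3) by blast
qed

text \<open>Here \<open>\<zeta>\<close> followed by the wall \<open>\<kappa>\<close> cuts the lune,
  with \<open>\<delta> \<union> X\<close> on one side. Were \<open>r'\<close> on \<open>X\<close>, a
  path along \<open>C\<close> from \<open>B \<inter> C\<close> to \<open>r'\<close> and a path along
  \<open>B\<close> to a point of \<open>D\<close> off \<open>\<delta>\<close> would join both sides
  of the cut. The path along \<open>C\<close> may leave the lune through \<open>D\<close> and then
  has to be rerouted.\<close>

lemma parallel_walls:
  assumes c: "cross A D" "cross C A" "cross C D" "cross B C" "cross B D" "cross B A"
    and h1: "C \<inter> A \<subseteq> side d D" and h2: "B \<inter> D \<subseteq> side (\<not> a) A"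
    and h3: "B \<inter> C \<subseteq> side d D" and h4: "B \<inter> C \<subseteq> side (\<not> a) A"
    and h5: "A \<inter> D \<subseteq> side (\<not> c) C"
    and D1: "is_arc \<delta> vD p" "\<delta> \<subseteq> D \<inter> (side (\<not> a) A \<union> A)" "\<delta> \<inter> B = {}" "vD \<notin> A" "p \<in> A" "vD \<in> side (\<not> c) C"
    and C1: "is_arc \<kappa> vC r" "\<kappa> \<subseteq> C \<inter> (side (\<not> a) A \<union> A)" "\<kappa> \<inter> B = {}" "\<kappa> \<inter> D = {}" "vC \<notin> A" "r \<in> A" "vC \<in> side d D"
    and r': "r' \<in> C \<inter> A" "r' \<noteq> r"
    and Z: "is_arc \<zeta> vD vC" "\<zeta> - {vD,vC} \<subseteq> side d D \<inter> side (\<not> a) A" "\<zeta> \<inter> B = {}" "\<zeta> \<inter> C = {vC}"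
    and X: "is_arc X p r" "X \<subseteq> A \<inter> (side d D \<union> D)"
  shows "r' \<notin> X"
proof
  assume r'X: "r' \<in> X"
  have pD: "p \<in> D" "vD \<in> D" using is_arc_ends[OF D1(1)] D1(2) by blast+
  have rC: "r \<in> C" "vC \<in> C" using is_arc_ends[OF C1(1)] C1(2) by blast+
  obtain q where AD: "A \<inter> D = {p,q}" and pq: "p \<noteq> q"
    using card2E[of "A \<inter> D" p] c(1) D1(5) pD unfolding cross_def by blast
  then have DA: "D \<inter> A = {p,q}" by (simp add: Int_commute)
  have CA: "C \<inter> A = {r,r'}"
  proof -
    obtain x where "C \<inter> A = {r,x}" using card2E[of "C \<inter> A" r] c(2) C1(6) rC unfolding cross_def by blast
    then show ?thesis by (rule two_elements) (use r' in auto)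
  qed
  define be where "be = D \<inter> (side (\<not> a) A \<union> A)"
  define al where "al = A \<inter> (side d D \<union> D)"
  define rh where "rh = C \<inter> (side (\<not> a) A \<union> A)"
  have ab: "is_arc be p q" unfolding be_def by (rule cross_arc[OF cross_sym[OF c(1)] DA])
  have aa: "is_arc al p q" unfolding al_def by (rule cross_arc[OF c(1) AD])
  have ar: "is_arc rh r r'" unfolding rh_def by (rule cross_arc[OF c(2) CA])
  have rD: "r \<notin> D" "r' \<notin> D" "r \<in> side d D" using CA h1 side_disjoint[of d D] by blast+
  have qq: "q \<in> A" "q \<in> D" using AD by blast+
  have vn: "vD \<noteq> q" "r \<noteq> q" "vC \<noteq> r'" using D1(4) qq rD(1) C1(5) r'(1) by auto
  obtain \<delta>' where d': "is_arc \<delta>' vD q" "\<delta> \<union> \<delta>' = be" "\<delta> \<inter> \<delta>' = {vD}"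
    using arc_initial_part[OF ab D1(1) _ vn(1)] D1(2) unfolding be_def by blast
  obtain Y where Y: "is_arc Y r q" "X \<union> Y = al" "X \<inter> Y = {r}"
    using arc_initial_part[OF aa is_arc_sym[OF X(1)] _ vn(2)] X(2) unfolding al_def by blast
  obtain \<kappa>' where c': "is_arc \<kappa>' vC r'" "\<kappa> \<union> \<kappa>' = rh" "\<kappa> \<inter> \<kappa>' = {vC}"
    using arc_initial_part[OF ar C1(1) _ vn(3)] C1(2) unfolding rh_def by blast
  have ends: "p \<in> \<delta>" "vD \<in> \<delta>" "q \<in> \<delta>'" "vD \<in> \<delta>'" "p \<in> X" "r \<in> X" "r \<in> Y" "q \<in> Y" "vD \<in> \<zeta>" "vC \<in> \<zeta>"
     "vC \<in> \<kappa>" "r \<in> \<kappa>" "r' \<in> \<kappa>'"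
    using is_arc_ends[OF D1(1)] is_arc_ends[OF d'(1)] is_arc_ends[OF X(1)] is_arc_ends[OF Y(1)] is_arc_ends[OF Z(1)]
     is_arc_ends[OF C1(1)] is_arc_ends[OF c'(1)] by auto
  have sub: "\<delta> \<subseteq> D" "\<delta>' \<subseteq> D" "X \<subseteq> A" "Y \<subseteq> A" "\<kappa> \<subseteq> C" "\<kappa>' \<subseteq> C"
    using d'(2) Y(2) c'(2) unfolding be_def al_def rh_def by blast+
  have nv: "p \<noteq> vD" "p \<noteq> r" "r' \<noteq> vC" using D1(4,5) rD pD vn by auto
  have nin: "q \<notin> \<delta>" "p \<notin> \<delta>'" "q \<notin> X" "p \<notin> Y" "r' \<notin> \<kappa>"
    using Int_singletonD[OF d'(3)] Int_singletonD[OF Y(3)] Int_singletonD[OF c'(3)] ends vn nv by auto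
  have S: "x \<inter> y \<subseteq> {p,q}" if "x \<subseteq> D" "y \<subseteq> A" for x y using that DA by blast
  have I: "\<delta> \<inter> X = {p}" "\<delta>' \<inter> Y = {q}" "\<delta> \<inter> Y = {}" "\<delta>' \<inter> X = {}"
    using Int_eq_singletonI[OF S[OF sub(1,3)]] Int_eq_singletonI[OF S[OF sub(2,4), unfolded insert_commute[of p q]]]
      Int_eq_emptyI[OF S[OF sub(1,4)]] Int_eq_emptyI[OF S[OF sub(2,3)]] nin ends by simp_all
  have I5: "\<zeta> \<inter> \<kappa> = {vC}" using sub(5) Z(4) ends by blast
  have ac1: "is_arc (\<delta> \<union> X) vD r" by (rule is_arc_join[OF D1(1) X(1) I(1)])
  have ac2: "is_arc (\<delta>' \<union> Y) vD r" by (rule is_arc_join[OF d'(1) is_arc_sym[OF Y(1)] I(2)])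
  have ac: "is_arc (\<zeta> \<union> \<kappa>) vD r" by (rule is_arc_join[OF Z(1) C1(1) I5])
  have disj: "side d D \<inter> side (\<not> a) A \<inter> (D \<union> A) = {}" using side_disjoint[of d D] side_disjoint[of "\<not> a" A] by blast
  have chi: "\<kappa> \<subseteq> side d D"
    by (rule connected_subset_side[OF crossD(2)[OF c(1)] is_arc_connected[OF C1(1)] C1(4) ends(11) C1(7)])
  have cL: "(\<zeta> \<union> \<kappa>) - {vD, r} \<subseteq> side d D \<inter> side (\<not> a) A"
  proof -
    have "\<kappa> - {r} \<subseteq> side (\<not> a) A" using C1(2) CA nin(5) by blast
    moreover have "vC \<in> side d D \<inter> side (\<not> a) A" using C1(2,5,7) ends(11) by blast
    ultimately show ?thesis using chi Z(2) by blast
  qed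
  have int12: "(\<delta> \<union> X) \<inter> (\<delta>' \<union> Y) = {vD,r}" using d'(3) Y(3) I(3,4) by blast
  have int1: "(\<delta> \<union> X) \<inter> (\<zeta> \<union> \<kappa>) = {vD,r}" using cL disj sub ends by blast
  have int2: "(\<delta>' \<union> Y) \<inter> (\<zeta> \<union> \<kappa>) = {vD,r}" using cL disj sub ends by blast
  have th: "theta (\<delta> \<union> X) (\<delta>' \<union> Y) (\<zeta> \<union> \<kappa>) vD r" unfolding theta_def using ac1 ac2 ac int12 int1 int2 by simp
  have G: "(\<delta> \<union> X) \<union> (\<delta>' \<union> Y) = be \<union> al" using d'(2) Y(2) by blast
  obtain e where e: "side d D \<inter> side (\<not> a) A = side e (be \<union> al)"
    using lune_side(2)[OF c(1), where a = "\<not> a" and d = d] unfolding be_def al_def by blast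
  obtain w where w: "w \<in> B" "w \<in> C" using cross_ne[OF c(4)] by blast
  have ws: "w \<in> side d D" "w \<in> side (\<not> a) A" using w h3 h4 by blast+
  have wA: "w \<notin> A" using ws(2) side_disjoint[of "\<not> a" A] by blast
  have wc: "w \<in> \<kappa>'" using ws(2) w c'(2) C1(3) unfolding rh_def by blast
  have wv: "w \<noteq> vC" "w \<noteq> r'" using w C1(3) ends(11) wA r'(1) by blast+
  obtain T2 t where T2: "connected T2" "w \<in> T2" "t \<in> T2" "t \<in> B \<inter> D" "T2 \<subseteq> B \<inter> (side d D \<union> D) \<inter> side (\<not> a) A"
    by (rule reach_endpoint[OF c(5,6) h2 w(1) ws])
  obtain U V where UV: "is_arc U vC w" "is_arc V w r'" "U \<union> V = \<kappa>'" "U \<inter> V = {w}"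
    using is_arc_split[OF c'(1) wc wv] by blast
  have vV: "vC \<notin> V" using Int_singletonD[OF UV(4)] wv(1) is_arc_ends[OF UV(1)] by auto
  have "V \<inter> \<kappa> \<subseteq> \<kappa> \<inter> \<kappa>'" "V \<inter> \<zeta> \<subseteq> \<zeta> \<inter> C" using UV(3) sub(6) by blast+
  then have Vc: "V \<inter> \<kappa> = {}" "V \<inter> \<zeta> = {}" unfolding c'(3) Z(4) using vV by blast+
  define L where "L = C \<inter> (side (\<not> d) D \<union> D)"
  obtain l l' where ll: "C \<inter> D = {l,l'}" "l \<noteq> l'" using cross_points[OF c(3)] by blast
  have aL: "is_arc L l l'" unfolding L_def by (rule cross_arc[OF c(3) ll(1)])
  have notL: "z \<in> side d D" if "z \<in> C" "z \<notin> L" for z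
    using that not_in_side[of z D "\<not> d"] unfolding L_def by auto
  have VC: "V \<subseteq> C" "V \<subseteq> side (\<not> a) A \<union> A" using UV(3) c'(2) unfolding rh_def by blast+
  obtain T1 where T1: "connected T1" "w \<in> T1" "r' \<in> T1" "T1 \<subseteq> side d D \<inter> side (\<not> a) A \<union> (be \<union> al)"
    "T1 \<inter> (\<zeta> \<union> \<kappa>) = {}"
  proof (cases "V \<inter> L = {}")
    case True
    have "V \<subseteq> side d D" using True VC(1) notL by blast
    then have "V \<subseteq> side d D \<inter> side (\<not> a) A \<union> (be \<union> al)" using VC unfolding al_def by blast
    then show ?thesis using that[of V] is_arc_connected[OF UV(2)] is_arc_ends[OF UV(2)] Vc by blast
  next
    case False
    have LA: "L \<inter> A = {}" using h1 side_Int[of d D] side_disjoint[of d D] unfolding L_def by blast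
    obtain b where b: "L \<subseteq> side b A"
      using connected_in_some_side[OF crossD(1)[OF c(1)] is_arc_connected[OF aL] LA] by blast
    have "b = (\<not> a)"
    proof (rule ccontr)
      assume "b \<noteq> (\<not> a)" then have "b = a" by auto
      then show False using False b VC(2) LA side_Int[of a A] by blast
    qed
    then have La: "L \<subseteq> side (\<not> a) A" using b by simp
    have wL: "w \<notin> L" using ws(1) side_Int[of d D] side_disjoint[of d D] unfolding L_def by blast
    have "L \<subseteq> rh" using La unfolding rh_def L_def by blast
    moreover have "L \<inter> \<kappa> = {}" using chi side_Int[of d D] side_disjoint[of d D] unfolding L_def by blast
    ultimately have "L \<subseteq> U \<union> V" using c'(2) UV(3) by blast
    moreover have "closed U" "closed V" using UV(1,2) is_arc_compact compact_imp_closed by blast+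
    moreover have "U \<inter> V \<inter> L = {}" unfolding UV(4) using wL by simp
    ultimately have "U \<inter> L = {}" using False is_arc_connected[OF aL] unfolding connected_closed by blast
    then have LV: "L \<subseteq> V" using \<open>L \<subseteq> U \<union> V\<close> by blast
    obtain g where g: "continuous_on {0..1::real} g" "inj_on g {0..1}" "g ` {0..1} = V" "g 0 = w" "g 1 = r'"
      using is_arcE[OF UV(2)] by blast
    have lL: "l \<in> L" "l' \<in> L" using is_arc_ends[OF aL] by auto
    obtain m m' x1 x2 where x: "0 \<le> x1" "x1 < x2" "x2 \<le> 1" "g x1 = m" "g x2 = m'" "{m,m'} = {l,l'}" "is_arc L m m'"
    proof -
      have "l \<in> g ` {0..1}" "l' \<in> g ` {0..1}" using lL LV g(3) by blast+
      then obtain y1 y2 where y: "y1 \<in> {0..1}" "g y1 = l" "y2 \<in> {0..1}" "g y2 = l'" by blast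
      have "y1 \<noteq> y2" using y ll(2) by auto
      then consider "y1 < y2" | "y2 < y1" by linarith
      then show ?thesis
      proof cases
        case 1 then show ?thesis using that[of y1 y2 l l'] y aL by auto
      next
        case 2 then show ?thesis using that[of y2 y1 l' l] y is_arc_sym[OF aL] by auto
      qed
    qed
    have gL: "g ` {x1..x2} = L"
    proof (rule is_arc_subset_eq[OF _ x(7)])
      show "is_arc (g ` {x1..x2}) m m'" unfolding x(4,5)[symmetric]
        by (rule is_arc_interval[OF x(2)])
          (use x(1,3) in \<open>auto intro: continuous_on_subset[OF g(1)] inj_on_subset[OF g(2)]\<close>)
      show "g ` {x1..x2} \<subseteq> L"
        by (rule arc_connected_subset[OF g(1,2) is_arc_connected[OF aL]])
          (use LV g(3) x is_arc_ends[OF x(7)] in auto)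
    qed
    \<comment> \<open>The excursion \<open>L\<close> of \<open>C\<close> beyond \<open>D\<close> is
      replaced by the arc of \<open>D\<close> with the same ends in the closed side \<open>c\<close>
      of \<open>C\<close>. This arc avoids \<open>A\<close> by \<open>h5\<close>, so it lies on the
      border of the lune, and it misses the cut because \<open>vD\<close> is on the other side of
      \<open>C\<close> and \<open>\<kappa>\<close> avoids \<open>D\<close>.\<close>
    define K where "K = D \<inter> (side c C \<union> C)"
    have DC: "D \<inter> C = {m,m'}" using ll(1) x(6) by (simp add: Int_commute)
    have aK: "is_arc K m m'" unfolding K_def by (rule cross_arc[OF cross_sym[OF c(3)] DC])
    have KA: "K \<inter> A = {}" using h5 side_Int[of c C] side_disjoint[of "\<not> c" C] unfolding K_def by blast
    have mK: "m \<in> K" "m' \<in> K" using is_arc_ends[OF aK] by auto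
    have "m \<in> side (\<not> a) A" using La is_arc_ends[OF x(7)] by auto
    then have Ka: "K \<subseteq> side (\<not> a) A"
      using connected_subset_side[OF crossD(1)[OF c(1)] is_arc_connected[OF aK] KA mK(1)] by blast
    define T1 where "T1 = g ` {0..x1} \<union> K \<union> g ` {x2..1}"
    have co: "connected (g ` {0..x1})" "connected (g ` {x2..1})"
      using x by (auto intro!: connected_continuous_image continuous_on_subset[OF g(1)])
    have mem: "m \<in> g ` {0..x1}" "m' \<in> g ` {x2..1}" unfolding x(4,5)[symmetric] using x(1-3) by simp_all
    have "connected (g ` {0..x1} \<union> K)"
      by (rule connected_Un[OF co(1) is_arc_connected[OF aK]]) (use mem mK in blast)
    then have 1: "connected T1" unfolding T1_def
      by (rule connected_Un[OF _ co(2)]) (use mem mK in blast)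
    have "g 0 \<in> T1" "g 1 \<in> T1" unfolding T1_def using x(1,2,3) by simp_all
    then have 2: "w \<in> T1" "r' \<in> T1" using g(4,5) by simp_all
    have outer: "g y \<in> side d D \<or> g y \<in> K" if y: "y \<in> {0..x1} \<union> {x2..1}" for y
    proof (cases "g y \<in> L")
      case True
      then obtain z where z: "z \<in> {x1..x2}" "g y = g z" using gL by blast
      have "y \<in> {0..1}" "z \<in> {0..1}" using y z(1) x(1-3) by auto
      then have "y = z" using z(2) inj_onD[OF g(2)] by blast
      then have "y = x1 \<or> y = x2" using y z(1) by auto
      then show ?thesis using x(4,5) mK by blast
    next
      case False
      have "y \<in> {0..1}" using y x(1-3) by auto
      then have "g y \<in> V" using g(3) by blast
      then show ?thesis using False notL VC(1) by blast
    qed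
    have gV: "g ` {0..x1} \<subseteq> V" "g ` {x2..1} \<subseteq> V" using x(1-3) g(3) by auto
    have "g ` {0..x1} \<union> g ` {x2..1} \<subseteq> side d D \<inter> side (\<not> a) A \<union> (be \<union> al) \<union> K"
      using outer gV VC unfolding al_def by blast
    moreover have "K \<subseteq> be" using Ka unfolding be_def K_def by blast
    ultimately have 3: "T1 \<subseteq> side d D \<inter> side (\<not> a) A \<union> (be \<union> al)" unfolding T1_def by blast
    have "\<zeta> \<inter> D \<subseteq> {vD}"
    proof
      fix z assume z: "z \<in> \<zeta> \<inter> D"
      have "vC \<notin> D" using C1(4) ends(11) by blast
      then have "z \<noteq> vC" using z by auto
      moreover have "z \<notin> side d D" using z side_disjoint[of d D] by auto
      ultimately show "z \<in> {vD}" using Z(2) z by auto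
    qed
    moreover have "vD \<notin> K" using D1(6) side_Int[of c C] side_disjoint[of "\<not> c" C] unfolding K_def by blast
    ultimately have "K \<inter> (\<zeta> \<union> \<kappa>) = {}" using C1(4) unfolding K_def by blast
    then have 4: "T1 \<inter> (\<zeta> \<union> \<kappa>) = {}" using Vc gV unfolding T1_def by blast
    show ?thesis by (rule that[OF 1 2 3 4])
  qed
  have "(T1 \<union> T2) \<inter> (\<delta>' \<union> Y) = {}"
  proof (rule theta_separates[OF th, unfolded G])
    show "(\<zeta> \<union> \<kappa>) - {vD,r} \<subseteq> side e (be \<union> al)" using cL e by simp
    show "connected (T1 \<union> T2)" using T1 T2 by (intro connected_Un) auto
    show "T1 \<union> T2 \<subseteq> side e (be \<union> al) \<union> (\<delta> \<union> X) \<union> (\<delta>' \<union> Y)"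
    proof -
      have "T2 \<subseteq> (side d D \<inter> side (\<not> a) A) \<union> be" using T2(5) unfolding be_def by blast
      then show ?thesis using T1(4) unfolding e Un_assoc using G by blast
    qed
    show "(T1 \<union> T2) \<inter> (\<zeta> \<union> \<kappa>) = {}" using T1(5) T2(5) Z(3) C1(3) by blast
    show "(T1 \<union> T2) \<inter> (\<delta> \<union> X) \<noteq> {}" using T1(3) r'X by blast
  qed
  moreover have "t \<in> be" using T2(4) h2 unfolding be_def by blast
  then have "t \<in> \<delta>'" using d'(2) D1(3) T2(4) by blast
  ultimately show False using T2(3) by blast
qed

section \<open>Parity of first hits\<close>

text \<open>Only one direction of travel from the base point is examined;
  \<open>first_hit_flip\<close> shows that for nested sides the opposite comparison is then its
  negation.\<close>

definition first_hit :: "(real \<Rightarrow> complex) \<Rightarrow> complex set \<Rightarrow> complex set \<Rightarrow> bool" where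
  "first_hit g A B \<longleftrightarrow> (\<exists>s\<in>{0..1}. g s \<in> A \<and> (\<forall>x\<in>{0..s}. g x \<notin> B))"

text \<open>Seen from \<open>F\<close>, side \<open>a\<close> of \<open>A\<close> is contained in side \<open>b\<close> of \<open>B\<close>: if \<open>F\<close> crosses \<open>A\<close> and \<open>B\<close>,
  the condition amounts to \<open>F \<inter> side a A \<subseteq> side b B\<close>.\<close>

definition nested :: "bool \<Rightarrow> complex set \<Rightarrow> bool \<Rightarrow> complex set \<Rightarrow> complex set \<Rightarrow> bool" where
  "nested a A b B F \<longleftrightarrow> F \<inter> A \<subseteq> side b B \<and> F \<inter> B \<subseteq> side (\<not> a) A"

lemma nested_flip: "nested a A b B F \<Longrightarrow> nested (\<not> b) B (\<not> a) A F"
  by (auto simp: nested_def)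

lemma loop_cover:
  assumes l: "loop g F" and F: "F \<inter> G = {g s, g t}" and st: "0 < s" "s < 1" "0 < t" "t < 1"
    and x: "x \<in> {0..1}" "g x \<in> G"
  shows "x = s \<or> x = t"
proof -
  have "g x \<in> F" using loopD(3)[OF l] x(1) by blast
  then have "g x = g s \<or> g x = g t" using F x(2) by blast
  then show ?thesis using loop_inj_open[OF l x(1)] st by blast
qed

text \<open>The base point lies off \<open>side a A\<close> but in \<open>side b B\<close>. Nesting
  keeps the visits to \<open>A\<close> out of the excursion beyond \<open>B\<close> and the visits
  to \<open>B\<close> out of the passage through \<open>side a A\<close>. So the cyclic word of
  crossings, read from the base point, is AABB or BBAA.\<close>

lemma word_cases:
  assumes l: "loop g F" and c: "cross F A" "cross F B" and v: "g 0 \<in> side (\<not> a) A" "g 0 \<in> side b B"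
    and n: "nested a A b B F"
  obtains s t s' t' where "0 < s" "s < t" "t < s'" "s' < t'" "t' < 1" "F \<inter> A = {g s, g t}" "F \<inter> B = {g s', g t'}"
      "first_hit g A B" "\<not> first_hit g B A"
  | s t s' t' where "0 < s'" "s' < t'" "t' < s" "s < t" "t < 1" "F \<inter> A = {g s, g t}" "F \<inter> B = {g s', g t'}"
      "first_hit g B A" "\<not> first_hit g A B"
proof -
  have nA: "g 0 \<notin> A" "g 0 \<notin> B" using v in_side_not by blast+
  obtain s t where st: "0 < s" "s < t" "t < 1" "F \<inter> A = {g s, g t}" by (rule loop_points[OF l c(1) nA(1)])
  obtain s' t' where st': "0 < s'" "s' < t'" "t' < 1" "F \<inter> B = {g s', g t'}" by (rule loop_points[OF l c(2) nA(2)])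
  note SA = loop_sides(2)[OF l c(1) v(1) st]
  note SB = loop_sides(2)[OF l c(2) v(2) st']
  have B: "g s' \<in> side (\<not> a) A" "g t' \<in> side (\<not> a) A" using n st'(4) unfolding nested_def by blast+
  have A: "g s \<in> side b B" "g t \<in> side b B" using n st(4) unfolding nested_def by blast+
  have AA: "g s \<in> A" "g t \<in> A" "g s' \<in> B" "g t' \<in> B" using st(4) st'(4) by blast+
  have ne: "s' \<noteq> s" "s' \<noteq> t" "t' \<noteq> s" "t' \<noteq> t"
    using A AA(3,4) side_disjoint[of b B] by auto
  have notin: "\<not> (s < s' \<and> s' < t)" "\<not> (s < t' \<and> t' < t)" "\<not> (s' < s \<and> s < t')" "\<not> (s' < t \<and> t < t')"
    using SA[of s'] SA[of t'] SB[of s] SB[of t] A B side_Int[of "\<not> a" A] side_Int[of b B] by blast+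
  have hA: "x = s \<or> x = t" if "x \<in> {0..1}" "g x \<in> A" for x
    using loop_cover[OF l st(4)] st that by auto
  have hB: "x = s' \<or> x = t'" if "x \<in> {0..1}" "g x \<in> B" for x
    using loop_cover[OF l st'(4)] st' that by auto
  consider "t < s'" | "t' < s" using notin ne st st' by linarith
  then show ?thesis
  proof cases
    case 1
    have "first_hit g A B" unfolding first_hit_def
      by (rule bexI[of _ s]) (use AA(1) hB st st' 1 in auto, fastforce)
    moreover have "\<not> first_hit g B A"
    proof
      assume "first_hit g B A"
      then obtain x where x: "x \<in> {0..1}" "g x \<in> B" "\<forall>y\<in>{0..x}. g y \<notin> A" unfolding first_hit_def by blast
      then have "s \<in> {0..x}" using hB[OF x(1,2)] st st' 1 by auto
      then show False using x(3) AA(1) by blast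
    qed
    ultimately show ?thesis using that(1)[of s t s' t'] st st' 1 by blast
  next
    case 2
    have "first_hit g B A" unfolding first_hit_def
      by (rule bexI[of _ s']) (use AA(3) hA st st' 2 in auto, fastforce)
    moreover have "\<not> first_hit g A B"
    proof
      assume "first_hit g A B"
      then obtain x where x: "x \<in> {0..1}" "g x \<in> A" "\<forall>y\<in>{0..x}. g y \<notin> B" unfolding first_hit_def by blast
      then have "s' \<in> {0..x}" using hA[OF x(1,2)] st st' 2 by auto
      then show False using x(3) AA(3) by blast
    qed
    ultimately show ?thesis using that(2)[of s' t' s t] st st' 2 by blast
  qed
qed

lemma first_hit_flip:
  assumes "loop g F" "cross F A" "cross F B" "g 0 \<in> side (\<not> a) A" "g 0 \<in> side b B" "nested a A b B F"
  shows "first_hit g B A \<longleftrightarrow> \<not> first_hit g A B"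
  by (rule word_cases[OF assms]) auto

text \<open>In a word AABB the curve \<open>A\<close> is reached without touching \<open>B\<close>
  by going forward, in a word BBAA by going backward from the base point. The end \<open>p\<close>
  of the wall therefore records the answer of \<open>first_hit\<close>.\<close>

lemma wall:
  assumes l: "loop g F" and c: "cross F A" "cross F B" and v: "g 0 \<in> side (\<not> a) A" "g 0 \<in> side b B"
    and n: "nested a A b B F" and st: "0 < s" "s < t" "t < 1" "F \<inter> A = {g s, g t}"
  defines "w \<equiv> (if first_hit g A B then g ` {0..s} else g ` {t..1})"
    and "p \<equiv> (if first_hit g A B then g s else g t)"
  shows "is_arc w (g 0) p" "w \<subseteq> F \<inter> (side (\<not> a) A \<union> A)" "w \<inter> B = {}" "p \<in> A"
proof -
  show "p \<in> A" using st(4) unfolding p_def by auto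
  have l0: "g 1 = g 0" using loopD(2)[OF l] .
  have "is_arc (g ` {0..s}) (g 0) (g s)" "is_arc (g ` {t..1}) (g t) (g 1)"
    using loop_arc[OF l, of 0 s] loop_arc[OF l, of t 1] st by auto
  then show "is_arc w (g 0) p" unfolding w_def p_def using l0 is_arc_sym by auto
  note S = loop_sides(1)[OF l c(1) v(1) st]
  have in01: "w \<subseteq> g ` {0..1}" using st unfolding w_def by auto
  have gs: "g s \<in> A" "g t \<in> A" using st(4) by blast+
  have "g x \<in> side (\<not> a) A \<union> A" if "x \<in> {0..s} \<union> {t..1}" for x
  proof -
    have "x = s \<or> x = t \<or> x \<in> {0..1} \<and> (x < s \<or> t < x)" using that st(1-3) by auto
    then show ?thesis using S[of x] gs by blast
  qed
  then have "w \<subseteq> side (\<not> a) A \<union> A" unfolding w_def by (simp add: image_subset_iff)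
  then show "w \<subseteq> F \<inter> (side (\<not> a) A \<union> A)" using in01 loopD(3)[OF l] by blast
  have un: "s1 = s \<and> t1 = t" if "0 < s1" "s1 < t1" "t1 < 1" "F \<inter> A = {g s1, g t1}" for s1 t1
  proof -
    have "g s1 \<in> A" "g t1 \<in> A" using that(4) by blast+
    then have "s1 = s \<or> s1 = t" "t1 = s \<or> t1 = t"
      using loop_cover[OF l st(4), of s1] loop_cover[OF l st(4), of t1] st(1-3) that(1-3) by auto
    then show ?thesis using that(2) st(2) by auto
  qed
  show "w \<inter> B = {}"
  proof (cases rule: word_cases[OF l c v n])
    case (1 s1 t1 s' t')
    have e: "s1 = s" "t1 = t" using un[of s1 t1] 1 by auto
    have "g x \<notin> B" if "x \<in> {0..s}" for x
    proof
      assume "g x \<in> B"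
      then have "x = s' \<or> x = t'" using loop_cover[OF l 1(7), of x] 1(1-5) that e by auto
      then show False using 1(1-5) that e by auto
    qed
    then show ?thesis unfolding w_def using 1 by auto
  next
    case (2 s1 t1 s' t')
    have e: "s1 = s" "t1 = t" using un[of s1 t1] 2 by auto
    have "g x \<notin> B" if "x \<in> {t..1}" for x
    proof
      assume "g x \<in> B"
      then have "x = s' \<or> x = t'" using loop_cover[OF l 2(7), of x] 2(1-5) that e by auto
      then show False using 2(1-5) that e by auto
    qed
    then show ?thesis unfolding w_def using 2 by auto
  qed
qed

lemma cross_ne_ends: "cross F A \<Longrightarrow> F \<inter> A = {x, y} \<Longrightarrow> x \<noteq> y"
  unfolding cross_def by auto

lemma nestedD:
  assumes "nested a A b B F"
  shows "F \<inter> A \<subseteq> side b B" "F \<inter> B \<subseteq> side (\<not> a) A" "A \<inter> F \<subseteq> side b B" "B \<inter> F \<subseteq> side (\<not> a) A"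
  using assms unfolding nested_def by auto

text \<open>The wall of \<open>D\<close> towards \<open>A\<close> and the wall of \<open>A\<close>
  towards \<open>D\<close> end at the same crossing by \<open>walls_meet\<close>, and by orientation
  the first crossing along \<open>gD\<close> is the first along \<open>gA\<close>. So either both
  walls run forward or both run backward.\<close>

lemma interleaving_first_hit:
  assumes c: "cross A D" "cross C A" "cross C D" "cross B C" "cross B D" "cross B A"
    and n: "nested a A b B C" "nested a A b B D" "nested c C d D A" "nested c C d D B"
    and o: "oriented a A gA" "oriented d D gD"
    and v: "gD 0 \<in> side (\<not> a) A" "gD 0 \<in> side b B" "gA 0 \<in> side (\<not> c) C" "gA 0 \<in> side d D"
    and Z: "is_arc \<zeta> (gD 0) (gA 0)" "\<zeta> - {gD 0, gA 0} \<subseteq> side d D \<inter> side (\<not> a) A" "\<zeta> \<inter> B = {}" "\<zeta> \<inter> C = {}"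
  shows "first_hit gD A B \<longleftrightarrow> first_hit gA D C"
proof -
  have l: "loop gA A" "loop gD D" using o unfolding oriented_def by auto
  note cs = cross_sym[OF c(1)] cross_sym[OF c(2)] cross_sym[OF c(3)] cross_sym[OF c(4)] cross_sym[OF c(5)]
  have na: "gD 0 \<notin> A" "gA 0 \<notin> D" using v in_side_not by blast+
  obtain s t where st: "0 < s" "s < t" "t < 1" "D \<inter> A = {gD s, gD t}" by (rule loop_points[OF l(2) cs(1) na(1)])
  obtain s' t' where st': "0 < s'" "s' < t'" "t' < 1" "A \<inter> D = {gA s', gA t'}" by (rule loop_points[OF l(1) c(1) na(2)])
  note W = wall[OF l(2) cs(1,5) v(1,2) n(2) st]
  have v': "gA 0 \<in> side (\<not> \<not> d) D" using v(4) by simp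
  note W' = wall[OF l(1) c(1) cs(2) v' v(3) nested_flip[OF n(3)] st']
  have eq: "(if first_hit gD A B then gD s else gD t) = (if first_hit gA D C then gA s' else gA t')"
    by (rule walls_meet[OF c nestedD(3)[OF n(3)] nestedD(4)[OF n(2)] nestedD(1)[OF n(4)] nestedD(4)[OF n(1)]
          W(1,2,3) na(1) W(4) W'(1) _ W'(3) na(2) W'(4) Z])
      (use W'(2) in auto)
  have "gD 0 \<notin> side a A" using v(1) in_side_not(2)[of "gD 0" "\<not> a" A] by auto
  moreover have DA: "D \<inter> A = {gA s', gA t'}" using st'(4) by blast
  ultimately have "gD s = gA s'"
    using orientation_base_bool[OF o(2) o(1) cs(1) st st'(1-3) DA] v(4) by simp
  moreover have "gD s \<noteq> gD t" "gA s' \<noteq> gA t'" using cross_ne_ends[OF cs(1)] st(4) DA by auto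
  moreover have "{gD s, gD t} = {gA s', gA t'}" using st(4) DA by simp
  ultimately show ?thesis using eq by (auto split: if_splits simp: doubleton_eq_iff)
qed

text \<open>The ends of the walls of \<open>C\<close> and \<open>D\<close> on \<open>A\<close> are
  compared along a loop on \<open>A\<close>. Orientation identifies which crossing is which;
  different answers would produce the configuration excluded by
  \<open>parallel_walls\<close>.\<close>

lemma parallel_first_hit_aux:
  assumes c: "cross A D" "cross C A" "cross C D" "cross B C" "cross B D" "cross B A"
    and n: "nested a A b B C" "nested a A b B D" "nested c C d D A" "nested c C d D B"
    and o: "oriented c C gC" "oriented d D gD"
    and v: "gD 0 \<in> side (\<not> a) A" "gD 0 \<in> side b B" "gD 0 \<in> side (\<not> c) C"
       "gC 0 \<in> side (\<not> a) A" "gC 0 \<in> side b B" "gC 0 \<in> side d D"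
    and Z: "is_arc \<zeta> (gD 0) (gC 0)" "\<zeta> - {gD 0, gC 0} \<subseteq> side d D \<inter> side (\<not> a) A" "\<zeta> \<inter> B = {}" "\<zeta> \<inter> C = {gC 0}"
    and st: "0 < s" "s < t" "t < 1" "C \<inter> A = {gC s, gC t}"
    and k: "(if first_hit gC A B then gC ` {0..s} else gC ` {t..1}) \<inter> D = {}"
  shows "first_hit gD A B \<longleftrightarrow> first_hit gC A B"
proof (rule ccontr)
  assume mm: "\<not> ?thesis"
  have l: "loop gC C" "loop gD D" using o unfolding oriented_def by auto
  note cs = cross_sym[OF c(1)] cross_sym[OF c(2)] cross_sym[OF c(3)] cross_sym[OF c(4)] cross_sym[OF c(5)]
  have na: "gD 0 \<notin> A" "gC 0 \<notin> A" using v in_side_not by blast+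
  obtain x y where xy: "0 < x" "x < y" "y < 1" "D \<inter> A = {gD x, gD y}" by (rule loop_points[OF l(2) cs(1) na(1)])
  note W = wall[OF l(2) cs(1,5) v(1,2) n(2) xy]
  note W' = wall[OF l(1) c(2) cs(4) v(4,5) n(1) st]
  \<comment> \<open>A base point beyond \<open>D\<close> makes the passage of \<open>gA\<close>
    through \<open>side d D\<close> one interval of parameters. It contains both crossings with
    \<open>C\<close>, giving the order \<open>uD < uC < wC < wD\<close>.\<close>
  obtain u where u: "u \<in> A" "u \<in> side (\<not> d) D" using crossD(4)[OF c(1), of "\<not> d"] by blast
  obtain gA where gA: "oriented a A gA" "gA 0 = u" using oriented_exists[OF crossD(1)[OF c(1)] u(1)] by blast
  have lA: "loop gA A" using gA unfolding oriented_def by auto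
  have vA: "gA 0 \<in> side (\<not> d) D" using gA(2) u(2) by simp
  have uD: "gA 0 \<notin> D" "gA 0 \<notin> side d D"
    using vA in_side_not(1) in_side_not(2)[of "gA 0" "\<not> d" D] by auto
  have uC: "gA 0 \<notin> C"
  proof
    assume "gA 0 \<in> C"
    then have "gA 0 \<in> C \<inter> A" using u(1) gA(2) by simp
    then show False using nestedD(3)[OF n(3)] uD(2) by blast
  qed
  obtain uD wD where D: "0 < uD" "uD < wD" "wD < 1" "A \<inter> D = {gA uD, gA wD}" by (rule loop_points[OF lA c(1) uD(1)])
  obtain uC wC where C: "0 < uC" "uC < wC" "wC < 1" "A \<inter> C = {gA uC, gA wC}" by (rule loop_points[OF lA cs(2) uC])
  note SD1 = loop_sides(1)[OF lA c(1) vA D]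
  have SD2: "gA z \<in> side d D" if "uD < z" "z < wD" for z using loop_sides(2)[OF lA c(1) vA D that] by simp
  have CD: "gA uC \<in> side d D" "gA wC \<in> side d D" using nestedD(1)[OF n(3)] C(4) by blast+
  have DC: "gA uD \<in> side (\<not> c) C" "gA wD \<in> side (\<not> c) C" using nestedD(2)[OF n(3)] D(4) by blast+
  have inC: "uD < z \<and> z < wD" if "z \<in> {0..1}" "gA z \<in> side d D" for z
  proof -
    have "z \<noteq> uD" "z \<noteq> wD" using that(2) D(4) side_disjoint[of d D] by blast+
    moreover have "\<not> (z < uD \<or> wD < z)" using SD1[OF that(1)] that(2) side_Int[of d D] by blast
    ultimately show ?thesis by linarith
  qed
  have ord: "uD < uC" "wC < wD" using inC[of uC] inC[of wC] CD C by auto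
  have nc: "gA 0 \<notin> side c C"
  proof
    assume "gA 0 \<in> side c C"
    then have "gA uD \<in> side c C" using loop_sides(1)[OF lA cs(2) _ C, of c uD] ord D C by auto
    then show False using DC(1) side_Int[of c C] by blast
  qed
  have eD: "D \<inter> A = {gA uD, gA wD}" and eC: "C \<inter> A = {gA uC, gA wC}" using D(4) C(4) by blast+
  have oD: "gD x = gA wD"
  proof -
    have "gD 0 \<notin> side a A" using v(1) in_side_not(2)[of "gD 0" "\<not> a" A] by auto
    then show ?thesis using orientation_base_bool[OF o(2) gA(1) cs(1) xy D(1-3) eD] uD(2) by simp
  qed
  have oC: "gC s = gA wC"
  proof -
    have "gC 0 \<notin> side a A" using v(4) in_side_not(2)[of "gC 0" "\<not> a" A] by auto
    then show ?thesis using orientation_base_bool[OF o(1) gA(1) c(2) st C(1-3) eC] nc by simp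
  qed
  have neq: "gD x \<noteq> gD y" "gC s \<noteq> gC t" "gA uD \<noteq> gA wD" "gA uC \<noteq> gA wC"
    using cross_ne_ends[OF cs(1) xy(4)] cross_ne_ends[OF c(2) st(4)] cross_ne_ends[OF c(1) D(4)] cross_ne_ends[OF cs(2) C(4)] by auto
  have oD': "gD y = gA uD" and oC': "gC t = gA uC"
    using oD oC neq xy(4) eD st(4) eC by (auto simp: doubleton_eq_iff)
  have al: "gA ` {z1..z2} \<subseteq> A \<inter> (side d D \<union> D)" if "uD \<le> z1" "z2 \<le> wD" for z1 z2
  proof
    fix q assume "q \<in> gA ` {z1..z2}"
    then obtain z where z: "z \<in> {z1..z2}" "q = gA z" by blast
    have "z \<in> {0..1}" using z(1) that D by auto
    then have "q \<in> A" using z(2) loopD(3)[OF lA] by blast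
    moreover have "z = uD \<or> z = wD \<or> uD < z \<and> z < wD" using z(1) that by auto
    then have "q \<in> side d D \<union> D" using SD2[of z] D(4) z(2) by blast
    ultimately show "q \<in> A \<inter> (side d D \<union> D)" by simp
  qed
  define p where "p = (if first_hit gD A B then gD x else gD y)"
  define r where "r = (if first_hit gC A B then gC s else gC t)"
  define r' where "r' = (if first_hit gC A B then gC t else gC s)"
  have r': "r' \<in> C \<inter> A" "r' \<noteq> r" using st(4) neq(2) unfolding r_def r'_def by auto
  have PW: "r' \<notin> X" if X: "is_arc X p r" "X \<subseteq> A \<inter> (side d D \<union> D)" for X
    by (rule parallel_walls[OF c nestedD(3)[OF n(3)] nestedD(4)[OF n(2)] nestedD(1)[OF n(4)] nestedD(4)[OF n(1)] nestedD(2)[OF n(3)]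
          W(1,2,3) na(1) W(4) v(3) W'(1,2,3) k na(2) W'(4) v(6) r'[unfolded r_def] Z X[unfolded p_def r_def]])
  \<comment> \<open>With different answers, the arc of \<open>A\<close> from \<open>p\<close> to
    \<open>r\<close> in the closed side of \<open>D\<close> contains both crossings of
    \<open>A\<close> with \<open>C\<close>.\<close>
  consider "first_hit gD A B" "\<not> first_hit gC A B" | "\<not> first_hit gD A B" "first_hit gC A B" using mm by blast
  then show False
  proof cases
    case 1
    have "is_arc (gA ` {uC..wD}) (gA uC) (gA wD)" using loop_arc[OF lA, of uC wD] C D ord by auto
    then have "is_arc (gA ` {uC..wD}) p r" unfolding p_def r_def using 1 oD oC' is_arc_sym by simp
    moreover have "r' \<in> gA ` {uC..wD}" unfolding r'_def using 1 oC C(2) ord by simp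
    ultimately show False using PW al[of uC wD] ord by auto
  next
    case 2
    have "is_arc (gA ` {uD..wC}) (gA uD) (gA wC)" using loop_arc[OF lA, of uD wC] C D ord by auto
    then have "is_arc (gA ` {uD..wC}) p r" unfolding p_def r_def using 2 oD' oC by simp
    moreover have "r' \<in> gA ` {uD..wC}" unfolding r'_def using 2 oC' C(2) ord by simp
    ultimately show False using PW al[of uD wC] ord by auto
  qed
qed

text \<open>The auxiliary lemma needs a wall of \<open>C\<close> that misses \<open>D\<close>.
  \<open>C\<close> has a wall towards \<open>A\<close> and one towards \<open>B\<close>, leaving the
  base point in opposite directions, and at least one of them qualifies. If it is the wall towards
  \<open>B\<close>, the roles of \<open>A\<close> and \<open>B\<close> are exchanged by
  \<open>nested_flip\<close>.\<close>

lemma parallel_first_hit: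
  assumes c: "cross A D" "cross C A" "cross C D" "cross B C" "cross B D" "cross B A"
    and n: "nested a A b B C" "nested a A b B D" "nested c C d D A" "nested c C d D B"
    and o: "oriented c C gC" "oriented d D gD"
    and v: "gD 0 \<in> side (\<not> a) A" "gD 0 \<in> side b B" "gD 0 \<in> side (\<not> c) C"
       "gC 0 \<in> side (\<not> a) A" "gC 0 \<in> side b B" "gC 0 \<in> side d D"
    and Z: "is_arc \<zeta> (gD 0) (gC 0)" "\<zeta> - {gD 0, gC 0} \<subseteq> side d D \<inter> side (\<not> a) A \<inter> side b B" "\<zeta> \<inter> C = {gC 0}"
  shows "first_hit gD A B \<longleftrightarrow> first_hit gC A B"
proof -
  have l: "loop gC C" "loop gD D" using o unfolding oriented_def by auto
  note cs = cross_sym[OF c(1)] cross_sym[OF c(2)] cross_sym[OF c(3)] cross_sym[OF c(4)] cross_sym[OF c(5)] cross_sym[OF c(6)]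
  have ZA: "\<zeta> \<inter> A = {}" "\<zeta> \<inter> B = {}"
    using Z(2) v side_disjoint[of b B] side_disjoint[of "\<not> a" A] by blast+
  have nC: "gC 0 \<notin> A" "gC 0 \<notin> B" "gC 0 \<notin> D" using v in_side_not by blast+
  obtain s t where st: "0 < s" "s < t" "t < 1" "C \<inter> A = {gC s, gC t}" by (rule loop_points[OF l(1) c(2) nC(1)])
  obtain s' t' where st': "0 < s'" "s' < t'" "t' < 1" "C \<inter> B = {gC s', gC t'}" by (rule loop_points[OF l(1) cs(4) nC(2)])
  obtain x y where xy: "0 < x" "x < y" "y < 1" "C \<inter> D = {gC x, gC y}" by (rule loop_points[OF l(1) c(3) nC(3)])
  define k1 where "k1 = (if first_hit gC A B then {0..s} else {t..1})"
  define k2 where "k2 = (if first_hit gC B A then {0..s'} else {t'..1})"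
  have fl: "first_hit gC B A \<longleftrightarrow> \<not> first_hit gC A B" by (rule first_hit_flip[OF l(1) c(2) cs(4) v(4,5) n(1)])
  have fl': "first_hit gD B A \<longleftrightarrow> \<not> first_hit gD A B" by (rule first_hit_flip[OF l(2) cs(1) cs(5) v(1,2) n(2)])
  have inD: "gC s \<in> side d D" "gC t \<in> side d D" "gC s' \<in> side d D" "gC t' \<in> side d D"
    using nestedD(1)[OF n(3)] nestedD(1)[OF n(4)] st(4) st'(4) by blast+
  \<comment> \<open>All crossings of \<open>C\<close> with \<open>A\<close> and \<open>B\<close> lie
    in \<open>side d D\<close>. So the excursion of \<open>C\<close> beyond \<open>D\<close>
    contains none of them and cannot reach from one wall into the other.\<close>
  have notxy: "\<not> (x \<le> z \<and> z \<le> y)" if "z \<in> {0..1}" "gC z \<in> side d D" for z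
  proof
    assume z: "x \<le> z \<and> z \<le> y"
    have "gC x \<in> D" "gC y \<in> D" using xy(4) by blast+
    then have "z \<noteq> x" "z \<noteq> y" using that(2) side_disjoint[of d D] by blast+
    then have "gC z \<in> side (\<not> d) D" using loop_sides(2)[OF l(1) c(3) v(6) xy] z by auto
    then show False using that(2) side_Int[of d D] by blast
  qed
  have ns: "\<not> (x \<le> s \<and> s \<le> y)" "\<not> (x \<le> t \<and> t \<le> y)" "\<not> (x \<le> s' \<and> s' \<le> y)" "\<not> (x \<le> t' \<and> t' \<le> y)"
    using notxy inD st st' by auto
  have meet: "x \<in> K \<or> y \<in> K" if ne: "gC ` K \<inter> D \<noteq> {}" and K: "K \<subseteq> {0..1}" for K
  proof -
    obtain z where z: "z \<in> K" "gC z \<in> D" using ne by blast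
    then have "z \<in> {0..1}" using K by blast
    then have "z = x \<or> z = y" using loop_cover[OF l(1) xy(4), of z] xy z(2) by auto
    then show ?thesis using z(1) by blast
  qed
  have K: "k1 \<subseteq> {0..1}" "k2 \<subseteq> {0..1}" unfolding k1_def k2_def using st st' by auto
  have "gC ` k1 \<inter> D = {} \<or> gC ` k2 \<inter> D = {}"
  proof (rule ccontr)
    assume "\<not> ?thesis"
    then have m: "x \<in> k1 \<or> y \<in> k1" "x \<in> k2 \<or> y \<in> k2" using meet K by blast+
    show False
    proof (cases rule: word_cases[OF l(1) c(2) cs(4) v(4,5) n(1)])
      case (1 s1 t1 s1' t1')
      have "gC s \<in> A" "gC t \<in> A" "gC s' \<in> B" "gC t' \<in> B" using st(4) st'(4) by blast+
      then have "s = s1 \<or> s = t1" "t = s1 \<or> t = t1" "s' = s1' \<or> s' = t1'" "t' = s1' \<or> t' = t1'"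
        using loop_cover[OF l(1) 1(6), of s] loop_cover[OF l(1) 1(6), of t]
          loop_cover[OF l(1) 1(7), of s'] loop_cover[OF l(1) 1(7), of t'] 1(1-5) st(1-3) st'(1-3) by auto
      then have "s' > t" "t' > t" using 1 by auto
      then show False using m ns xy st st' 1(8,9) unfolding k1_def k2_def by auto
    next
      case (2 s1 t1 s1' t1')
      have "gC s \<in> A" "gC t \<in> A" "gC s' \<in> B" "gC t' \<in> B" using st(4) st'(4) by blast+
      then have "s = s1 \<or> s = t1" "t = s1 \<or> t = t1" "s' = s1' \<or> s' = t1'" "t' = s1' \<or> t' = t1'"
        using loop_cover[OF l(1) 2(6), of s] loop_cover[OF l(1) 2(6), of t]
          loop_cover[OF l(1) 2(7), of s'] loop_cover[OF l(1) 2(7), of t'] 2(1-5) st(1-3) st'(1-3) by auto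
      then have "s > t'" "t > t'" "s > s'" using 2 by auto
      then show False using m ns xy st st' 2(8,9) unfolding k1_def k2_def by auto
    qed
  qed
  then show ?thesis
  proof
    assume k: "gC ` k1 \<inter> D = {}"
    have "(if first_hit gC A B then gC ` {0..s} else gC ` {t..1}) = gC ` k1" by (simp add: k1_def)
    then have kk: "(if first_hit gC A B then gC ` {0..s} else gC ` {t..1}) \<inter> D = {}" using k by simp
    show ?thesis
      by (rule parallel_first_hit_aux[OF c n o v Z(1) _ ZA(2) Z(3) st kk])
        (use Z(2) in auto)
  next
    assume k: "gC ` k2 \<inter> D = {}"
    have "(if first_hit gC B A then gC ` {0..s'} else gC ` {t'..1}) = gC ` k2" by (simp add: k2_def)
    then have kk: "(if first_hit gC B A then gC ` {0..s'} else gC ` {t'..1}) \<inter> D = {}" using k by simp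
    have "first_hit gD B A \<longleftrightarrow> first_hit gC B A"
      by (rule parallel_first_hit_aux[OF c(5) cs(4) c(3) c(2)[THEN cross_sym] c(1) cs(6)
            nested_flip[OF n(1)] nested_flip[OF n(2)] n(4,3) o _ _ v(3) _ _ v(6) Z(1) _ ZA(1) Z(3) st' kk])
        (use Z(2) v in auto)
    then show ?thesis using fl fl' by simp
  qed
qed

section \<open>Contacts along a transversal\<close>

text \<open>The assumptions \<open>base\<close> and \<open>triple\<close> put the entries at
  distinct parameters strictly between 0 and 1, so that they can serve as vertices on a line. One
  side function \<open>\<sigma>\<close> is shared by all contacts.\<close>

locale transversal_family =
  fixes S :: "complex set set" and Z :: "complex set" and gZ :: "real \<Rightarrow> complex" and \<sigma> :: "complex set \<Rightarrow> bool"
  assumes fin: "finite S" and ZS: "Z \<notin> S"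
    and crosses: "\<And>F G. F \<in> insert Z S \<Longrightarrow> G \<in> insert Z S \<Longrightarrow> F \<noteq> G \<Longrightarrow> cross F G"
    and lZ: "loop gZ Z" and base: "\<And>F. F \<in> S \<Longrightarrow> gZ 0 \<notin> F"
    and triple: "\<And>F G. F \<in> S \<Longrightarrow> G \<in> S \<Longrightarrow> F \<noteq> G \<Longrightarrow> Z \<inter> F \<inter> G = {}"
begin

text \<open>The parameter at which \<open>Z\<close> enters the side \<open>\<sigma> F\<close> of \<open>F\<close>.\<close>

definition entry :: "complex set \<Rightarrow> real" where
  "entry F = (SOME x. \<exists>s t. 0 < s \<and> s < t \<and> t < 1 \<and> Z \<inter> F = {gZ s, gZ t} \<and>
     x = (if gZ 0 \<in> side (\<sigma> F) F then t else s))"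

lemma entry:
  assumes "F \<in> S"
  obtains s t where "0 < s" "s < t" "t < 1" "Z \<inter> F = {gZ s, gZ t}"
    "entry F = (if gZ 0 \<in> side (\<sigma> F) F then t else s)"
proof -
  have c: "cross Z F" using assms crosses ZS by auto
  obtain s t where st: "0 < s" "s < t" "t < 1" "Z \<inter> F = {gZ s, gZ t}" by (rule loop_points[OF lZ c base[OF assms]])
  have "\<exists>s t. 0 < s \<and> s < t \<and> t < 1 \<and> Z \<inter> F = {gZ s, gZ t} \<and>
     entry F = (if gZ 0 \<in> side (\<sigma> F) F then t else s)"
    unfolding entry_def by (rule someI_ex) (use st in blast)
  then show ?thesis using that by blast
qed

lemma entry_bounds: assumes "F \<in> S" shows "0 < entry F" "entry F < 1" "gZ (entry F) \<in> F" "gZ (entry F) \<in> Z"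
  by (rule entry[OF assms]; force split: if_splits)+

lemma entry_inj: "inj_on entry S"
proof (rule inj_onI, rule ccontr)
  fix F G assume F: "F \<in> S" and G: "G \<in> S" and e: "entry F = entry G" and ne: "F \<noteq> G"
  have "gZ (entry F) \<in> Z \<inter> F \<inter> G" using entry_bounds[OF F] entry_bounds[OF G] e by simp
  then show False using triple[OF F G ne] by simp
qed

text \<open>The loop starts on \<open>Z\<close> and has the chosen side on its left. Stretches of
  \<open>Z\<close> can thus play the role of the arc that cuts the lune, and
  \<open>orientation_base_bool\<close> applies to any two such loops.\<close>

definition gen :: "complex set \<Rightarrow> real \<Rightarrow> complex" where
  "gen F = (SOME g. oriented (\<sigma> F) F g \<and> g 0 = gZ (entry F))"

lemma gen:
  assumes "F \<in> S" shows "oriented (\<sigma> F) F (gen F)" "gen F 0 = gZ (entry F)"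
proof -
  have "cross Z F" using assms crosses ZS by auto
  then have "\<exists>g. oriented (\<sigma> F) F g \<and> g 0 = gZ (entry F)"
    using oriented_exists[of F "gZ (entry F)"] crossD(2) entry_bounds(3)[OF assms] by metis
  then show "oriented (\<sigma> F) F (gen F)" "gen F 0 = gZ (entry F)"
    unfolding gen_def using someI_ex[of "\<lambda>g. oriented (\<sigma> F) F g \<and> g 0 = gZ (entry F)"] by auto
qed

text \<open>The nesting is also satisfied by the complementary sides with \<open>A\<close> and
  \<open>B\<close> exchanged. The order of the entries excludes the case in which the base point of
  \<open>Z\<close> falls between entering the outer and entering the inner side.\<close>

definition contact :: "complex set \<Rightarrow> complex set \<Rightarrow> bool" where
  "contact A B \<longleftrightarrow> A \<in> S \<and> B \<in> S \<and> A \<noteq> B \<and> entry B < entry A \<and>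
     (\<forall>F\<in>insert Z S - {A,B}. nested (\<sigma> A) A (\<sigma> B) B F)"

text \<open>Cyclically, \<open>Z\<close> enters the outer side, enters the inner side, leaves the
  inner and leaves the outer one. As \<open>entry B < entry A\<close>, the base point does not
  interrupt the stretch from the first event to the second.\<close>

lemma contact_between:
  assumes c: "contact A B" and x: "entry B < x" "x < entry A"
  shows "gZ x \<in> side (\<not> \<sigma> A) A" "gZ x \<in> side (\<sigma> B) B"
proof -
  have AB: "A \<in> S" "B \<in> S" "A \<noteq> B" and n: "nested (\<sigma> A) A (\<sigma> B) B Z" and le: "entry B < entry A"
    using c ZS unfolding contact_def by auto
  have cA: "cross Z A" and cB: "cross Z B" using AB crosses ZS by auto
  obtain s t where st: "0 < s" "s < t" "t < 1" "Z \<inter> A = {gZ s, gZ t}"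
    "entry A = (if gZ 0 \<in> side (\<sigma> A) A then t else s)" by (rule entry[OF AB(1)])
  obtain u w where uw: "0 < u" "u < w" "w < 1" "Z \<inter> B = {gZ u, gZ w}"
    "entry B = (if gZ 0 \<in> side (\<sigma> B) B then w else u)" by (rule entry[OF AB(2)])
  define hA where "hA \<longleftrightarrow> gZ 0 \<in> side (\<sigma> A) A"
  define hB where "hB \<longleftrightarrow> gZ 0 \<in> side (\<sigma> B) B"
  have bA: "gZ 0 \<in> side (hA = \<sigma> A) A"
    using base[OF AB(1)] not_in_side[of "gZ 0" A "\<sigma> A"] unfolding hA_def by (cases "gZ 0 \<in> side (\<sigma> A) A") auto
  have bB: "gZ 0 \<in> side (hB = \<sigma> B) B"
    using base[OF AB(2)] not_in_side[of "gZ 0" B "\<sigma> B"] unfolding hB_def by (cases "gZ 0 \<in> side (\<sigma> B) B") auto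
  have SA: "gZ y \<in> side ((hA = \<sigma> A) = (y < s \<or> t < y)) A" if "y \<in> {0..1}" "y \<noteq> s" "y \<noteq> t" for y
  proof (cases "y < s \<or> t < y")
    case True
    from loop_sides(1)[OF lZ cA bA st(1-4) that(1) True] show ?thesis using True by simp
  next
    case False
    then have "s < y" "y < t" using that by auto
    from loop_sides(2)[OF lZ cA bA st(1-4) this] show ?thesis using False by simp
  qed
  have SB: "gZ y \<in> side ((hB = \<sigma> B) = (y < u \<or> w < y)) B" if "y \<in> {0..1}" "y \<noteq> u" "y \<noteq> w" for y
  proof (cases "y < u \<or> w < y")
    case True
    from loop_sides(1)[OF lZ cB bB uw(1-4) that(1) True] show ?thesis using True by simp
  next
    case False
    then have "u < y" "y < w" using that by auto
    from loop_sides(2)[OF lZ cB bB uw(1-4) this] show ?thesis using False by simp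
  qed
  have uniq: "p = q" if "z \<in> side p X" "z \<in> side q X" for z p q X
    using that side_Int[of p X] by (cases "q = p") auto
  have inA: "gZ s \<in> side (\<sigma> B) B" "gZ t \<in> side (\<sigma> B) B" using nestedD(1)[OF n] st(4) by blast+
  have inB: "gZ u \<in> side (\<not> \<sigma> A) A" "gZ w \<in> side (\<not> \<sigma> A) A" using nestedD(2)[OF n] uw(4) by blast+
  have mem: "gZ s \<in> A" "gZ t \<in> A" "gZ u \<in> B" "gZ w \<in> B" using st(4) uw(4) by blast+
  have ne: "s \<noteq> u" "s \<noteq> w" "t \<noteq> u" "t \<noteq> w" using inA mem side_disjoint[of "\<sigma> B" B] by auto
  have 1: "((hB = \<sigma> B) = (s < u \<or> w < s)) = \<sigma> B" using uniq[OF SB[of s] inA(1)] st ne by auto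
  have 2: "((hB = \<sigma> B) = (t < u \<or> w < t)) = \<sigma> B" using uniq[OF SB[of t] inA(2)] st ne by auto
  have 3: "((hA = \<sigma> A) = (u < s \<or> t < u)) = (\<not> \<sigma> A)" using uniq[OF SA[of u] inB(1)] uw ne by auto
  have 4: "((hA = \<sigma> A) = (w < s \<or> t < w)) = (\<not> \<sigma> A)" using uniq[OF SA[of w] inB(2)] uw ne by auto
  have eA: "entry A = (if hA then t else s)" and eB: "entry B = (if hB then w else u)"
    using st(5) uw(5) unfolding hA_def hB_def by auto
  have x01: "x \<in> {0..1}" using x entry_bounds[OF AB(1)] entry_bounds[OF AB(2)] by auto
  \<comment> \<open>Facts 1 to 4 restrict the order of the four crossings, while \<open>hA\<close>
    and \<open>hB\<close> tell where the base point cuts the cyclic order; the remaining orders are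
    checked one by one.\<close>
  have x2: "x \<noteq> s \<and> x \<noteq> t \<and> x \<noteq> u \<and> x \<noteq> w \<and> \<not> (hA = (x < s \<or> t < x)) \<and> (hB = (x < u \<or> w < x))"
    using 1 2 3 4 x eA eB st(1-3) uw(1-3) ne by (cases hA; cases hB; cases "\<sigma> A"; cases "\<sigma> B") auto
  have "((hA = \<sigma> A) = (x < s \<or> t < x)) = (\<not> \<sigma> A)" using x2 by auto
  moreover have "gZ x \<in> side ((hA = \<sigma> A) = (x < s \<or> t < x)) A" using SA[OF x01] x2 by blast
  ultimately show "gZ x \<in> side (\<not> \<sigma> A) A" by simp
  have "((hB = \<sigma> B) = (x < u \<or> w < x)) = \<sigma> B" using x2 by auto
  moreover have "gZ x \<in> side ((hB = \<sigma> B) = (x < u \<or> w < x)) B" using SB[OF x01] x2 by blast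
  ultimately show "gZ x \<in> side (\<sigma> B) B" by simp
qed

definition circ :: "real \<Rightarrow> complex set" where
  "circ x = (THE F. F \<in> S \<and> entry F = x)"

lemma circ: assumes "F \<in> S" shows "circ (entry F) = F"
  unfolding circ_def by (rule the_equality) (use assms entry_inj in \<open>auto dest: inj_onD\<close>)

text \<open>In a contact, \<open>Max e\<close> is the entry of the inner curve. Vertices not under
  the half circle are never passed, so the value is \<open>False\<close> there.\<close>

definition \<phi> :: "real set \<Rightarrow> real \<Rightarrow> bool" where
  "\<phi> e x \<longleftrightarrow> Min e < x \<and> x < Max e \<and> first_hit (gen (circ x)) (circ (Max e)) (circ (Min e))"

lemma phi:
  assumes "A \<in> S" "B \<in> S" "F \<in> S" "entry B < entry A"
  shows "\<phi> {entry A, entry B} (entry F) \<longleftrightarrow> entry B < entry F \<and> entry F < entry A \<and> first_hit (gen F) A B"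
  using assms by (simp add: \<phi>_def circ)

lemma contactD:
  assumes "contact A B"
  shows "A \<in> S" "B \<in> S" "A \<noteq> B" "entry B < entry A" "nested (\<sigma> A) A (\<sigma> B) B Z"
    "\<And>F. F \<in> S \<Longrightarrow> F \<noteq> A \<Longrightarrow> F \<noteq> B \<Longrightarrow> nested (\<sigma> A) A (\<sigma> B) B F"
  using assms ZS unfolding contact_def by auto

lemma entry_in_side:
  assumes c: "contact A B"
  shows "gZ (entry A) \<in> side (\<sigma> B) B" "gZ (entry B) \<in> side (\<not> \<sigma> A) A"
  using nestedD[OF contactD(5)[OF c]] entry_bounds[OF contactD(1)[OF c]] entry_bounds[OF contactD(2)[OF c]] by blast+

lemma arc_Z: "F \<in> S \<Longrightarrow> G \<in> S \<Longrightarrow> entry F < entry G \<Longrightarrow>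
    is_arc (gZ ` {entry F..entry G}) (gZ (entry F)) (gZ (entry G))"
  using loop_arc[OF lZ, of "entry F" "entry G"] entry_bounds by force

text \<open>Entries in the order BADC make all terms vanish. For BDCA the passes over
  \<open>C\<close> and \<open>D\<close> agree by \<open>parallel_first_hit\<close>. For BDAC, the
  interleaving case, \<open>interleaving_first_hit\<close> together with one flip makes the pass
  over \<open>D\<close> and the pass over \<open>A\<close> opposite, as required.\<close>

lemma even_pair_ordered:
  assumes e: "contact A B" and f: "contact C D" and d: "distinct [A,B,C,D]" and le: "entry B < entry D"
  shows "(btw (entry A) (entry B) (entry C) \<noteq> btw (entry A) (entry B) (entry D)) \<longleftrightarrow>
    ((\<phi> {entry A, entry B} (entry C) \<noteq> \<phi> {entry A, entry B} (entry D)) \<noteq>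
     (\<phi> {entry C, entry D} (entry A) \<noteq> \<phi> {entry C, entry D} (entry B)))"
proof -
  note E = contactD[OF e] and F = contactD[OF f]
  have ne: "entry A \<noteq> entry C" "entry A \<noteq> entry D"
    using d E F entry_inj by (auto dest: inj_onD)
  have cr: "cross A D" "cross C A" "cross C D" "cross B C" "cross B D" "cross B A"
    using crosses d E F by auto
  have n: "nested (\<sigma> A) A (\<sigma> B) B C" "nested (\<sigma> A) A (\<sigma> B) B D" "nested (\<sigma> C) C (\<sigma> D) D A" "nested (\<sigma> C) C (\<sigma> D) D B"
    using d E F by auto
  note p = phi[OF E(1,2) _ E(4)] and q = phi[OF F(1,2) _ F(4)]
  consider "entry A < entry D" | "entry D < entry A" "entry C < entry A" | "entry D < entry A" "entry A < entry C"
    using ne by linarith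
  then show ?thesis
  proof cases
    case 1
    then show ?thesis using p q E F le by (simp add: btw_def)
  next
    case 2
    have bD: "gZ (entry D) \<in> side (\<not> \<sigma> A) A" "gZ (entry D) \<in> side (\<sigma> B) B"
      using contact_between[OF e] le 2(1) by auto
    have bC: "gZ (entry C) \<in> side (\<not> \<sigma> A) A" "gZ (entry C) \<in> side (\<sigma> B) B"
      using contact_between[OF e] le F(4) 2 by auto
    have ar: "is_arc (gZ ` {entry D..entry C}) (gZ (entry D)) (gZ (entry C))" by (rule arc_Z[OF F(2,1,4)])
    have in1: "gZ ` {entry D..entry C} - {gZ (entry D), gZ (entry C)} \<subseteq>
        side (\<sigma> D) D \<inter> side (\<not> \<sigma> A) A \<inter> side (\<sigma> B) B"
    proof
      fix z assume z: "z \<in> gZ ` {entry D..entry C} - {gZ (entry D), gZ (entry C)}"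
      then obtain x where x: "x \<in> {entry D..entry C}" "z = gZ x" by blast
      then have "entry D < x" "x < entry C" using z by (auto simp: less_le)
      then show "z \<in> side (\<sigma> D) D \<inter> side (\<not> \<sigma> A) A \<inter> side (\<sigma> B) B"
        using contact_between[OF e, of x] contact_between[OF f, of x] le 2 x(2) by auto
    qed
    have zc: "gZ ` {entry D..entry C} \<inter> C = {gZ (entry C)}"
    proof
      show "gZ ` {entry D..entry C} \<inter> C \<subseteq> {gZ (entry C)}"
      proof
        fix z assume z: "z \<in> gZ ` {entry D..entry C} \<inter> C"
        then obtain x where x: "x \<in> {entry D..entry C}" "z = gZ x" by blast
        have "x = entry C"
        proof (rule ccontr)
          assume "x \<noteq> entry C"
          then have "x = entry D \<or> entry D < x \<and> x < entry C" using x by auto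
          then have "z \<in> side (\<not> \<sigma> C) C" using contact_between(1)[OF f, of x] entry_in_side(2)[OF f] x(2) by auto
          then show False using z side_disjoint[of "\<not> \<sigma> C" C] by auto
        qed
        then show "z \<in> {gZ (entry C)}" using x by simp
      qed
      show "{gZ (entry C)} \<subseteq> gZ ` {entry D..entry C} \<inter> C" using F(4) entry_bounds(3)[OF F(1)] by auto
    qed
    have "first_hit (gen D) A B \<longleftrightarrow> first_hit (gen C) A B"
      by (rule parallel_first_hit[OF cr n gen(1)[OF F(1)] gen(1)[OF F(2)], unfolded gen(2)[OF F(1)] gen(2)[OF F(2)],
            OF bD entry_in_side(2)[OF f] bC entry_in_side(1)[OF f] ar in1 zc])
    moreover have "\<not> \<phi> {entry C, entry D} (entry A)" "\<not> \<phi> {entry C, entry D} (entry B)"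
      using q[OF E(1)] q[OF E(2)] le 2 by auto
    moreover have "entry B < entry C" using le F(4) by simp
    ultimately show ?thesis using p[OF F(1)] p[OF F(2)] le 2 E(4) by (simp add: btw_def)
  next
    case 3
    have bD: "gZ (entry D) \<in> side (\<not> \<sigma> A) A" "gZ (entry D) \<in> side (\<sigma> B) B"
      using contact_between[OF e] le 3(1) by auto
    have bA: "gZ (entry A) \<in> side (\<not> \<sigma> C) C" "gZ (entry A) \<in> side (\<sigma> D) D"
      using contact_between[OF f] 3 by auto
    have ar: "is_arc (gZ ` {entry D..entry A}) (gZ (entry D)) (gZ (entry A))" by (rule arc_Z[OF F(2) E(1) 3(1)])
    have in1: "gZ ` {entry D..entry A} - {gZ (entry D), gZ (entry A)} \<subseteq> side (\<sigma> D) D \<inter> side (\<not> \<sigma> A) A"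
    proof
      fix z assume z: "z \<in> gZ ` {entry D..entry A} - {gZ (entry D), gZ (entry A)}"
      then obtain x where x: "x \<in> {entry D..entry A}" "z = gZ x" by blast
      then have "entry D < x" "x < entry A" using z by (auto simp: less_le)
      then show "z \<in> side (\<sigma> D) D \<inter> side (\<not> \<sigma> A) A"
        using contact_between[OF e, of x] contact_between[OF f, of x] le 3 x(2) by auto
    qed
    have zB: "gZ ` {entry D..entry A} \<inter> B = {}"
    proof -
      have "gZ x \<in> side (\<sigma> B) B" if "x \<in> {entry D..entry A}" for x
        using contact_between(2)[OF e, of x] entry_in_side(1)[OF e] that le by (cases "x = entry A") auto
      then show ?thesis using side_disjoint[of "\<sigma> B" B] by blast
    qed
    have zC: "gZ ` {entry D..entry A} \<inter> C = {}"
    proof -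
      have "gZ x \<in> side (\<not> \<sigma> C) C" if "x \<in> {entry D..entry A}" for x
        using contact_between(1)[OF f, of x] entry_in_side(2)[OF f] that 3 by (cases "x = entry D") auto
      then show ?thesis using side_disjoint[of "\<not> \<sigma> C" C] by blast
    qed
    have I: "first_hit (gen D) A B \<longleftrightarrow> first_hit (gen A) D C"
      by (rule interleaving_first_hit[OF cr n gen(1)[OF E(1)] gen(1)[OF F(2)], unfolded gen(2)[OF E(1)] gen(2)[OF F(2)],
            OF bD bA ar in1 zB zC])
    have "loop (gen A) A" using gen(1)[OF E(1)] unfolding oriented_def by simp
    then have "first_hit (gen A) D C \<longleftrightarrow> \<not> first_hit (gen A) C D"
      using first_hit_flip[of "gen A" A C D "\<sigma> C" "\<sigma> D"] cr(1) cross_sym[OF cr(2)] bA n(3) gen(2)[OF E(1)] by simp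
    moreover have "\<not> \<phi> {entry A, entry B} (entry C)" "\<not> \<phi> {entry C, entry D} (entry B)"
      using p[OF F(1)] q[OF E(2)] le 3 by auto
    moreover have "entry B < entry D" "entry B < entry C" using le F(4) by auto
    ultimately show ?thesis using I p[OF F(2)] q[OF E(1)] 3 E(4) by (simp add: btw_def)
  qed
qed

lemma even_contacts: "even_drawing \<phi> {{entry A, entry B} | A B. contact A B}"
  unfolding even_drawing_def
proof (intro allI impI)
  fix p q u w assume pq: "{p,q} \<in> {{entry A, entry B} | A B. contact A B}"
    and uw: "{u,w} \<in> {{entry A, entry B} | A B. contact A B}" and d: "distinct [p,q,u,w]"
  obtain A B where AB: "{p,q} = {entry A, entry B}" "contact A B" using pq by blast
  obtain C D where CD: "{u,w} = {entry C, entry D}" "contact C D" using uw by blast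
  note S = contactD(1,2)[OF AB(2)] contactD(1,2)[OF CD(2)]
  have pq': "p = entry A \<and> q = entry B \<or> p = entry B \<and> q = entry A" using AB(1) by (auto simp: doubleton_eq_iff)
  have uw': "u = entry C \<and> w = entry D \<or> u = entry D \<and> w = entry C" using CD(1) by (auto simp: doubleton_eq_iff)
  have dis: "distinct [A,B,C,D]" "distinct [C,D,A,B]" using d pq' uw' by auto
  have de: "distinct [entry A, entry B, entry C, entry D]" using d pq' uw' by auto
  have main: "(btw (entry A) (entry B) (entry C) \<noteq> btw (entry A) (entry B) (entry D)) \<longleftrightarrow>
    ((\<phi> {entry A, entry B} (entry C) \<noteq> \<phi> {entry A, entry B} (entry D)) \<noteq>
     (\<phi> {entry C, entry D} (entry A) \<noteq> \<phi> {entry C, entry D} (entry B)))"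
  proof (cases "entry B < entry D")
    case True then show ?thesis by (rule even_pair_ordered[OF AB(2) CD(2) dis(1)])
  next
    case False
    then have "entry D < entry B" using de by auto
    from even_pair_ordered[OF CD(2) AB(2) dis(2) this] interleave_sym[OF de] show ?thesis by argo
  qed
  have s: "btw (entry B) (entry A) x = btw (entry A) (entry B) x" for x by (rule btw_sym)
  show "(btw p q u \<noteq> btw p q w) \<longleftrightarrow>
       ((\<phi> {p,q} u \<noteq> \<phi> {p,q} w) \<noteq> (\<phi> {u,w} p \<noteq> \<phi> {u,w} q))"
    unfolding AB(1) CD(1) using pq' uw' main s by (elim disjE conjE; hypsubst) (simp_all, argo+)
qed

theorem card_contacts: "card {{entry A, entry B} | A B. contact A B} \<le> 7 * card S"
proof -
  have "card {{entry A, entry B} | A B. contact A B} \<le> 7 * card (entry ` S)"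
  proof (rule even_drawing_card_edges[OF _ _ even_contacts])
    show "finite (entry ` S)" using fin by simp
    show "{{entry A, entry B} | A B. contact A B} \<subseteq> {e. e \<subseteq> entry ` S \<and> card e = 2}"
    proof
      fix e assume "e \<in> {{entry A, entry B} | A B. contact A B}"
      then obtain A B where "e = {entry A, entry B}" "contact A B" by blast
      then show "e \<in> {e. e \<subseteq> entry ` S \<and> card e = 2}" using contactD[of A B] by auto
    qed
  qed
  then show ?thesis using card_image[OF entry_inj] by simp
qed

end

section \<open>Crossings and cells of planar arrangements\<close>

locale planar_arrangement =
  fixes \<A> :: "complex set set"
  assumes finA: "finite \<A>" and jor: "\<And>C. C \<in> \<A> \<Longrightarrow> jordan C"
    and crs: "\<And>C D. C \<in> \<A> \<Longrightarrow> D \<in> \<A> \<Longrightarrow> C \<noteq> D \<Longrightarrow> cross C D"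
    and simple: "\<And>C D E. C \<in> \<A> \<Longrightarrow> D \<in> \<A> \<Longrightarrow> E \<in> \<A> \<Longrightarrow> C \<noteq> D \<Longrightarrow> C \<noteq> E \<Longrightarrow> D \<noteq> E \<Longrightarrow> C \<inter> D \<inter> E = {}"
begin

definition X :: "complex set" where
  "X = \<Union>{C \<inter> D | C D. C \<in> \<A> \<and> D \<in> \<A> \<and> C \<noteq> D}"

definition cell :: "complex set \<Rightarrow> bool" where
  "cell T \<longleftrightarrow> T \<in> components (- \<Union>\<A>)"

text \<open>A cell contains no crossing, so closure and frontier contain the same ones; closures
  behave better under the passage from the sphere.\<close>

definition tri :: "complex set \<Rightarrow> bool" where
  "tri T \<longleftrightarrow> cell T \<and> card (closure T \<inter> X) = 3"

lemma XI: "C \<in> \<A> \<Longrightarrow> D \<in> \<A> \<Longrightarrow> C \<noteq> D \<Longrightarrow> x \<in> C \<Longrightarrow> x \<in> D \<Longrightarrow> x \<in> X"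
  unfolding X_def by blast

lemma X_on:
  assumes "x \<in> X" "x \<in> C"
  obtains E where "E \<in> \<A>" "E \<noteq> C" "x \<in> E"
  using assms unfolding X_def by blast

lemma finX: "finite X"
proof -
  have *: "finite (C \<inter> D)" if "C \<in> \<A>" "D \<in> \<A>" "C \<noteq> D" for C D
    using crs[OF that] unfolding cross_def by (metis card.infinite zero_neq_numeral)
  have "{C \<inter> D | C D. C \<in> \<A> \<and> D \<in> \<A> \<and> C \<noteq> D} \<subseteq> (\<lambda>(C,D). C \<inter> D) ` (\<A> \<times> \<A>)" by auto
  moreover have "finite ((\<lambda>(C,D). C \<inter> D) ` (\<A> \<times> \<A>))" using finA by simp
  ultimately have "finite {C \<inter> D | C D. C \<in> \<A> \<and> D \<in> \<A> \<and> C \<noteq> D}" by (rule finite_subset)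
  then show ?thesis unfolding X_def by (rule finite_Union) (use * in blast)
qed

lemma no_triple: "C \<in> \<A> \<Longrightarrow> D \<in> \<A> \<Longrightarrow> E \<in> \<A> \<Longrightarrow> C \<noteq> D \<Longrightarrow> x \<in> C \<Longrightarrow> x \<in> D \<Longrightarrow> x \<in> E \<Longrightarrow> E = C \<or> E = D"
  using simple by blast

lemma first_edge:
  assumes S: "is_arc S p q" and pq: "q \<in> X"
  obtains Y R y where "is_arc Y p y" "y \<in> X" "Y \<inter> X \<subseteq> {p,y}" "connected R" "compact R" "q \<in> R" "Y \<union> R = S" "Y \<inter> R = {y}" "p \<notin> R"
proof -
  obtain g where g: "continuous_on {0..1::real} g" "inj_on g {0..1}" "g ` {0..1} = S" "g 0 = p" "g 1 = q"
    using is_arcE[OF S] by blast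
  define P where "P = {x\<in>{0<..1}. g x \<in> X}"
  have "finite P"
  proof (rule inj_on_finite[of g])
    show "inj_on g P" by (rule inj_on_subset[OF g(2)]) (auto simp: P_def)
    show "g ` P \<subseteq> X" by (auto simp: P_def)
  qed (rule finX)
  moreover have "1 \<in> P" using pq g(5) by (simp add: P_def)
  ultimately have fP: "finite P" "P \<noteq> {}" by auto
  note m = Min_in[OF fP] Min_le[OF fP(1)]
  define t where "t = Min P"
  have t: "0 < t" "t \<le> 1" "g t \<in> X" using m(1) by (auto simp: P_def t_def)
  have first: "g x \<notin> X" if "0 < x" "x < t" for x using m(2)[of x] that t by (auto simp: P_def t_def)
  show ?thesis
  proof (rule that[of "g ` {0..t}" "g t" "g ` {t..1}"])
    show "is_arc (g ` {0..t}) p (g t)"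
      using is_arc_interval[of 0 t g] t g(4) continuous_on_subset[OF g(1)] inj_on_subset[OF g(2)] by auto
    show "g t \<in> X" by (rule t(3))
    show "g ` {0..t} \<inter> X \<subseteq> {p, g t}"
    proof
      fix z assume "z \<in> g ` {0..t} \<inter> X"
      then obtain x where x: "x \<in> {0..t}" "z = g x" "g x \<in> X" by blast
      then have "x = 0 \<or> x = t" using first[of x] by fastforce
      then show "z \<in> {p, g t}" using x(2) g(4) by auto
    qed
    show "connected (g ` {t..1})" "compact (g ` {t..1})"
      using t by (auto intro!: connected_continuous_image compact_continuous_image continuous_on_subset[OF g(1)])
    show "q \<in> g ` {t..1}" unfolding g(5)[symmetric] using t by simp
    have "{0..t} \<union> {t..1} = {0..1}" using t by auto
    then show "g ` {0..t} \<union> g ` {t..1} = S" using g(3) by (metis image_Un)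
    have "g ` ({0..t} \<inter> {t..1}) = g ` {0..t} \<inter> g ` {t..1}"
      by (rule inj_on_image_Int[OF g(2)]) (use t in auto)
    moreover have "{0..t} \<inter> {t..1} = {t}" using t by auto
    ultimately show "g ` {0..t} \<inter> g ` {t..1} = {g t}" by simp
    show "p \<notin> g ` {t..1}"
    proof
      assume "p \<in> g ` {t..1}"
      then obtain x where "x \<in> {t..1}" "g 0 = g x" using g(4) by auto
      then have "0 = x" using inj_onD[OF g(2), of 0 x] t by auto
      then show False using \<open>x \<in> {t..1}\<close> t by auto
    qed
  qed
qed

text \<open>The two edges of the arrangement on \<open>C\<close> that start at \<open>v\<close>; the one that leads into side \<open>j\<close> of \<open>D\<close>
  is \<open>Y j\<close> and ends at \<open>y j\<close>.\<close>

definition star :: "complex set \<Rightarrow> complex set \<Rightarrow> complex \<Rightarrow> (bool \<Rightarrow> complex set) \<Rightarrow> (bool \<Rightarrow> complex) \<Rightarrow> bool" where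
  "star C D v Y y \<longleftrightarrow> (\<forall>j. is_arc (Y j) v (y j) \<and> y j \<in> X \<and> Y j \<inter> X = {v, y j} \<and> Y j \<subseteq> C \<inter> (side j D \<union> D))"

lemma half_star:
  assumes C: "C \<in> \<A>" and D: "D \<in> \<A>" and CD: "C \<noteq> D" and v: "v \<in> C" "v \<in> D"
  obtains Y y M where "star C D v Y y" "compact M" "connected M" "M \<subseteq> C" "C - M = (\<Union>j. Y j - {y j})"
    "\<And>u. u \<in> C \<inter> D \<Longrightarrow> u \<noteq> v \<Longrightarrow> u \<in> M" "v \<notin> M"
proof -
  have cr: "cross C D" by (rule crs[OF C D CD])
  obtain v' where vv: "C \<inter> D = {v,v'}" "v \<noteq> v'"
    using card2E[of "C \<inter> D" v] cr v unfolding cross_def by blast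
  have vX: "v \<in> X" "v' \<in> X" using XI[OF C D CD] vv by blast+
  define A where "A j = C \<inter> (side j D \<union> D)" for j
  have aA: "is_arc (A j) v v'" for j unfolding A_def by (rule cross_arc[OF cr vv(1)])
  have "\<exists>Y R y. is_arc Y v y \<and> y \<in> X \<and> Y \<inter> X \<subseteq> {v,y} \<and> connected R \<and> compact R \<and> v' \<in> R \<and> Y \<union> R = A j \<and> Y \<inter> R = {y} \<and> v \<notin> R" for j
    by (rule first_edge[OF aA[of j] vX(2)]) blast
  then obtain Y R y where Y: "\<And>j. is_arc (Y j) v (y j)" "\<And>j. y j \<in> X" "\<And>j. Y j \<inter> X \<subseteq> {v, y j}"
    "\<And>j. connected (R j)" "\<And>j. compact (R j)" "\<And>j. v' \<in> R j" "\<And>j. Y j \<union> R j = A j" "\<And>j. Y j \<inter> R j = {y j}" "\<And>j. v \<notin> R j"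
    by metis
  have Yin: "v \<in> Y j" "y j \<in> Y j" "y j \<in> R j" for j using is_arc_ends[OF Y(1)[of j]] Y(8)[of j] by blast+
  have AU: "A True \<union> A False = C" unfolding A_def using closure_side_Un[of C True D] by simp
  have AI: "A True \<inter> A False = {v,v'}" unfolding A_def using closure_side_Int[of C True D] vv(1) by simp
  define M where "M = R True \<union> R False"
  show ?thesis
  proof (rule that[of Y y M])
    show "star C D v Y y" unfolding star_def
    proof (intro allI conjI)
      fix j
      show "is_arc (Y j) v (y j)" "y j \<in> X" by (rule Y)+
      show "Y j \<inter> X = {v, y j}" using Y(3)[of j] vX(1) Y(2)[of j] Yin[of j] by blast
      show "Y j \<subseteq> C \<inter> (side j D \<union> D)" using Y(7)[of j] unfolding A_def by blast
    qed
    show "compact M" unfolding M_def using Y(5) by (intro compact_Un)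
    show "connected M" unfolding M_def by (rule connected_Un[OF Y(4) Y(4)]) (use Y(6) in blast)
    show "M \<subseteq> C" unfolding M_def using Y(7) AU by blast
    show "v \<notin> M" unfolding M_def using Y(9) by blast
    show "u \<in> M" if "u \<in> C \<inter> D" "u \<noteq> v" for u using that vv(1) Y(6) unfolding M_def by blast
    show "C - M = (\<Union>j. Y j - {y j})"
    proof
      show "C - M \<subseteq> (\<Union>j. Y j - {y j})"
      proof
        fix z assume z: "z \<in> C - M"
        then obtain j where j: "z \<in> A j" using AU by blast
        have "z \<notin> R j" using z unfolding M_def by (cases j) auto
        then have "z \<in> Y j" "z \<noteq> y j" using j Y(7)[of j] Yin[of j] by blast+
        then show "z \<in> (\<Union>j. Y j - {y j})" by blast
      qed
      show "(\<Union>j. Y j - {y j}) \<subseteq> C - M"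
      proof
        fix z assume "z \<in> (\<Union>j. Y j - {y j})"
        then obtain j where j: "z \<in> Y j" "z \<noteq> y j" by blast
        have zA: "z \<in> A j" using j(1) Y(7)[of j] by blast
        have 1: "z \<notin> R j" using j Y(8)[of j] by blast
        have 2: "z \<notin> R (\<not> j)"
        proof
          assume r: "z \<in> R (\<not> j)"
          then have "z \<in> A (\<not> j)" using Y(7)[of "\<not> j"] by blast
          then have "z \<in> {v,v'}" using zA AI by (cases j) auto
          then show False using r Y(9)[of "\<not> j"] 1 Y(6)[of j] by blast
        qed
        have "z \<notin> M" using 1 2 unfolding M_def by (cases j) auto
        moreover have "z \<in> C" using zA unfolding A_def by blast
        ultimately show "z \<in> C - M" by simp
      qed
    qed
  qed
qed

lemma starD:
  assumes "star C D v Y y"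
  shows "is_arc (Y j) v (y j)" "y j \<in> X" "Y j \<inter> X = {v, y j}" "Y j \<subseteq> C \<inter> (side j D \<union> D)"
    "v \<in> Y j" "y j \<in> Y j" "v \<noteq> y j"
proof -
  show *: "is_arc (Y j) v (y j)" "y j \<in> X" "Y j \<inter> X = {v, y j}" "Y j \<subseteq> C \<inter> (side j D \<union> D)"
    using assms unfolding star_def by blast+
  show "v \<in> Y j" "y j \<in> Y j" "v \<noteq> y j" using is_arc_ends[OF *(1)] by auto
qed

lemma closed_UnA: "B \<subseteq> \<A> \<Longrightarrow> closed (\<Union>B)"
  using finA jor jordan_compact compact_imp_closed finite_subset by (metis closed_Union subsetD)

text \<open>Removing the open edges at \<open>v\<close> and \<open>v\<close> itself from the arrangement leaves a closed set whose intersection with \<open>C \<union> D\<close> is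
  connected. By Janiszewski's theorem points near \<open>v\<close> in the same quadrant of \<open>C\<close>, \<open>D\<close> then
  lie in the same cell.\<close>

lemma stars_exist:
  assumes C: "C \<in> \<A>" and D: "D \<in> \<A>" and CD: "C \<noteq> D" and v: "v \<in> C" "v \<in> D"
  obtains Y y Y' y' where "star C D v Y y" "star D C v Y' y'"
    "\<And>i j T. cell T \<Longrightarrow> v \<in> closure T \<Longrightarrow> T \<subseteq> side i C \<inter> side j D \<Longrightarrow> Y j \<union> Y' i \<subseteq> closure T"
    "\<And>i j T T'. cell T \<Longrightarrow> v \<in> closure T \<Longrightarrow> T \<subseteq> side i C \<inter> side j D \<Longrightarrow>
       cell T' \<Longrightarrow> v \<in> closure T' \<Longrightarrow> T' \<subseteq> side i C \<inter> side j D \<Longrightarrow> T = T'"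
proof -
  have cr: "cross C D" by (rule crs[OF C D CD])
  obtain v' where vv: "C \<inter> D = {v,v'}" "v \<noteq> v'"
    using card2E[of "C \<inter> D" v] cr v unfolding cross_def by blast
  obtain Y y M where Y: "star C D v Y y" "compact M" "connected M" "M \<subseteq> C" "C - M = (\<Union>j. Y j - {y j})"
    "\<And>u. u \<in> C \<inter> D \<Longrightarrow> u \<noteq> v \<Longrightarrow> u \<in> M" "v \<notin> M"
    using half_star[OF C D CD v] by blast
  obtain Y' y' M' where Y': "star D C v Y' y'" "compact M'" "connected M'" "M' \<subseteq> D" "D - M' = (\<Union>j. Y' j - {y' j})"
    "\<And>u. u \<in> D \<inter> C \<Longrightarrow> u \<noteq> v \<Longrightarrow> u \<in> M'" "v \<notin> M'"
    using half_star[OF D C CD[symmetric] v(2,1)] by blast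
  define K where "K = \<Union>(\<A> - {C,D})"
  define N where "N = (C - M) \<union> (D - M')"
  define B where "B = K \<union> (M \<union> M')"
  have v'M: "v' \<in> M" "v' \<in> M'" using Y(6)[of v'] Y'(6)[of v'] vv by blast+
  have cM: "connected (M \<union> M')" using Y(3) Y'(3) v'M by (intro connected_Un) auto
  have clB: "closed B" unfolding B_def K_def using closed_UnA[of "\<A> - {C,D}"] Y(2) Y'(2) compact_imp_closed by auto
  have cY: "connected (Y j - {y j})" for j by (rule is_arc_minus_connected(2)[OF starD(1)[OF Y(1)]])
  have cY': "connected (Y' j - {y' j})" for j by (rule is_arc_minus_connected(2)[OF starD(1)[OF Y'(1)]])
  have vY: "v \<in> Y j - {y j}" "v \<in> Y' j - {y' j}" for j using starD(5,7)[OF Y(1)] starD(5,7)[OF Y'(1)] by auto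
  have cN: "connected N"
  proof -
    have "connected (\<Union>j. Y j - {y j})" "connected (\<Union>j. Y' j - {y' j})"
      by (rule connected_Union; use cY cY' vY in blast)+
    then show ?thesis unfolding N_def Y(5) Y'(5) by (intro connected_Un) (use vY in blast)+
  qed
  have vK: "v \<notin> K"
  proof
    assume "v \<in> K"
    then obtain E where "E \<in> \<A>" "E \<noteq> C" "E \<noteq> D" "v \<in> E" unfolding K_def by blast
    then show False using no_triple[OF C D _ CD v] by blast
  qed
  have free: "z = v" if z: "z \<in> N" "z \<in> X" for z
  proof -
    obtain j where "z \<in> Y j \<and> z \<noteq> y j \<or> z \<in> Y' j \<and> z \<noteq> y' j" using z(1) unfolding N_def Y(5) Y'(5) by blast
    then show ?thesis using z(2) starD(3)[OF Y(1), of j] starD(3)[OF Y'(1), of j] by blast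
  qed
  have NCD: "N \<subseteq> C \<union> D" unfolding N_def by blast
  have NK: "N \<inter> K = {}"
  proof -
    have "z \<in> X" if zN: "z \<in> N" and zK: "z \<in> K" for z
    proof -
      obtain E where E: "E \<in> \<A>" "E \<noteq> C" "E \<noteq> D" "z \<in> E" using zK unfolding K_def by blast
      have "z \<in> C \<or> z \<in> D" using zN NCD by blast
      then show ?thesis using XI[OF C E(1) E(2)[symmetric] _ E(4)] XI[OF D E(1) E(3)[symmetric] _ E(4)] by blast
    qed
    then show ?thesis using free vK by blast
  qed
  have NB: "N \<inter> B = {}"
  proof -
    have "N \<inter> (M \<union> M') = {}"
    proof -
      have "z = v" if "z \<in> N" "z \<in> M \<union> M'" for z
      proof -
        have "z \<in> C \<and> z \<in> D" using that Y(4) Y'(4) unfolding N_def by blast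
        then show ?thesis using XI[OF C D CD] free[OF that(1)] by blast
      qed
      then show ?thesis using Y(7) Y'(7) by blast
    qed
    then show ?thesis using NK unfolding B_def by blast
  qed
  \<comment> \<open>\<open>W\<close> is an open set around \<open>v\<close> that contains both stars
    without their far ends. A cell with \<open>v\<close> in its closure must meet it.\<close>
  define W where "W = connected_component_set (- B) v"
  have oW: "open W" unfolding W_def using clB by (intro open_connected_component) auto
  have vN: "v \<in> N" unfolding N_def using v Y(7) by blast
  have NW: "N \<subseteq> W" unfolding W_def by (rule connected_component_maximal[OF vN cN]) (use NB in blast)
  have int: "(C \<union> D) \<inter> B = M \<union> M'"
  proof -
    have "(C \<union> D) \<inter> K \<subseteq> M \<union> M'" using NK unfolding N_def by blast
    then show ?thesis using Y(4) Y'(4) unfolding B_def by blast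
  qed
  have un: "(C \<union> D) \<union> B = \<Union>\<A>" using C D Y(4) Y'(4) unfolding B_def K_def by blast
  have cmp: "compact (C \<union> D)" using jordan_compact[OF jor[OF C]] jordan_compact[OF jor[OF D]] by (rule compact_Un)
  have near: "b \<in> T" if T: "cell T" "T \<subseteq> side i C \<inter> side j D" and a: "a \<in> T" "a \<in> W"
      and b: "b \<in> side i C \<inter> side j D" "b \<in> W" for T i j a b
  proof -
    have L: "side j D \<inter> side i C \<inter> (C \<union> D) = {}" using side_disjoint[of i C] side_disjoint[of j D] by blast
    obtain e where e: "side j D \<inter> side i C = side e ((D \<inter> (side i C \<union> C)) \<union> (C \<inter> (side j D \<union> D)))"
      using lune_side(2)[OF cr] by blast
    have "connected (side j D \<inter> side i C)" unfolding e by (rule jordan_side(2)[OF lune_side(1)[OF cr]])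
    then have "connected_component (- (C \<union> D)) a b"
      unfolding connected_component_def using L a(1) T(2) b(1)
      by (intro exI[of _ "side j D \<inter> side i C"]) blast
    moreover have "connected_component (- B) a b"
      using a(2) b(2) unfolding W_def mem_Collect_eq
      by (rule connected_component_trans[OF connected_component_sym])
    ultimately have "connected_component (- (C \<union> D \<union> B)) a b"
      using Janiszewski[OF cmp clB] cM unfolding int by blast
    then have ab: "connected_component (- \<Union>\<A>) a b" unfolding un .
    obtain x where "T = connected_component_set (- \<Union>\<A>) x" using T(1) unfolding cell_def components_def by blast
    then show ?thesis using a(1) connected_component_trans[OF _ ab] by simp
  qed
  have meet: "\<exists>a. a \<in> T \<and> a \<in> W" if "v \<in> closure T" for T
    using that open_Int_closure_eq_empty[OF oW, of T] NW vN by blast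
  show ?thesis
  proof (rule that[OF Y(1) Y'(1)])
    fix i j T assume T: "cell T" "v \<in> closure T" "T \<subseteq> side i C \<inter> side j D"
    obtain a where a: "a \<in> T" "a \<in> W" using meet[OF T(2)] by blast
    define G where "G = (D \<inter> (side i C \<union> C)) \<union> (C \<inter> (side j D \<union> D))"
    obtain e where e: "side j D \<inter> side i C = side e G" using lune_side(2)[OF cr] unfolding G_def by blast
    have clG: "G \<subseteq> closure (side j D \<inter> side i C)"
      unfolding e using jordan_side(5)[OF lune_side(1)[OF cr, of i j]] unfolding G_def by blast
    have NG: "N \<inter> G \<subseteq> closure T"
    proof
      fix n assume n: "n \<in> N \<inter> G"
      show "n \<in> closure T"
      proof (rule ccontr)
        assume "n \<notin> closure T"
        then have "n \<in> W \<inter> - closure T" "open (W \<inter> - closure T)" using n NW oW by (auto intro: open_Int)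
        moreover have "n \<in> closure (side j D \<inter> side i C)" using n clG by blast
        ultimately obtain b where b: "b \<in> W" "b \<notin> closure T" "b \<in> side j D \<inter> side i C"
          using open_Int_closure_eq_empty[of "W \<inter> - closure T" "side j D \<inter> side i C"] by blast
        then have "b \<in> T" using near[OF T(1,3) a, of b] by blast
        then show False using b(2) closure_subset by blast
      qed
    qed
    \<comment> \<open>\<open>N\<close> omits the far ends of the edges; each is a limit of its
      half-open edge.\<close>
    have ext: "S \<subseteq> closure T" if "is_arc S v w" "S - {w} \<subseteq> closure T" for S w
    proof -
      have "connected S" "w \<in> S" "v \<in> S" "v \<noteq> w" using that(1) is_arc_connected is_arc_ends by blast+
      then have "w islimpt S" using connected_imp_perfect[of S w] by auto
      then have "w \<in> closure (S - {w})" by (simp add: islimpt_in_closure)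
      then show ?thesis using that(2) closure_minimal[OF that(2) closed_closure] by blast
    qed
    have "Y j - {y j} \<subseteq> N \<inter> G" using Y(5) starD(4)[OF Y(1), of j] unfolding N_def G_def by blast
    then have "Y j \<subseteq> closure T" using ext[OF starD(1)[OF Y(1)]] NG by blast
    moreover have "Y' i - {y' i} \<subseteq> N \<inter> G" using Y'(5) starD(4)[OF Y'(1), of i] unfolding N_def G_def by blast
    then have "Y' i \<subseteq> closure T" using ext[OF starD(1)[OF Y'(1)]] NG by blast
    ultimately show "Y j \<union> Y' i \<subseteq> closure T" by blast
  next
    fix i j T T' assume T: "cell T" "v \<in> closure T" "T \<subseteq> side i C \<inter> side j D"
      and T': "cell T'" "v \<in> closure T'" "T' \<subseteq> side i C \<inter> side j D"
    obtain a where a: "a \<in> T" "a \<in> W" using meet[OF T(2)] by blast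
    obtain b where b: "b \<in> T'" "b \<in> W" using meet[OF T'(2)] by blast
    have "b \<in> T" using near[OF T(1,3) a, of b] b T'(3) by blast
    then show "T = T'" using T(1) T'(1) b(1) unfolding cell_def by (meson components_nonoverlap disjoint_iff)
  qed
qed

end

section \<open>Triangles at a crossing\<close>

lemma arc_connected_all:
  assumes "is_arc S p q" "connected K" "K \<subseteq> S" "p \<in> K" "q \<in> K"
  shows "K = S"
proof -
  obtain g where g: "continuous_on {0..1::real} g" "inj_on g {0..1}" "g ` {0..1} = S" "g 0 = p" "g 1 = q"
    using is_arcE[OF assms(1)] by blast
  have "g ` {0..1} \<subseteq> K"
    by (rule arc_connected_subset[OF g(1,2) assms(2)]) (use assms g in auto)
  then show ?thesis using assms(3) g(3) by auto
qed

lemma cross_other: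
  assumes "cross A D" "p \<in> A" "p \<in> D" obtains q where "A \<inter> D = {p,q}" "p \<noteq> q"
proof -
  have "card (A \<inter> D) = 2" "p \<in> A \<inter> D" using assms unfolding cross_def by simp_all
  then show ?thesis by (rule card2E) (rule that)
qed

context planar_arrangement
begin

lemma cellD:
  assumes "cell T" shows "connected T" "T \<inter> \<Union>\<A> = {}" "T \<noteq> {}"
  using assms unfolding cell_def
  by (auto dest: in_components_connected in_components_subset in_components_nonempty)

lemma cell_side:
  assumes "cell T" "C \<in> \<A>" shows "\<exists>b. T \<subseteq> side b C"
  using connected_in_some_side[OF jor[OF assms(2)] cellD(1)[OF assms(1)]] cellD(2)[OF assms(1)] assms(2) by blast

lemma closure_in:
  assumes "T \<subseteq> side i C" "C \<in> \<A>" shows "closure T \<subseteq> side i C \<union> C"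
  using closure_mono[OF assms(1)] jordan_side(5)[OF jor[OF assms(2)]] by simp

lemma card3_subset: assumes "card S = 3" "{a,b,c} \<subseteq> S" "a \<noteq> b" "a \<noteq> c" "b \<noteq> c" shows "S = {a,b,c}"
proof -
  have "finite S" using assms(1) by (metis card.infinite zero_neq_numeral)
  moreover have "card {a,b,c} = 3" using assms(3-5) by simp
  ultimately show ?thesis using assms(1,2) card_subset_eq by metis
qed

text \<open>Let \<open>w\<close> be the other point of \<open>C \<inter> D\<close>. If both edges of
  the triangle at \<open>v\<close> end at \<open>w\<close>, the third corner lies in the open lune,
  and a pseudocircle through it cannot leave the lune, so it never meets \<open>C\<close>. If only
  the edge on \<open>C\<close> ends at \<open>w\<close>, the border of the lune on \<open>D\<close>
  has \<open>z\<close> as its only inner crossing. A pseudocircle through \<open>z\<close> then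
  meets \<open>D\<close> again beyond \<open>C\<close>, and on the way, on the triangle's side of
  \<open>D\<close>, it would have to cross the arc of \<open>C\<close>, which has no inner
  crossings.\<close>

lemma no_common_end:
  assumes C: "C \<in> \<A>" and D: "D \<in> \<A>" and CD: "C \<noteq> D" and v: "v \<in> C" "v \<in> D"
    and st: "star C D v Y y" "star D C v Y' y'"
    and T: "tri T" "v \<in> closure T" "T \<subseteq> side i C" "T \<subseteq> side j D" and cl: "Y j \<union> Y' i \<subseteq> closure T"
  shows "y j \<notin> D"
proof
  assume yD: "y j \<in> D"
  have cT: "cell T" and c3: "card (closure T \<inter> X) = 3" using T(1) unfolding tri_def by auto
  have cr: "cross C D" by (rule crs[OF C D CD])
  note s = starD[OF st(1), of j] and s' = starD[OF st(2), of i]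
  define w where "w = y j"
  have w: "w \<in> C" "w \<in> D" "w \<noteq> v" using s(4,6,7) yD unfolding w_def by auto
  have vv: "C \<inter> D = {v,w}"
  proof -
    obtain x where "C \<inter> D = {v,x}" using card2E[of "C \<inter> D" v] cr v unfolding cross_def by blast
    then show ?thesis by (rule two_elements) (use w in auto)
  qed
  then have vv': "D \<inter> C = {v,w}" by (simp add: Int_commute)
  define A where "A = C \<inter> (side j D \<union> D)"
  define B where "B = D \<inter> (side i C \<union> C)"
  have aA: "is_arc A v w" unfolding A_def by (rule cross_arc[OF cr vv])
  have aB: "is_arc B v w" unfolding B_def by (rule cross_arc[OF cross_sym[OF cr] vv'])
  have YA: "Y j = A" by (rule is_arc_subset_eq[OF _ aA]) (use s(1,4) in \<open>auto simp: w_def A_def\<close>)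
  have AX: "A \<inter> X = {v,w}" using s(3) YA w_def by simp
  have vX: "v \<in> X" "w \<in> X" using AX by blast+
  have notin: "v \<notin> F" "w \<notin> F" if "F \<in> \<A>" "F \<noteq> C" "F \<noteq> D" for F
    using no_triple[OF C D that(1) CD] that v w by blast+
  have clT: "closure T \<subseteq> (side i C \<union> C) \<inter> (side j D \<union> D)"
    using closure_in[OF T(3) C] closure_in[OF T(4) D] by blast
  show False
  proof (cases "y' i \<in> C")
    case True
    have "y' i \<in> D \<inter> C" using True s'(4,6) by blast
    then have "y' i = w" using vv' s'(7) by auto
    then have YB: "Y' i = B" by (intro is_arc_subset_eq[OF _ aB]) (use s'(1,4) in \<open>auto simp: B_def\<close>)
    have BX: "B \<inter> X = {v,w}" using s'(3) YB \<open>y' i = w\<close> by simp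
    have "\<not> closure T \<inter> X \<subseteq> {v,w}"
    proof
      assume "closure T \<inter> X \<subseteq> {v,w}"
      then have "card (closure T \<inter> X) \<le> card {v,w}" by (rule card_mono[rotated]) simp
      also have "\<dots> \<le> 2" by (cases "v = w") auto
      finally show False using c3 by simp
    qed
    then obtain x where x: "x \<in> closure T" "x \<in> X" "x \<noteq> v" "x \<noteq> w" by blast
    have "x \<notin> A" "x \<notin> B" using AX BX x by blast+
    then have xs: "x \<in> side i C" "x \<in> side j D" using x(1) clT unfolding A_def B_def by blast+
    have xn: "x \<notin> C" "x \<notin> D" using xs in_side_not by blast+
    obtain F where F: "F \<in> \<A>" "F \<noteq> C" "x \<in> F" using x(2) xn(1) unfolding X_def by blast
    have FD: "F \<noteq> D" using F(3) xn(2) by blast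
    have "F \<inter> (B \<union> A) = {}"
    proof -
      have "F \<inter> A \<subseteq> X" "F \<inter> B \<subseteq> X" using XI[OF C F(1)] XI[OF D F(1)] F(2) FD unfolding A_def B_def by blast+
      then have "F \<inter> A \<subseteq> {v,w}" "F \<inter> B \<subseteq> {v,w}" using AX BX by blast+
      then show ?thesis using notin[OF F(1,2) FD] by blast
    qed
    moreover obtain e where e: "side j D \<inter> side i C = side e (B \<union> A)" "jordan (B \<union> A)"
      using lune_side(1)[OF cr, of i j] lune_side(2)[OF cr, of j i] unfolding A_def B_def by blast
    ultimately have "F \<subseteq> side e (B \<union> A)"
      using connected_subset_side[OF e(2) jordan_connected[OF jor[OF F(1)]], of x e] F(3) xs by blast
    then have "F \<subseteq> side i C" using e(1) by blast
    moreover have "F \<inter> C \<noteq> {}" using cross_ne[OF crs[OF F(1) C F(2)]] .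
    ultimately show False using side_disjoint[of i C] by blast
  next
    case False
    define z where "z = y' i"
    have z: "z \<in> D" "z \<notin> C" "z \<in> X" "z \<noteq> v" "z \<noteq> w" "z \<in> side i C"
      using s'(2,4,6,7) False w(1) unfolding z_def by auto
    obtain F where F: "F \<in> \<A>" "F \<noteq> D" "z \<in> F" by (rule X_on[OF z(3) z(1)])
    have FC: "F \<noteq> C" using F(3) z(2) by blast
    have clv: "v \<in> closure T" "w \<in> closure T" "z \<in> closure T" using cl s(5,6) s'(6) w_def z_def by blast+
    have c3': "closure T \<inter> X = {v,w,z}"
      by (rule card3_subset[OF c3]) (use clv vX z w in auto)
    \<comment> \<open>The star at the corner \<open>w\<close> shows that the border of the triangle
      continues from \<open>w\<close> along \<open>D\<close> to \<open>v\<close> or to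
      \<open>z\<close>. Together with the edge from \<open>v\<close> to \<open>z\<close> this
      accounts for all of \<open>B\<close>.\<close>
    obtain V x V' x' where W: "star C D w V x" "star D C w V' x'"
      "\<And>i j T. cell T \<Longrightarrow> w \<in> closure T \<Longrightarrow> T \<subseteq> side i C \<inter> side j D \<Longrightarrow> V j \<union> V' i \<subseteq> closure T"
      using stars_exist[OF C D CD w(1,2)] by metis
    note q = starD[OF W(2), of i]
    have "x' i \<in> closure T" using W(3)[OF cT clv(2), of i j] T(3,4) q(6) by blast
    then have x': "x' i = v \<or> x' i = z" using c3' q(2,7) by blast
    have Bsub: "V' i \<subseteq> B" "Y' i \<subseteq> B" using q(4) s'(4) unfolding B_def by blast+
    have BX: "B \<inter> X \<subseteq> {v,w,z}"
    proof (cases "x' i = v")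
      case True
      then have "V' i = B" by (intro is_arc_subset_eq[OF _ is_arc_sym[OF aB]]) (use q(1) Bsub in auto)
      then show ?thesis using q(3) True by blast
    next
      case False
      then have xz: "x' i = z" using x' by blast
      have "z \<in> V' i" "z \<in> Y' i" using q(6) s'(6) xz z_def by auto
      then have "connected (V' i \<union> Y' i)"
        by (intro connected_Un is_arc_connected[OF q(1)] is_arc_connected[OF s'(1)]) auto
      then have "V' i \<union> Y' i = B"
        by (rule arc_connected_all[OF aB]) (use Bsub q(5) s'(5) in auto)
      then have "B \<inter> X = V' i \<inter> X \<union> Y' i \<inter> X" by blast
      then show ?thesis unfolding q(3) s'(3) xz z_def by auto
    qed
    have cF: "cross F D" by (rule crs[OF F(1) D F(2)])
    obtain z2 where z2: "F \<inter> D = {z,z2}" "z \<noteq> z2"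
      by (rule cross_other[OF cF F(3) z(1)])
    have z2m: "z2 \<in> F" "z2 \<in> D" using z2(1) by blast+
    have "z2 \<notin> B"
    proof
      assume "z2 \<in> B"
      then have "z2 \<in> {v,w,z}" using BX XI[OF F(1) D F(2) z2m] by blast
      then show False using z2(2) z2m(1) notin[OF F(1) FC F(2)] by auto
    qed
    then have z2s: "z2 \<in> side (\<not> i) C" "z2 \<notin> side i C" using z2m(2) not_in_side[of z2 C i] unfolding B_def by blast+
    define P where "P = F \<inter> (side j D \<union> D)"
    have aP: "is_arc P z z2" unfolding P_def by (rule cross_arc[OF cF z2(1)])
    have "P \<inter> C \<noteq> {}"
    proof
      assume "P \<inter> C = {}"
      then have "P \<subseteq> side i C"
        using connected_subset_side[OF jor[OF C] is_arc_connected[OF aP], of z i] is_arc_ends[OF aP] z(6) by blast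
      then show False using is_arc_ends[OF aP] z2s(2) by blast
    qed
    then obtain p where p: "p \<in> P" "p \<in> C" by blast
    have "p \<in> A" using p unfolding A_def P_def by blast
    moreover have "p \<in> X" using XI[OF F(1) C FC, of p] p unfolding P_def by blast
    ultimately have "p = v \<or> p = w" using AX by blast
    then show False using p(1) notin[OF F(1) FC F(2)] unfolding P_def by blast
  qed
qed

text \<open>The star at the corner \<open>y j\<close> yields an edge of the triangle on the third
  curve \<open>E\<close>. It ends at a corner other than \<open>y j\<close>, and not at
  \<open>v\<close>, which is off \<open>E\<close>; so it joins the two remaining corners.\<close>

lemma triangle_third_side:
  assumes C: "C \<in> \<A>" and D: "D \<in> \<A>" and CD: "C \<noteq> D" and v: "v \<in> C" "v \<in> D"
    and st: "star C D v Y y" "star D C v Y' y'"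
    and T: "tri T" "v \<in> closure T" "T \<subseteq> side i C" "T \<subseteq> side j D" and cl: "Y j \<union> Y' i \<subseteq> closure T"
  obtains E P where "E \<in> \<A>" "E \<noteq> C" "E \<noteq> D" "y j \<in> E" "y' i \<in> E" "y j \<in> side j D" "y' i \<in> side i C"
    "is_arc P (y j) (y' i)" "P \<subseteq> E \<inter> (side i C \<union> C)" "P \<inter> X = {y j, y' i}"
proof -
  have cT: "cell T" and c3: "card (closure T \<inter> X) = 3" using T(1) unfolding tri_def by auto
  note s = starD[OF st(1), of j] and s' = starD[OF st(2), of i]
  have yD: "y j \<notin> D" by (rule no_common_end[OF C D CD v st T cl])
  have zC: "y' i \<notin> C" by (rule no_common_end[OF D C CD[symmetric] v(2,1) st(2,1) T(1,2,4,3)]) (use cl in blast)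
  have yz: "y j \<in> C" "y' i \<in> D" "y j \<in> side j D" "y' i \<in> side i C"
    using s(4,6) s'(4,6) yD zC by blast+
  have cv: "y j \<in> closure T" "y' i \<in> closure T" using cl s(6) s'(6) by blast+
  have vX: "v \<in> X" using XI[OF C D CD v] .
  have c3': "closure T \<inter> X = {v, y j, y' i}"
    by (rule card3_subset[OF c3]) (use T(2) cv vX s(2,7) s'(2,7) yz(1) zC in auto)
  obtain E where E: "E \<in> \<A>" "E \<noteq> C" "y j \<in> E" by (rule X_on[OF s(2) yz(1)])
  have ED: "E \<noteq> D" using E(3) yD by blast
  obtain k where k: "T \<subseteq> side k E" using cell_side[OF cT E(1)] by blast
  obtain V x V' x' where W: "star C E (y j) V x" "star E C (y j) V' x'"
      "\<And>i k T. cell T \<Longrightarrow> y j \<in> closure T \<Longrightarrow> T \<subseteq> side i C \<inter> side k E \<Longrightarrow> V k \<union> V' i \<subseteq> closure T"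
    using stars_exist[OF C E(1) E(2)[symmetric] yz(1) E(3)] by metis
  note q = starD[OF W(2), of i]
  have "x' i \<in> closure T" using W(3)[OF cT cv(1), of i k] T(3) k q(6) by blast
  then have "x' i \<in> {v, y j, y' i}" using c3' q(2) by (metis IntI)
  then have "x' i = v \<or> x' i = y' i" using q(7) by auto
  moreover have "x' i \<in> E" using q(4,6) by blast
  moreover have "v \<notin> E" using no_triple[OF C D E(1) CD v] E(2) ED by blast
  ultimately have e: "x' i = y' i" "y' i \<in> E" by auto
  show ?thesis
    by (rule that[OF E(1,2) ED E(3) e(2) yz(3,4), of "V' i"]) (use q e(1) in auto)
qed

text \<open>Seen from every pseudocircle other than \<open>D\<close>, the sides \<open>u\<close> of
  \<open>E\<close> and \<open>i\<close> of \<open>C\<close> look disjoint; at \<open>v\<close>,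
  \<open>D\<close> violates this. The crossing \<open>v\<close> is determined by \<open>C\<close>,
  \<open>E\<close> and \<open>u\<close>, which allows contacts to be counted by pairs of
  curves.\<close>

definition contact :: "complex set \<Rightarrow> bool \<Rightarrow> complex set \<Rightarrow> bool \<Rightarrow> complex set \<Rightarrow> complex \<Rightarrow> bool" where
  "contact E u C i D v \<longleftrightarrow> E \<in> \<A> \<and> C \<in> \<A> \<and> D \<in> \<A> \<and> E \<noteq> C \<and> E \<noteq> D \<and> C \<noteq> D \<and> v \<in> C \<inter> D \<and>
     C \<inter> side u E \<inter> X = {v} \<and> (\<forall>F\<in>\<A> - {E,C,D}. F \<inter> E \<inter> side i C = {})"

text \<open>The two triangles share the edge on \<open>D\<close> from \<open>v\<close> to
  \<open>z\<close>, and only one pseudocircle besides \<open>D\<close> passes through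
  \<open>z\<close>, so both have the same third curve \<open>F\<close>. It meets \<open>C\<close>
  exactly at the two outer corners. Hence the third sides make up the whole arc of \<open>F\<close>
  on side \<open>i\<close> of \<open>C\<close>, and the edges at \<open>v\<close> the whole arc of
  \<open>C\<close> on one side of \<open>F\<close>; \<open>z\<close> and \<open>v\<close> are the
  only crossings inside these arcs.\<close>

lemma adjacent_triangles_contact:
  assumes C: "C \<in> \<A>" and D: "D \<in> \<A>" and CD: "C \<noteq> D" and v: "v \<in> C" "v \<in> D"
    and st: "star C D v Y y" "star D C v Y' y'"
    and T: "\<And>j. tri (T j)" "\<And>j. v \<in> closure (T j)" "\<And>j. T j \<subseteq> side i C" "\<And>j. T j \<subseteq> side j D"
      and cl: "\<And>j. Y j \<union> Y' i \<subseteq> closure (T j)"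
  shows "\<exists>E u. contact E u C i D v"
proof -
  define z where "z = y' i"
  have "\<exists>E P. E \<in> \<A> \<and> E \<noteq> C \<and> E \<noteq> D \<and> y j \<in> E \<and> z \<in> E \<and> y j \<in> side j D \<and> z \<in> side i C \<and>
    is_arc P (y j) z \<and> P \<subseteq> E \<inter> (side i C \<union> C) \<and> P \<inter> X = {y j, z}" for j
    unfolding z_def by (rule triangle_third_side[OF C D CD v st T(1-4) cl, of j]) blast
  then obtain E P where E: "\<And>j. E j \<in> \<A>" "\<And>j. E j \<noteq> C" "\<And>j. E j \<noteq> D" "\<And>j. y j \<in> E j" "\<And>j. z \<in> E j"
    "\<And>j. y j \<in> side j D" "z \<in> side i C" and P: "\<And>j. is_arc (P j) (y j) z"
    "\<And>j. P j \<subseteq> E j \<inter> (side i C \<union> C)" "\<And>j. P j \<inter> X = {y j, z}"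
    by metis
  note s = starD[OF st(1)] and s' = starD[OF st(2), of i]
  have zD: "z \<in> D" using s'(4,6) unfolding z_def by blast
  have yC: "y j \<in> C" for j using s(4,6) by blast
  define F where "F = E True"
  have EF: "E j = F" for j
    using no_triple[OF E(1) D E(1) E(3)[of True] E(5) zD E(5), of j] E(3)[of j] unfolding F_def by auto
  note E = E[unfolded EF] and P = P[unfolded EF]
  have FC: "F \<noteq> C" "F \<noteq> D" "F \<in> \<A>" using E(1,2,3) by auto
  have cFC: "cross F C" by (rule crs[OF FC(3) C FC(1)])
  have zy: "z \<noteq> y j" for j using is_arc_ends[OF P(1), of j] by auto
  have yy: "y True \<noteq> y False" using E(6)[of True] E(6)[of False] side_Int[of True D] by auto
  have FCi: "F \<inter> C = {y True, y False}"
  proof -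
    obtain x where "F \<inter> C = {y True, x}"
      by (rule cross_other[OF cFC E(4) yC])
    then show ?thesis by (rule two_elements) (use E(4) yC yy in auto)
  qed
  have Pside: "P j - {z} \<subseteq> side j D" for j
  proof (rule connected_subset_side[OF jor[OF D] is_arc_minus_connected(2)[OF P(1)[of j]], of "y j"])
    show "y j \<in> P j - {z}" using is_arc_ends[OF P(1), of j] by auto
    show "y j \<in> side j D" by (rule E(6))
    have "P j \<inter> D \<subseteq> {y j, z}" using XI[OF FC(3) D FC(2)] P(2,3) by blast
    moreover have "y j \<notin> D" using E(6) side_disjoint[of j D] by blast
    ultimately show "(P j - {z}) \<inter> D = {}" by blast
  qed
  have PP: "P True \<inter> P False = {z}"
  proof
    show "P True \<inter> P False \<subseteq> {z}" using Pside[of True] Pside[of False] side_Int[of True D] by auto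
    show "{z} \<subseteq> P True \<inter> P False" using is_arc_ends[OF P(1)] by blast
  qed
  have L: "is_arc (P True \<union> P False) (y True) (y False)"
    by (rule is_arc_join[OF P(1) is_arc_sym[OF P(1)] PP])
  have PU: "P True \<union> P False = F \<inter> (side i C \<union> C)"
    by (rule is_arc_subset_eq[OF L cross_arc[OF cFC FCi]]) (use P(2) in blast)
  have Fz: "x = z" if x: "x \<in> F" "x \<in> side i C" "x \<in> X" for x
  proof -
    have "x \<in> P True \<union> P False" unfolding PU using x by blast
    then obtain j where "x \<in> P j" by blast
    then have "x \<in> {y j, z}" using P(3)[of j] x(3) by (metis IntI)
    moreover have "x \<noteq> y j" using yC[of j] x(2) in_side_not by blast
    ultimately show ?thesis by simp
  qed
  have F1: "G \<inter> F \<inter> side i C = {}" if G: "G \<in> \<A>" "G \<noteq> F" "G \<noteq> C" "G \<noteq> D" for G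
  proof (rule equals0I, elim IntE)
    fix x assume "x \<in> G" "x \<in> F" and x3: "x \<in> side i C"
    then have x: "x \<in> G" "x \<in> F" "x \<in> side i C" by blast+
    then have xz: "x = z" by (intro Fz XI[OF G(1) FC(3) G(2)])
    then show False using no_triple[OF FC(3) D G(1) FC(2) x(2) _ x(1)] zD G(2,4) unfolding xz by blast
  qed
  have vF: "v \<notin> F" using no_triple[OF C D FC(3) CD v] FC by blast
  then obtain u where u: "v \<in> side u F" using side_cases[of v F] by blast
  have CF: "C \<inter> F = {y True, y False}" using FCi by (simp add: Int_commute)
  have cCF: "cross C F" by (rule cross_sym[OF cFC])
  have Yside: "Y j - {y j} \<subseteq> side u F" for j
  proof (rule connected_subset_side[OF jor[OF FC(3)] is_arc_minus_connected(2)[OF s(1)[of j]], of v])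
    show "v \<in> Y j - {y j}" using s(5,7) by blast
    have "Y j \<inter> F \<subseteq> Y j \<inter> X" using XI[OF C FC(3) FC(1)[symmetric]] s(4)[of j] by blast
    then have "Y j \<inter> F \<subseteq> {v, y j}" unfolding s(3) .
    then show "(Y j - {y j}) \<inter> F = {}" using vF by blast
  qed (rule u)
  have YY: "Y True \<inter> Y False = {v}"
  proof
    show "Y True \<inter> Y False \<subseteq> {v}"
    proof
      fix x assume x: "x \<in> Y True \<inter> Y False"
      then have "x \<in> D" using s(4)[of True] s(4)[of False] side_Int[of True D] by auto
      then have "x \<in> X" using x XI[OF C D CD] s(4) by blast
      then have "x \<in> {v, y True}" using s(3)[of True] x by (metis IntD1 IntI)
      moreover have "y True \<notin> D" using E(6) side_disjoint[of True D] by blast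
      ultimately show "x \<in> {v}" using \<open>x \<in> D\<close> by auto
    qed
    show "{v} \<subseteq> Y True \<inter> Y False" using s(5) by blast
  qed
  have M: "is_arc (Y True \<union> Y False) (y True) (y False)"
    by (rule is_arc_join[OF is_arc_sym[OF s(1)] s(1) YY])
  have "Y True \<union> Y False = C \<inter> (side u F \<union> F)"
  proof (rule is_arc_subset_eq[OF M cross_arc[OF cCF CF]])
    have "Y j \<subseteq> side u F \<union> F" for j using Yside[of j] E(4)[of j] by blast
    then show "Y True \<union> Y False \<subseteq> C \<inter> (side u F \<union> F)" using s(4) by blast
  qed
  note YU = this
  have "x = v" if x: "x \<in> C" "x \<in> side u F" "x \<in> X" for x
  proof -
    have "x \<in> Y True \<union> Y False" unfolding YU using x by blast
    then obtain j where "x \<in> Y j" by blast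
    then have "x \<in> {v, y j}" using s(3)[of j] x(3) by (metis IntI)
    moreover have "x \<noteq> y j" using E(4)[of j] x(2) in_side_not by blast
    ultimately show ?thesis by simp
  qed
  then have "C \<inter> side u F \<inter> X \<subseteq> {v}" by blast
  moreover have "{v} \<subseteq> C \<inter> side u F \<inter> X" using u v(1) XI[OF C D CD v] by simp
  ultimately have F2: "C \<inter> side u F \<inter> X = {v}" by (rule equalityI)
  have "contact F u C i D v" unfolding contact_def
    by (intro conjI ballI F1 F2) (use C D CD FC v in auto)
  then show ?thesis by blast
qed

definition trs :: "complex \<Rightarrow> complex set set" where
  "trs v = {T. tri T \<and> v \<in> closure T}"

text \<open>Triangles at \<open>v\<close> are told apart by their quadrants, and three occupied
  quadrants out of four include two adjacent ones across \<open>D\<close>.\<close>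

lemma triangles_at_crossing:
  assumes C: "C \<in> \<A>" and D: "D \<in> \<A>" and CD: "C \<noteq> D" and v: "v \<in> C" "v \<in> D"
  shows "finite (trs v)" "card (trs v) \<le> 4"
    "card (trs v) \<ge> 3 \<Longrightarrow> \<exists>E u i. contact E u C i D v"
proof -
  obtain Y y Y' y' where st: "star C D v Y y" "star D C v Y' y'"
    "\<And>i j T. cell T \<Longrightarrow> v \<in> closure T \<Longrightarrow> T \<subseteq> side i C \<inter> side j D \<Longrightarrow> Y j \<union> Y' i \<subseteq> closure T"
    "\<And>i j T T'. cell T \<Longrightarrow> v \<in> closure T \<Longrightarrow> T \<subseteq> side i C \<inter> side j D \<Longrightarrow>
       cell T' \<Longrightarrow> v \<in> closure T' \<Longrightarrow> T' \<subseteq> side i C \<inter> side j D \<Longrightarrow> T = T'"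
    using stars_exist[OF C D CD v] by metis
  have "\<exists>p. T \<subseteq> side (fst p) C \<inter> side (snd p) D" if t: "T \<in> trs v" for T
  proof -
    have "cell T" using t unfolding trs_def tri_def by blast
    then obtain i j where "T \<subseteq> side i C" "T \<subseteq> side j D" using cell_side[OF _ C, of T] cell_side[OF _ D, of T] by blast
    then show ?thesis by (intro exI[of _ "(i,j)"]) simp
  qed
  then obtain f where f: "\<And>T. T \<in> trs v \<Longrightarrow> T \<subseteq> side (fst (f T)) C \<inter> side (snd (f T)) D"
    by metis
  have inj: "inj_on f (trs v)"
  proof (rule inj_onI)
    fix T T' assume t: "T \<in> trs v" "T' \<in> trs v" "f T = f T'"
    then show "T = T'" using st(4)[of T "fst (f T)" "snd (f T)" T'] f[OF t(1)] f[OF t(2)] unfolding trs_def tri_def by auto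
  qed
  have U: "(UNIV :: (bool \<times> bool) set) = {(True,True),(True,False),(False,True),(False,False)}" by auto
  have c4: "card (UNIV :: (bool \<times> bool) set) = 4" by (simp add: U)
  show fin: "finite (trs v)" by (rule inj_on_finite[OF inj subset_UNIV]) simp
  have ci: "card (f ` trs v) = card (trs v)" by (rule card_image[OF inj])
  have "card (f ` trs v) \<le> card (UNIV :: (bool \<times> bool) set)" by (rule card_mono) auto
  then show "card (trs v) \<le> 4" using ci c4 by simp
  assume 3: "card (trs v) \<ge> 3"
  \<comment> \<open>Otherwise each side of \<open>C\<close> would have an unoccupied quadrant,
    leaving room for only two triangles.\<close>
  have "\<exists>i. \<forall>j. (i,j) \<in> f ` trs v"
  proof (rule ccontr)
    assume "\<not> ?thesis"
    then obtain a b where "(True,a) \<notin> f ` trs v" "(False,b) \<notin> f ` trs v" by blast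
    then have "f ` trs v \<subseteq> {p. p \<noteq> (True,a) \<and> p \<noteq> (False,b)}" by auto
    also have "\<dots> \<subseteq> {(True,\<not> a),(False,\<not> b)}" by auto
    finally have "f ` trs v \<subseteq> {(True,\<not> a),(False,\<not> b)}" .
    then have "card (f ` trs v) \<le> card {(True,\<not> a),(False,\<not> b)}" by (rule card_mono[rotated]) simp
    then show False using ci 3 by simp
  qed
  then obtain i where i: "\<And>j. (i,j) \<in> f ` trs v" by blast
  then have "\<exists>T. T \<in> trs v \<and> f T = (i,j)" for j by (metis imageE)
  then obtain T where T: "\<And>j. T j \<in> trs v" "\<And>j. f (T j) = (i,j)" by metis
  have TT: "tri (T j)" "v \<in> closure (T j)" "T j \<subseteq> side i C" "T j \<subseteq> side j D" for j
    using T(1)[of j] f[OF T(1)[of j]] T(2)[of j] unfolding trs_def by auto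
  have "Y j \<union> Y' i \<subseteq> closure (T j)" for j
    by (rule st(3)) (use TT[of j] in \<open>auto simp: tri_def\<close>)
  from adjacent_triangles_contact[OF C D CD v st(1,2) TT this] show "\<exists>E u i. contact E u C i D v" by blast
qed

end

section \<open>Averaging over colourings with three prescribed values\<close>

lemma colouring_average:
  fixes p q r :: "'v \<Rightarrow> 'c::finite" and A B C :: "'v \<Rightarrow> 'u"
  assumes "finite U" "finite V"
    and d: "\<And>v. v \<in> V \<Longrightarrow> A v \<in> U \<and> B v \<in> U \<and> C v \<in> U \<and> A v \<noteq> B v \<and> A v \<noteq> C v \<and> B v \<noteq> C v"
  shows "\<exists>f. card V \<le> CARD('c)^3 * card {v\<in>V. f (A v) = p v \<and> f (B v) = q v \<and> f (C v) = r v}"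
proof (rule ccontr)
  define P where "P = (U \<rightarrow>\<^sub>E (UNIV :: 'c set))"
  define ok where "ok f v \<longleftrightarrow> f (A v) = p v \<and> f (B v) = q v \<and> f (C v) = r v" for f v
  assume "\<not> ?thesis"
  then have lt: "CARD('c)^3 * card {v\<in>V. ok f v} < card V" for f unfolding ok_def using not_le by blast
  have fP: "finite P" unfolding P_def using assms(1) by (intro finite_PiE) auto
  have neP: "P \<noteq> {}" unfolding P_def by (simp add: PiE_eq_empty_iff)
  have 1: "card P \<le> CARD('c)^3 * card {f\<in>P. ok f v}" if v: "v \<in> V" for v
  proof -
    \<comment> \<open>Recolouring three points loses only their old colours, so \<open>h\<close> is
      injective. Hence at least the share \<open>1 / CARD('c)^3\<close> of all colourings is right
      for \<open>v\<close>.\<close>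
    define h where "h f = (f (A v), f (B v), f (C v), f(A v := p v, B v := q v, C v := r v))" for f :: "'u \<Rightarrow> 'c"
    note d = d[OF v]
    have "inj h"
    proof (rule injI, rule ext)
      fix f g x assume e: "h f = h g"
      show "f x = g x"
      proof (cases "x \<in> {A v, B v, C v}")
        case True then show ?thesis using e unfolding h_def by auto
      next
        case False
        have "(f(A v := p v, B v := q v, C v := r v)) x = (g(A v := p v, B v := q v, C v := r v)) x"
          using e unfolding h_def by (metis Pair_inject)
        then show ?thesis using False by simp
      qed
    qed
    moreover have "h ` P \<subseteq> UNIV \<times> UNIV \<times> UNIV \<times> {f\<in>P. ok f v}"
    proof
      fix y assume "y \<in> h ` P"
      then obtain f where f: "f \<in> P" "y = h f" by blast
      have "f(A v := p v, B v := q v, C v := r v) \<in> {f\<in>P. ok f v}"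
        using f(1) d unfolding P_def ok_def by (auto simp: PiE_iff extensional_def)
      then show "y \<in> UNIV \<times> UNIV \<times> UNIV \<times> {f\<in>P. ok f v}" unfolding f(2) h_def by simp
    qed
    ultimately have "card P \<le> card ((UNIV::'c set) \<times> (UNIV::'c set) \<times> (UNIV::'c set) \<times> {f\<in>P. ok f v})"
      using fP by (intro card_inj_on_le[of h]) (auto intro: inj_on_subset)
    then show ?thesis by (simp add: card_cartesian_product power3_eq_cube mult.assoc)
  qed
  have "card V * card P \<le> (\<Sum>v\<in>V. CARD('c)^3 * card {f\<in>P. ok f v})"
    using sum_mono[of V "\<lambda>_. card P" "\<lambda>v. CARD('c)^3 * card {f\<in>P. ok f v}"] 1 by simp
  also have "\<dots> = CARD('c)^3 * (\<Sum>v\<in>V. card {f\<in>P. ok f v})" by (simp add: sum_distrib_left)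
  also have "(\<Sum>v\<in>V. card {f\<in>P. ok f v}) = (\<Sum>v\<in>V. \<Sum>f\<in>P. if ok f v then 1 else 0)"
    using fP by (simp add: sum.If_cases Int_def)
  also have "\<dots> = (\<Sum>f\<in>P. \<Sum>v\<in>V. if ok f v then 1 else 0)" by (rule sum.swap)
  also have "\<dots> = (\<Sum>f\<in>P. card {v\<in>V. ok f v})"
    using assms(2) by (simp add: sum.If_cases Int_def)
  also have "CARD('c)^3 * \<dots> = (\<Sum>f\<in>P. CARD('c)^3 * card {v\<in>V. ok f v})" by (simp add: sum_distrib_left)
  also have "\<dots> < (\<Sum>f\<in>P. card V)" by (rule sum_strict_mono[OF fP neP]) (rule lt)
  also have "\<dots> = card V * card P" by simp
  finally show False by simp
qed

section \<open>Contacts of the arrangement as contacts along a transversal\<close>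

context planar_arrangement
begin

lemma contactD:
  assumes "contact E u C i D v"
  shows "E \<in> \<A>" "C \<in> \<A>" "D \<in> \<A>" "E \<noteq> C" "E \<noteq> D" "C \<noteq> D" "v \<in> C" "v \<in> D" "C \<inter> side u E \<inter> X = {v}"
    "v \<in> X"
    "\<And>F. F \<in> \<A> \<Longrightarrow> F \<notin> {E,C,D} \<Longrightarrow> F \<inter> E \<subseteq> side (\<not> i) C"
    "\<And>F. F \<in> \<A> \<Longrightarrow> F \<notin> {E,C,D} \<Longrightarrow> F \<inter> C \<subseteq> side (\<not> u) E"
proof -
  show *: "E \<in> \<A>" "C \<in> \<A>" "D \<in> \<A>" "E \<noteq> C" "E \<noteq> D" "C \<noteq> D" "v \<in> C" "v \<in> D" "C \<inter> side u E \<inter> X = {v}"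
    using assms unfolding contact_def by simp_all
  show "v \<in> X" using *(9) by blast
  show "F \<inter> E \<subseteq> side (\<not> i) C" if F: "F \<in> \<A>" "F \<notin> {E,C,D}" for F
  proof
    fix x assume x: "x \<in> F \<inter> E"
    have "F \<inter> E \<inter> side i C = {}" using assms F unfolding contact_def by simp
    then have "x \<notin> side i C" using x by blast
    moreover have "x \<notin> C" using no_triple[OF *(1,2) F(1) *(4), of x] x F(2) by auto
    ultimately show "x \<in> side (\<not> i) C" by (simp add: not_in_side)
  qed
  show "F \<inter> C \<subseteq> side (\<not> u) E" if F: "F \<in> \<A>" "F \<notin> {E,C,D}" for F
  proof
    fix x assume x: "x \<in> F \<inter> C"
    have "x \<in> X" using XI[OF F(1) *(2)] F(2) x by simp
    have "x \<noteq> v" using no_triple[OF *(2,3) F(1) *(6), of v] x *(7,8) F(2) by auto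
    then have "x \<notin> side u E" using *(9) x \<open>x \<in> X\<close> by blast
    moreover have "x \<notin> E" using no_triple[OF *(1,2) F(1) *(4), of x] x F(2) by auto
    ultimately show "x \<in> side (\<not> u) E" by (simp add: not_in_side)
  qed
qed

lemma transversal:
  assumes "Z \<in> \<A>" "S \<subseteq> \<A> - {Z}" "loop g Z" "g 0 \<notin> X"
  shows "transversal_family S Z g"
proof
  show "finite S" using finA assms(2) finite_subset by blast
  show "Z \<notin> S" using assms(2) by blast
  show "cross F G" if "F \<in> insert Z S" "G \<in> insert Z S" "F \<noteq> G" for F G
    using crs that assms(1,2) by blast
  show "loop g Z" by (rule assms(3))
  have gZ: "g 0 \<in> Z" using loopD(3)[OF assms(3)] by auto
  show "g 0 \<notin> F" if "F \<in> S" for F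
    using XI[OF assms(1), of F "g 0"] that assms(2,4) gZ by blast
  show "Z \<inter> F \<inter> G = {}" if "F \<in> S" "G \<in> S" "F \<noteq> G" for F G
    by (rule simple) (use that assms(1,2) in auto)
qed

text \<open>Two apparently disjoint sides give two nestings: side \<open>u\<close> of
  \<open>E\<close> in the complement of side \<open>i\<close> of \<open>C\<close>, or side
  \<open>i\<close> of \<open>C\<close> in the complement of side \<open>u\<close> of
  \<open>E\<close>. On \<open>Z\<close> at least one of them has the outer entry first. The choice
  depends only on the contact and on the loop \<open>g\<close>, not on \<open>S\<close>, so it can
  be prescribed before a subfamily is drawn. \<open>D\<close> is kept out of \<open>S\<close>
  because it violates the nesting at \<open>v\<close>.\<close>

lemma contact_sides:
  assumes Z: "Z \<in> \<A>" "loop g Z" "g 0 \<notin> X" and c: "contact E u C i D v" and ne: "Z \<notin> {E,C,D}"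
  obtains a b where "\<And>\<sigma> S. S \<subseteq> \<A> - {Z,D} \<Longrightarrow> E \<in> S \<Longrightarrow> C \<in> S \<Longrightarrow> \<sigma> E = a \<Longrightarrow> \<sigma> C = b \<Longrightarrow>
     transversal_family.contact S Z g \<sigma> E C \<or> transversal_family.contact S Z g \<sigma> C E"
proof -
  note k = contactD[OF c]
  have gZ: "g 0 \<in> Z" using loopD(3)[OF Z(2)] by auto
  have g0: "g 0 \<notin> E" "g 0 \<notin> C" using XI[OF Z(1) k(1) _ gZ] XI[OF Z(1) k(2) _ gZ] Z(3) ne by auto
  have cr: "cross Z E" "cross Z C" using crs[OF Z(1) k(1)] crs[OF Z(1) k(2)] ne by auto
  obtain s t where st: "0 < s" "s < t" "t < 1" "Z \<inter> E = {g s, g t}" by (rule loop_points[OF Z(2) cr(1) g0(1)])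
  obtain s' t' where st': "0 < s'" "s' < t'" "t' < 1" "Z \<inter> C = {g s', g t'}" by (rule loop_points[OF Z(2) cr(2) g0(2)])
  define b where "b \<longleftrightarrow> g 0 \<in> side u E"
  define d where "d \<longleftrightarrow> g 0 \<in> side i C"
  have nb: "g 0 \<in> side (\<not> u) E \<longleftrightarrow> \<not> b" using not_in_side[OF g0(1), of u] unfolding b_def by blast
  have nd: "g 0 \<in> side (\<not> i) C \<longleftrightarrow> \<not> d" using not_in_side[OF g0(2), of i] unfolding d_def by blast
  have ZE: "Z \<inter> E \<subseteq> side (\<not> i) C" and ZC: "Z \<inter> C \<subseteq> side (\<not> u) E" using k(11,12)[OF Z(1) ne] .
  have sE: "g x \<in> side (\<not> u) E \<longleftrightarrow> (if b then s < x \<and> x < t else x < s \<or> t < x)" if x: "x \<in> {0..1}" "g x \<notin> E" for x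
  proof -
    have xn: "x \<noteq> s" "x \<noteq> t" using x(2) st(4) by auto
    show ?thesis
    proof (cases b)
      case True
      have 0: "g 0 \<in> side u E" using True b_def by simp
      show ?thesis using loop_sides[OF Z(2) cr(1) 0 st, of x] x xn True in_side_not(2)[of "g x" u E]
        by (smt (verit) linorder_less_linear)
    next
      case False
      have 0: "g 0 \<in> side (\<not> u) E" using False nb by simp
      show ?thesis using loop_sides[OF Z(2) cr(1) 0 st, of x] x xn False in_side_not(2)[of "g x" "\<not> u" E]
        by (smt (verit) linorder_less_linear)
    qed
  qed
  have sC: "g x \<in> side (\<not> i) C \<longleftrightarrow> (if d then s' < x \<and> x < t' else x < s' \<or> t' < x)" if x: "x \<in> {0..1}" "g x \<notin> C" for x
  proof -
    have xn: "x \<noteq> s'" "x \<noteq> t'" using x(2) st'(4) by auto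
    show ?thesis
    proof (cases d)
      case True
      have 0: "g 0 \<in> side i C" using True d_def by simp
      show ?thesis using loop_sides[OF Z(2) cr(2) 0 st', of x] x xn True in_side_not(2)[of "g x" i C]
        by (smt (verit) linorder_less_linear)
    next
      case False
      have 0: "g 0 \<in> side (\<not> i) C" using False nd by simp
      show ?thesis using loop_sides[OF Z(2) cr(2) 0 st', of x] x xn False in_side_not(2)[of "g x" "\<not> i" C]
        by (smt (verit) linorder_less_linear)
    qed
  qed
  have in1: "g s \<in> side (\<not> i) C" "g t \<in> side (\<not> i) C" "g s' \<in> side (\<not> u) E" "g t' \<in> side (\<not> u) E"
    using ZE ZC st(4) st'(4) by auto
  note in2 = in_side_not(1)[OF in1(1)] in_side_not(1)[OF in1(2)] in_side_not(1)[OF in1(3)] in_side_not(1)[OF in1(4)]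
  have o: "if d then s' < s \<and> t < t' else (s < s' \<or> t' < s) \<and> (t < s' \<or> t' < t)"
    "if b then s < s' \<and> t' < t else (s' < s \<or> t < s') \<and> (t' < s \<or> t < t')"
    using in1 sC[of s] sC[of t] sE[of s'] sE[of t'] in2 st st' by auto
  have ent: "transversal_family.entry Z g \<sigma> F = (if g 0 \<in> side (\<sigma> F) F then t else s)"
    if tf: "transversal_family S Z g" and F: "F \<in> S" and s: "0 < s" "s < t" "t < 1" "Z \<inter> F = {g s, g t}" for \<sigma> S F s t
  proof -
    interpret tf: transversal_family S Z g \<sigma> by (rule tf)
    obtain x y where xy: "0 < x" "x < y" "y < 1" "Z \<inter> F = {g x, g y}"
      "tf.entry F = (if g 0 \<in> side (\<sigma> F) F then y else x)" by (rule tf.entry[OF F])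
    have "{g x, g y} = {g s, g t}" using xy(4) s(4) by simp
    then have "(g x = g s \<and> g y = g t) \<or> (g x = g t \<and> g y = g s)" by (auto simp: doubleton_eq_iff)
    then have "(x = s \<and> y = t) \<or> (x = t \<and> y = s)"
      using loop_inj_open[OF Z(2), of x s] loop_inj_open[OF Z(2), of y t] loop_inj_open[OF Z(2), of x t] loop_inj_open[OF Z(2), of y s] xy s
      by auto
    then show ?thesis using xy s by auto
  qed
  have nest: "nested u E (\<not> i) C F" "nested i C (\<not> u) E F" if "F \<in> \<A>" "F \<notin> {E,C,D}" for F
    unfolding nested_def using k(11,12)[OF that] by simp_all
  \<comment> \<open>The left parameter is the entry into the complement of side \<open>i\<close> of
    \<open>C\<close>, the right one the entry into side \<open>u\<close> of \<open>E\<close>. If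
    this order fails, the complementary nesting has its entries in the right order, which is
    \<open>o2\<close>.\<close>
  define o1 where "o1 \<longleftrightarrow> (if d then s' else t') < (if b then t else s)"
  have o2: "(if b then s else t) < (if d then t' else s')" if "\<not> o1"
    using that o st st' unfolding o1_def by (auto split: if_splits)
  show ?thesis
  proof (rule that[of "if o1 then u else \<not> u" "if o1 then \<not> i else i"])
    fix \<sigma> S assume S: "S \<subseteq> \<A> - {Z,D}" and ES: "E \<in> S" and CS: "C \<in> S"
      and sE: "\<sigma> E = (if o1 then u else \<not> u)" and sC: "\<sigma> C = (if o1 then \<not> i else i)"
    have tf: "transversal_family S Z g" by (rule transversal[OF Z(1) _ Z(2,3)]) (use S in blast)
    interpret tf: transversal_family S Z g \<sigma> by (rule tf)
    have eE: "tf.entry E = (if g 0 \<in> side (\<sigma> E) E then t else s)" by (rule ent[OF tf ES st])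
    have eC: "tf.entry C = (if g 0 \<in> side (\<sigma> C) C then t' else s')" by (rule ent[OF tf CS st'])
    have other: "F \<in> \<A> \<and> F \<notin> {E,C,D}" if "F \<in> insert Z S - {E,C}" for F using that S ne Z(1) by blast
    show "tf.contact E C \<or> tf.contact C E"
    proof (cases o1)
      case True
      have "tf.entry C < tf.entry E" using True eE eC nd unfolding sE sC o1_def b_def by auto
      moreover have "nested (\<sigma> E) E (\<sigma> C) C F" if "F \<in> insert Z S - {E,C}" for F
        using nest(1) other[OF that] True unfolding sE sC by simp
      ultimately have "tf.contact E C" unfolding tf.contact_def using ES CS k(4) by blast
      then show ?thesis ..
    next
      case False
      have "tf.entry E < tf.entry C" using False eE eC nb o2 unfolding sE sC d_def by auto
      moreover have "nested (\<sigma> C) C (\<sigma> E) E F" if "F \<in> insert Z S - {C,E}" for F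
        using nest(2) other[of F] that False unfolding sE sC by auto
      ultimately have "tf.contact C E" unfolding tf.contact_def using ES CS k(4) by blast
      then show ?thesis ..
    qed
  qed
qed

end

section \<open>Counting triangles\<close>

lemma jordan_infinite: assumes "jordan C" shows "infinite C"
proof -
  obtain h where h: "simple_path h" "path_image h = C" using assms unfolding jordan_def by blast
  have "h (1/4) \<noteq> h (1/2)"
    using h(1)[unfolded simple_path_def loop_free_def, THEN conjunct2, THEN bspec[of _ _ "1/4"], THEN bspec[of _ _ "1/2"]] by auto
  moreover have "h (1/4) \<in> C" "h (1/2) \<in> C" unfolding h(2)[symmetric] path_image_def by auto
  ultimately show ?thesis using connected_finite_iff_sing[OF jordan_connected[OF assms]] by auto
qed

context planar_arrangement
begin

text \<open>The constant is \<open>27 * 28\<close>: a suitable colouring keeps one contact in 27,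
  the even drawing has at most \<open>7 * card S\<close> edges, and each edge accounts for at most
  four of the crossings.\<close>

lemma generic_contacts:
  assumes Z: "Z \<in> \<A>" "loop g Z" "g 0 \<notin> X" and fV: "finite V"
    and c: "\<And>v. v \<in> V \<Longrightarrow> contact (E v) (u v) (C v) (i v) (D v) v \<and> Z \<notin> {E v, C v, D v}"
  shows "card V \<le> 756 * card \<A>"
proof -
  have "\<exists>a b. \<forall>\<sigma> S. S \<subseteq> \<A> - {Z, D v} \<longrightarrow> E v \<in> S \<longrightarrow> C v \<in> S \<longrightarrow> \<sigma> (E v) = a \<longrightarrow> \<sigma> (C v) = b \<longrightarrow>
     transversal_family.contact S Z g \<sigma> (E v) (C v) \<or> transversal_family.contact S Z g \<sigma> (C v) (E v)"
    if v: "v \<in> V" for v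
  proof -
    have 1: "contact (E v) (u v) (C v) (i v) (D v) v" "Z \<notin> {E v, C v, D v}" using c[OF v] by simp_all
    show ?thesis by (rule contact_sides[OF Z 1]) blast
  qed
  then obtain a b where ab: "\<And>v \<sigma> S. v \<in> V \<Longrightarrow> S \<subseteq> \<A> - {Z, D v} \<Longrightarrow> E v \<in> S \<Longrightarrow> C v \<in> S \<Longrightarrow> \<sigma> (E v) = a v \<Longrightarrow> \<sigma> (C v) = b v \<Longrightarrow>
     transversal_family.contact S Z g \<sigma> (E v) (C v) \<or> transversal_family.contact S Z g \<sigma> (C v) (E v)"
    by metis
  have dis: "D v \<in> \<A> \<and> E v \<in> \<A> \<and> C v \<in> \<A> \<and> D v \<noteq> E v \<and> D v \<noteq> C v \<and> E v \<noteq> C v" if "v \<in> V" for v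
    using contactD(1-6)[OF conjunct1[OF c[OF that]]] by simp
  \<comment> \<open>\<open>None\<close> deletes a pseudocircle, \<open>Some\<close> chooses its
    side; the type has three elements.\<close>
  obtain f :: "complex set \<Rightarrow> bool option" where
    f: "card V \<le> CARD(bool option)^3 * card {v\<in>V. f (D v) = None \<and> f (E v) = Some (a v) \<and> f (C v) = Some (b v)}"
    using colouring_average[where A=D and B=E and C=C and p="\<lambda>_. None" and q="\<lambda>v. Some (a v)" and r="\<lambda>v. Some (b v)", OF finA fV dis] by blast
  define W where "W = {v\<in>V. f (D v) = None \<and> f (E v) = Some (a v) \<and> f (C v) = Some (b v)}"
  define S where "S = {F\<in>\<A>. F \<noteq> Z \<and> f F \<noteq> None}"
  define \<sigma> where "\<sigma> F = the (f F)" for F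
  interpret tf: transversal_family S Z g \<sigma> by (rule transversal[OF Z(1) _ Z(2,3)]) (auto simp: S_def)
  define L where "L = {{tf.entry A, tf.entry B} | A B. tf.contact A B}"
  have cL: "card L \<le> 7 * card \<A>"
  proof -
    have "card L \<le> 7 * card S" unfolding L_def by (rule tf.card_contacts)
    also have "card S \<le> card \<A>" by (rule card_mono[OF finA]) (auto simp: S_def)
    finally show ?thesis by simp
  qed
  have fL: "finite L"
  proof (rule finite_subset)
    show "L \<subseteq> Pow (tf.entry ` S)" unfolding L_def tf.contact_def by blast
    show "finite (Pow (tf.entry ` S))" using tf.fin by simp
  qed
  have W: "E v \<in> S" "C v \<in> S" "{tf.entry (E v), tf.entry (C v)} \<in> L" if v: "v \<in> W" for v
  proof -
    have vV: "v \<in> V" and fv: "f (D v) = None" "f (E v) = Some (a v)" "f (C v) = Some (b v)"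
      using v unfolding W_def by simp_all
    have zn: "Z \<noteq> E v" "Z \<noteq> C v" using c[OF vV] by auto
    show S: "E v \<in> S" "C v \<in> S" unfolding S_def using dis[OF vV] zn fv by auto
    have "S \<subseteq> \<A> - {Z, D v}" unfolding S_def using fv(1) by auto
    from ab[OF vV this S, of \<sigma>] fv have "tf.contact (E v) (C v) \<or> tf.contact (C v) (E v)"
      unfolding \<sigma>_def by simp
    then show "{tf.entry (E v), tf.entry (C v)} \<in> L" unfolding L_def by (auto simp: insert_commute)
  qed
  \<comment> \<open>An edge is an unordered pair of entries. Two bits are needed in addition: which
    of its ends belongs to \<open>E\<close>, and the side \<open>u\<close> of \<open>E\<close> that
    contains \<open>v\<close>.\<close>
  define h where "h v = ({tf.entry (E v), tf.entry (C v)}, tf.entry (E v) < tf.entry (C v), u v)" for v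
  have "inj_on h W"
  proof (rule inj_onI)
    fix v w assume v: "v \<in> W" and w: "w \<in> W" and e: "h v = h w"
    have vV: "v \<in> V" "w \<in> V" using v w unfolding W_def by simp_all
    have ne: "tf.entry (E v) \<noteq> tf.entry (C v)" "tf.entry (E w) \<noteq> tf.entry (C w)"
      using inj_onD[OF tf.entry_inj _ W(1,2)[OF v]] inj_onD[OF tf.entry_inj _ W(1,2)[OF w]] dis[OF vV(1)] dis[OF vV(2)] by blast+
    have "tf.entry (E v) = tf.entry (E w) \<and> tf.entry (C v) = tf.entry (C w)"
      using e ne unfolding h_def by (auto simp: doubleton_eq_iff)
    then have EC: "E v = E w" "C v = C w"
      using inj_onD[OF tf.entry_inj _ W(1)[OF v] W(1)[OF w]] inj_onD[OF tf.entry_inj _ W(2)[OF v] W(2)[OF w]] by blast+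
    have uv: "u v = u w" using e unfolding h_def by simp
    have "{v} = C v \<inter> side (u v) (E v) \<inter> X" by (rule contactD(9)[OF conjunct1[OF c[OF vV(1)]], symmetric])
    also have "\<dots> = C w \<inter> side (u w) (E w) \<inter> X" by (simp only: EC uv)
    also have "\<dots> = {w}" by (rule contactD(9)[OF conjunct1[OF c[OF vV(2)]]])
    finally have "{v} = {w}" .
    then show "v = w" by simp
  qed
  moreover have "h ` W \<subseteq> L \<times> UNIV \<times> UNIV" unfolding h_def using W(3) by auto
  ultimately have "card W \<le> card (L \<times> (UNIV::bool set) \<times> (UNIV::bool set))"
    using fL by (intro card_inj_on_le) auto
  also have "\<dots> \<le> 28 * card \<A>" using cL by (simp add: card_cartesian_product)
  finally have "card W \<le> 28 * card \<A>" .
  moreover have "card V \<le> 27 * card W" using f unfolding W_def by simp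
  ultimately show ?thesis by simp
qed

section \<open>Bounds for crossings, contact points and triangles\<close>

lemma card_on_circle: assumes Z: "Z \<in> \<A>" shows "card (X \<inter> Z) \<le> 2 * card \<A>"
proof -
  have "X \<inter> Z \<subseteq> (\<Union>F\<in>\<A> - {Z}. F \<inter> Z)"
  proof
    fix x assume "x \<in> X \<inter> Z"
    then have x: "x \<in> X" "x \<in> Z" by simp_all
    obtain F where "F \<in> \<A>" "F \<noteq> Z" "x \<in> F" by (rule X_on[OF x])
    then show "x \<in> (\<Union>F\<in>\<A> - {Z}. F \<inter> Z)" using x by blast
  qed
  moreover have c2: "card (F \<inter> Z) = 2" if "F \<in> \<A> - {Z}" for F
    using crs[OF _ Z, of F] that unfolding cross_def by blast
  moreover have "finite (\<Union>F\<in>\<A> - {Z}. F \<inter> Z)"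
  proof (rule finite_UN_I)
    show "finite (F \<inter> Z)" if "F \<in> \<A> - {Z}" for F using c2[OF that] by (metis card.infinite zero_neq_numeral)
  qed (use finA in simp)
  ultimately have "card (X \<inter> Z) \<le> card (\<Union>F\<in>\<A> - {Z}. F \<inter> Z)" by (metis card_mono)
  also have "\<dots> \<le> (\<Sum>F\<in>\<A> - {Z}. card (F \<inter> Z))" by (rule card_UN_le) (use finA in simp)
  also have "\<dots> = (\<Sum>F\<in>\<A> - {Z}. 2)" by (rule sum.cong) (use c2 in auto)
  also have "\<dots> \<le> 2 * card \<A>" using card_mono[OF finA, of "\<A> - {Z}"] by auto
  finally show ?thesis .
qed

lemma card_X: "card X \<le> card \<A> * (card \<A> - 1)"
proof -
  define P where "P = {B. B \<subseteq> \<A> \<and> card B = 2}"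
  have fP: "finite P" unfolding P_def using finA by simp
  have c2: "card (\<Inter>B) = 2" if B: "B \<in> P" for B
  proof -
    obtain C D where B: "B = {C,D}" "C \<noteq> D" "C \<in> \<A>" "D \<in> \<A>"
      using B unfolding P_def card_2_iff by auto
    then show ?thesis using crs[OF B(3,4,2)] unfolding cross_def by simp
  qed
  have "X = (\<Union>B\<in>P. \<Inter>B)"
  proof
    show "X \<subseteq> (\<Union>B\<in>P. \<Inter>B)"
    proof
      fix x assume "x \<in> X"
      then obtain C D where "C \<in> \<A>" "D \<in> \<A>" "C \<noteq> D" "x \<in> C" "x \<in> D" unfolding X_def by blast
      then have "{C,D} \<in> P" "x \<in> \<Inter>{C,D}" unfolding P_def by auto
      then show "x \<in> (\<Union>B\<in>P. \<Inter>B)" by blast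
    qed
    show "(\<Union>B\<in>P. \<Inter>B) \<subseteq> X"
    proof
      fix x assume "x \<in> (\<Union>B\<in>P. \<Inter>B)"
      then obtain C D where "C \<in> \<A>" "D \<in> \<A>" "C \<noteq> D" "x \<in> C" "x \<in> D"
        unfolding P_def card_2_iff by auto
      then show "x \<in> X" by (rule XI)
    qed
  qed
  then have "card X \<le> (\<Sum>B\<in>P. card (\<Inter>B))" using card_UN_le[OF fP, of "\<Inter>"] by simp
  also have "\<dots> = card P * 2" using c2 by simp
  also have "card P = card \<A> choose 2" unfolding P_def by (rule n_subsets[OF finA])
  also have "\<dots> * 2 \<le> card \<A> * (card \<A> - 1)" by (simp add: choose_two)
  finally show ?thesis .
qed

text \<open>Contacts that involve the transversal \<open>Z\<close> itself are counted directly: at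
  most \<open>2 * card \<A>\<close> with \<open>E = Z\<close>, and as many crossings on
  \<open>Z\<close> for \<open>C = Z\<close> or \<open>D = Z\<close>. This raises 756 to 760.\<close>

lemma card_contact_points: "card {v. \<exists>E u C i D. contact E u C i D v} \<le> 760 * card \<A>"
proof (cases "\<A> = {}")
  case True
  then have "{v. \<exists>E u C i D. contact E u C i D v} = {}" unfolding contact_def by blast
  then show ?thesis by simp
next
  case False
  then obtain Z where Z: "Z \<in> \<A>" by blast
  define V where "V = {v. \<exists>E u C i D. contact E u C i D v}"
  have VX: "V \<subseteq> X" unfolding V_def using contactD(10) by blast
  then have fV: "finite V" using finX finite_subset by blast
  obtain z where z: "z \<in> Z" "z \<notin> X"
  proof -
    have "infinite Z" by (rule jordan_infinite[OF jor[OF Z]])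
    then have "Z - X \<noteq> {}" using finX by (metis Diff_eq_empty_iff finite_subset)
    then show ?thesis using that by blast
  qed
  obtain g where g: "loop g Z" "g 0 = z"
    by (rule oriented_exists[OF jor[OF Z] z(1), of True]) (auto simp: oriented_def)
  have "\<exists>E u C i D. contact E u C i D v" if "v \<in> V" for v using that unfolding V_def by blast
  then obtain E u C i D where c: "\<And>v. v \<in> V \<Longrightarrow> contact (E v) (u v) (C v) (i v) (D v) v" by metis
  define V1 where "V1 = {v\<in>V. E v = Z}"
  define V2 where "V2 = {v\<in>V. Z \<notin> {E v, C v, D v}}"
  have "V \<subseteq> V2 \<union> V1 \<union> (X \<inter> Z)"
  proof
    fix v assume v: "v \<in> V"
    then have "v \<in> X" "v \<in> C v" "v \<in> D v" using VX contactD(7,8)[OF c[OF v]] by blast+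
    then show "v \<in> V2 \<union> V1 \<union> (X \<inter> Z)" using v unfolding V1_def V2_def by blast
  qed
  then have "card V \<le> card (V2 \<union> V1 \<union> (X \<inter> Z))"
    by (rule card_mono[rotated]) (use fV finX in \<open>simp add: V1_def V2_def\<close>)
  also have "\<dots> \<le> card V2 + card V1 + card (X \<inter> Z)"
    using card_Un_le[of "V2 \<union> V1" "X \<inter> Z"] card_Un_le[of V2 V1] by simp
  finally have "card V \<le> card V2 + card V1 + card (X \<inter> Z)" .
  moreover have "card V2 \<le> 756 * card \<A>"
  proof (rule generic_contacts[OF Z g(1)])
    show "g 0 \<notin> X" using g(2) z(2) by simp
    show "finite V2" using fV unfolding V2_def by simp
    show "contact (E v) (u v) (C v) (i v) (D v) v \<and> Z \<notin> {E v, C v, D v}" if "v \<in> V2" for v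
      using that c[of v] unfolding V2_def by blast
  qed
  moreover have "card V1 \<le> 2 * card \<A>"
  proof -
    have "inj_on (\<lambda>v. (C v, u v)) V1"
    proof (rule inj_onI)
      fix v w assume v: "v \<in> V1" and w: "w \<in> V1" and e: "(C v, u v) = (C w, u w)"
      have "{v} = {w}" using contactD(9)[OF c, of v] contactD(9)[OF c, of w] v w e unfolding V1_def by simp
      then show "v = w" by simp
    qed
    moreover have "(\<lambda>v. (C v, u v)) ` V1 \<subseteq> \<A> \<times> UNIV"
      using contactD(2)[OF c] unfolding V1_def by blast
    ultimately have "card V1 \<le> card (\<A> \<times> (UNIV::bool set))" using finA by (intro card_inj_on_le) auto
    then show ?thesis by (simp add: card_cartesian_product)
  qed
  ultimately show ?thesis using card_on_circle[OF Z] unfolding V_def by simp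
qed

text \<open>Needed for honest counting: an infinite family of triangles would have cardinality
  0.\<close>

lemma finite_tri: "finite {T. tri T}"
proof (rule finite_subset)
  show "{T. tri T} \<subseteq> (\<Union>v\<in>X. trs v)"
  proof
    fix T assume "T \<in> {T. tri T}"
    then have T: "tri T" by simp
    then have "closure T \<inter> X \<noteq> {}" unfolding tri_def by (metis card.empty zero_neq_numeral)
    then show "T \<in> (\<Union>v\<in>X. trs v)" using T unfolding trs_def by blast
  qed
  have "finite (trs v)" if v: "v \<in> X" for v
  proof -
    obtain C D where "C \<in> \<A>" "D \<in> \<A>" "C \<noteq> D" "v \<in> C" "v \<in> D" using v unfolding X_def by blast
    then show ?thesis by (rule triangles_at_crossing(1))
  qed
  then show "finite (\<Union>v\<in>X. trs v)" using finX by simp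
qed

theorem card_triangles: "3 * card {T. tri T} \<le> 2 * (card \<A>)\<^sup>2 + 1520 * card \<A>"
proof -
  define V where "V = {v. \<exists>E u C i D. contact E u C i D v}"
  have VX: "V \<subseteq> X" unfolding V_def using contactD(10) by blast
  have le: "card (trs v) \<le> 2 + (if v \<in> V then 2 else 0)" if v: "v \<in> X" for v
  proof -
    obtain C D where CD: "C \<in> \<A>" "D \<in> \<A>" "C \<noteq> D" "v \<in> C" "v \<in> D" using v unfolding X_def by blast
    show ?thesis
    proof (cases "card (trs v) \<ge> 3")
      case True
      then have "v \<in> V" using triangles_at_crossing(3)[OF CD] unfolding V_def by blast
      then show ?thesis using triangles_at_crossing(2)[OF CD] by simp
    qed simp
  qed
  have "3 * card {T. tri T} = (\<Sum>T\<in>{T. tri T}. card (closure T \<inter> X))" by (simp add: tri_def)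
  also have "\<dots> = (\<Sum>T\<in>{T. tri T}. \<Sum>v\<in>X. if v \<in> closure T then 1 else 0)"
    using finX by (simp add: sum.If_cases Int_def conj_commute)
  also have "\<dots> = (\<Sum>v\<in>X. \<Sum>T\<in>{T. tri T}. if v \<in> closure T then 1 else 0)" by (rule sum.swap)
  also have "\<dots> = (\<Sum>v\<in>X. card (trs v))"
    using finite_tri by (simp add: sum.If_cases Int_def trs_def)
  also have "\<dots> \<le> (\<Sum>v\<in>X. 2 + (if v \<in> V then 2 else 0))" by (rule sum_mono) (rule le)
  also have "\<dots> = 2 * card X + 2 * card V"
    using finX VX by (subst sum.distrib) (simp add: sum.If_cases Int_absorb1)
  also have "\<dots> \<le> 2 * (card \<A> * (card \<A> - 1)) + 2 * (760 * card \<A>)"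
    using card_X card_contact_points unfolding V_def by (intro add_mono mult_le_mono) auto
  also have "\<dots> \<le> 2 * (card \<A>)\<^sup>2 + 1520 * card \<A>" by (simp add: power2_eq_square)
  finally show ?thesis .
qed

end

section \<open>From the sphere to the plane\<close>

text \<open>The map is continuous only off the pole of the projection, so preimages of closed sets
  are closed merely relative to \<open>U\<close>, and \<open>x\<close> must lie in
  \<open>U\<close>.\<close>

lemma continuous_on_closure_image:
  assumes "continuous_on U h" "F \<subseteq> U" "x \<in> U" "x \<in> closure F"
  shows "h x \<in> closure (h ` F)"
proof -
  have "closedin (top_of_set U) (U \<inter> h -` closure (h ` F))"
    by (rule continuous_closedin_preimage[OF assms(1)]) simp
  then obtain T where T: "closed T" "U \<inter> h -` closure (h ` F) = U \<inter> T" unfolding closedin_closed by blast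
  have "F \<subseteq> U \<inter> h -` closure (h ` F)" using assms(2) closure_subset by fastforce
  then have "F \<subseteq> T" using T(2) by blast
  then have "closure F \<subseteq> T" using T(1) by (rule closure_minimal)
  then show ?thesis using T(2) assms(3,4) by blast
qed

locale spherical_arrangement =
  fixes A :: "(real^3) set set" and z :: "real^3" and f :: "real^3 \<Rightarrow> complex" and g :: "complex \<Rightarrow> real^3"
  assumes arr: "arrangement A" "simple_arrangement A" "pairwise_intersecting A"
    and z: "z \<in> S2" "z \<notin> \<Union>A" and hom: "homeomorphism (S2 - {z}) UNIV f g"
begin

lemma sub: "C \<in> A \<Longrightarrow> C \<subseteq> S2 - {z}"
  using arr(1) z unfolding arrangement_def pseudocircle_def by blast

lemma cont: "continuous_on (S2 - {z}) f" "continuous_on UNIV g"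
  using hom unfolding homeomorphism_def by auto

lemma gf: "x \<in> S2 - {z} \<Longrightarrow> g (f x) = x" and fg: "f (g y) = y" and g_in: "g y \<in> S2 - {z}"
proof -
  show "x \<in> S2 - {z} \<Longrightarrow> g (f x) = x" "f (g y) = y" using hom unfolding homeomorphism_def by blast+
  have "range g = S2 - {z}" using hom unfolding homeomorphism_def by blast
  then show "g y \<in> S2 - {z}" by blast
qed

lemma inj: "inj_on f (S2 - {z})"
  by (rule inj_on_inverseI[of _ g]) (rule gf)

lemma image_Int: "C \<in> A \<Longrightarrow> D \<in> A \<Longrightarrow> f ` C \<inter> f ` D = f ` (C \<inter> D)"
  using inj_on_image_Int[OF inj sub sub] by simp

lemma image_jordan: assumes "C \<in> A" shows "jordan (f ` C)"
proof -
  have "pseudocircle C" using arr(1) assms unfolding arrangement_def by blast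
  then obtain h where h: "simple_path h" "pathfinish h = pathstart h" "path_image h = C"
    unfolding pseudocircle_def by metis
  have "simple_path (f \<circ> h)"
  proof (rule simple_path_continuous_image[OF h(1)])
    show "continuous_on (path_image h) f" unfolding h(3) by (rule continuous_on_subset[OF cont(1) sub[OF assms]])
    show "inj_on f (path_image h)" unfolding h(3) by (rule inj_on_subset[OF inj sub[OF assms]])
  qed
  moreover have "pathfinish (f \<circ> h) = pathstart (f \<circ> h)" "path_image (f \<circ> h) = f ` C"
    using h by (simp_all add: path_image_compose pathfinish_compose pathstart_compose)
  ultimately show ?thesis unfolding jordan_def by blast
qed

text \<open>The preimage of one side is connected and avoids \<open>C\<close>, so it lies in a
  component of the sphere minus \<open>C\<close>. That this component may also contain the pole is
  harmless, since only inclusion is needed to contradict \<open>crosses\<close>.\<close>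

lemma not_one_side:
  assumes C: "C \<in> A" and D: "D \<in> A" and CD: "C \<noteq> D"
  shows "\<not> f ` D - f ` C \<subseteq> side b (f ` C)"
proof
  assume s: "f ` D - f ` C \<subseteq> side b (f ` C)"
  define K where "K = g ` side b (f ` C)"
  note jC = image_jordan[OF C]
  have "connected K" unfolding K_def
    by (rule connected_continuous_image[OF continuous_on_subset[OF cont(2)] jordan_side(2)[OF jC]]) simp
  moreover have "K \<subseteq> S2 - C"
  proof
    fix x assume "x \<in> K"
    then obtain y where y: "y \<in> side b (f ` C)" "x = g y" unfolding K_def by blast
    have "x \<notin> C" using y(2) fg[of y] in_side_not(1)[OF y(1)] by (metis imageI)
    then show "x \<in> S2 - C" using g_in[of y] y(2) by simp
  qed
  moreover have "K \<noteq> {}" unfolding K_def using jordan_side(3)[OF jC] by simp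
  ultimately obtain L where L: "L \<in> components (S2 - C)" "K \<subseteq> L"
    using exists_component_superset[of K "S2 - C"] by auto
  have "D - C \<subseteq> K"
  proof
    fix x assume x: "x \<in> D - C"
    have xS: "x \<in> S2 - {z}" using x sub[OF D] by blast
    have "f x \<notin> f ` C" using inj_on_image_mem_iff[OF inj xS sub[OF C]] x by simp
    then have "f x \<in> side b (f ` C)" using s x by blast
    then show "x \<in> K" unfolding K_def using gf[OF xS] by (metis imageI)
  qed
  then have "\<not> crosses C D" unfolding crosses_def using L by blast
  moreover have "C \<inter> D \<noteq> {}" using arr(3) C D CD unfolding pairwise_intersecting_def by blast
  ultimately show False using arr(1) C D CD unfolding arrangement_def by blast
qed

lemma image_cross:
  assumes C: "C \<in> A" and D: "D \<in> A" and CD: "C \<noteq> D"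
  shows "cross (f ` C) (f ` D)"
proof -
  have "C \<inter> D \<noteq> {}" using arr(3) C D CD unfolding pairwise_intersecting_def by blast
  then have "card (C \<inter> D) = 2" using arr(1) C D CD unfolding arrangement_def by blast
  moreover have "card (f ` (C \<inter> D)) = card (C \<inter> D)"
    by (rule card_image) (use inj sub[OF C] in \<open>auto intro: inj_on_subset\<close>)
  ultimately have "card (f ` C \<inter> f ` D) = 2" unfolding image_Int[OF C D] by simp
  then show ?thesis unfolding cross_def
    using image_jordan[OF C] image_jordan[OF D] not_one_side[OF C D CD] not_one_side[OF D C] CD by auto
qed

sublocale planar_arrangement "(`) f ` A"
proof
  show "finite ((`) f ` A)" using arr(1) unfolding arrangement_def by simp
  show "jordan C" if "C \<in> (`) f ` A" for C using that image_jordan by blast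
  show "cross C D" if CD: "C \<in> (`) f ` A" "D \<in> (`) f ` A" "C \<noteq> D" for C D
  proof -
    obtain C' D' where 1: "C' \<in> A" "D' \<in> A" "C = f ` C'" "D = f ` D'" using CD by blast
    then have "C' \<noteq> D'" using CD(3) by blast
    then show ?thesis unfolding 1(3,4) by (rule image_cross[OF 1(1,2)])
  qed
  show "C \<inter> D \<inter> E = {}" if m: "C \<in> (`) f ` A" "D \<in> (`) f ` A" "E \<in> (`) f ` A" and n: "C \<noteq> D" "C \<noteq> E" "D \<noteq> E" for C D E
  proof -
    obtain C' D' E' where 1: "C' \<in> A" "D' \<in> A" "E' \<in> A" "C = f ` C'" "D = f ` D'" "E = f ` E'" using m by blast
    then have ne: "C' \<noteq> D'" "C' \<noteq> E'" "D' \<noteq> E'" using n by blast+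
    have "C' \<inter> D' \<inter> E' = {}" using arr(2) 1(1-3) ne unfolding simple_arrangement_def by blast
    moreover have "f ` C' \<inter> f ` D' \<inter> f ` E' = f ` (C' \<inter> D' \<inter> E')"
      using inj_on_image_Int[OF inj, of "C' \<inter> D'" E'] sub[OF 1(1)] sub[OF 1(3)] image_Int[OF 1(1,2)] by auto
    ultimately show ?thesis unfolding 1(4-6) by simp
  qed
qed

lemma image_crossings: "X = f ` crossings A"
proof
  show "X \<subseteq> f ` crossings A"
  proof
    fix x assume "x \<in> X"
    then obtain C D where 1: "C \<in> A" "D \<in> A" "f ` C \<noteq> f ` D" "x \<in> f ` C \<inter> f ` D" unfolding X_def by blast
    then have "x \<in> f ` (C \<inter> D)" "C \<noteq> D" using image_Int[OF 1(1,2)] by auto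
    then show "x \<in> f ` crossings A" unfolding crossings_def using 1(1,2) by blast
  qed
  show "f ` crossings A \<subseteq> X"
  proof
    fix x assume "x \<in> f ` crossings A"
    then obtain C D y where 1: "C \<in> A" "D \<in> A" "C \<noteq> D" "y \<in> C" "y \<in> D" "x = f y" unfolding crossings_def by blast
    have "f ` C \<noteq> f ` D" using inj_on_image_eq_iff[OF inj sub[OF 1(1)] sub[OF 1(2)]] 1(3) by simp
    then show "x \<in> X" using XI[of "f ` C" "f ` D" x] 1 by blast
  qed
qed

lemma cell_subset: "F \<in> cells A \<Longrightarrow> F \<subseteq> S2"
  unfolding cells_def using in_components_subset by blast

text \<open>A larger connected set in the plane that avoids the curves would pull back to one on the
  sphere, so maximality carries over. This uses that the cell itself avoids the pole.\<close>

lemma image_cell: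
  assumes F: "F \<in> cells A" "z \<notin> F"
  shows "cell (f ` F)" "card (closure (f ` F) \<inter> X) = card (frontier F \<inter> crossings A)"
proof -
  have Fm: "F \<noteq> {}" "F \<subseteq> S2 - \<Union>A" "connected F"
    "\<And>D. D \<noteq> {} \<Longrightarrow> F \<subseteq> D \<Longrightarrow> D \<subseteq> S2 - \<Union>A \<Longrightarrow> connected D \<Longrightarrow> D = F"
    using F(1) unfolding cells_def in_components_maximal by blast+
  have FS: "F \<subseteq> S2 - {z}" using Fm(2) F(2) by blast
  show "cell (f ` F)" unfolding cell_def in_components_maximal
  proof (intro conjI allI impI)
    show "f ` F \<noteq> {}" using Fm(1) by simp
    show "f ` F \<subseteq> - \<Union> ((`) f ` A)"
    proof
      fix y assume "y \<in> f ` F"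
      then obtain x where x: "x \<in> F" "y = f x" by blast
      have "y \<notin> f ` C" if C: "C \<in> A" for C
      proof -
        have "x \<in> S2 - {z}" "x \<notin> C" using x(1) FS Fm(2) C by blast+
        then show ?thesis using inj_on_image_mem_iff[OF inj _ sub[OF C], of x] x(2) by simp
      qed
      then show "y \<in> - \<Union> ((`) f ` A)" by blast
    qed
    show "connected (f ` F)" by (rule connected_continuous_image[OF continuous_on_subset[OF cont(1) FS] Fm(3)])
    fix K assume K: "K \<noteq> {} \<and> f ` F \<subseteq> K \<and> K \<subseteq> - \<Union> ((`) f ` A) \<and> connected K"
    have "g ` K = F"
    proof (rule Fm(4))
      show "g ` K \<noteq> {}" using K by simp
      show "F \<subseteq> g ` K"
      proof
        fix x assume x: "x \<in> F"
        then have "f x \<in> K" "g (f x) = x" using K gf FS by blast+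
        then show "x \<in> g ` K" by (metis imageI)
      qed
      show "g ` K \<subseteq> S2 - \<Union>A"
      proof
        fix x assume "x \<in> g ` K"
        then obtain y where y: "y \<in> K" "x = g y" by blast
        have "x \<notin> C" if C: "C \<in> A" for C
        proof
          assume "x \<in> C"
          then have "y \<in> f ` C" using fg[of y] y(2) by (metis imageI)
          then show False using y(1) K C by blast
        qed
        then show "x \<in> S2 - \<Union>A" using g_in[of y] y(2) by blast
      qed
      show "connected (g ` K)" by (rule connected_continuous_image[OF continuous_on_subset[OF cont(2)]]) (use K in auto)
    qed
    then have "f ` F = f ` g ` K" by simp
    also have "\<dots> = K" using fg by (simp add: image_image)
    finally show "K = f ` F" by simp
  qed
  have cS: "crossings A \<subseteq> S2 - {z}" unfolding crossings_def using sub by blast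
  \<comment> \<open>The frontier in \<open>p3\<close> is taken in three-space, where a subset of the
    sphere has empty interior; hence it equals the closure.\<close>
  have "negligible F" by (rule negligible_subset[OF negligible_sphere[of 0 1]]) (use FS in blast)
  then have "negligible (interior F)" by (rule negligible_subset) (rule interior_subset)
  then have "interior F = {}" using open_not_negligible[OF open_interior] by blast
  then have fr: "frontier F = closure F" unfolding frontier_def by simp
  have gF: "g ` f ` F = F"
  proof -
    have "g ` f ` F = (\<lambda>x. x) ` F" unfolding image_image by (rule image_cong) (use gf FS in blast)+
    then show ?thesis by simp
  qed
  have "f x \<in> closure (f ` F) \<longleftrightarrow> x \<in> closure F" if x: "x \<in> S2 - {z}" for x
    using continuous_on_closure_image[OF cont(1) FS x] continuous_on_closure_image[OF cont(2), of "f ` F" "f x"] gF gf[OF x] by auto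
  then have "f x \<in> closure (f ` F) \<longleftrightarrow> x \<in> closure F" if "x \<in> crossings A" for x using cS that by blast
  then have "closure (f ` F) \<inter> X = f ` (closure F \<inter> crossings A)"
    unfolding image_crossings by auto
  moreover have "card (f ` (closure F \<inter> crossings A)) = card (closure F \<inter> crossings A)"
    by (rule card_image) (use inj cS in \<open>auto intro: inj_on_subset\<close>)
  ultimately show "card (closure (f ` F) \<inter> X) = card (frontier F \<inter> crossings A)" unfolding fr by simp
qed

text \<open>The cell that contains the pole may be a triangle with no counterpart among the planar
  ones. Cells are disjoint, so this concerns at most one and costs the summand 3.\<close>

lemma p3_bound: "3 * p3 A \<le> 3 + 2 * (card A)\<^sup>2 + 1520 * card A"
proof -
  define P where "P = {F \<in> cells A. card (frontier F \<inter> crossings A) = 3}"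
  define Q where "Q = {F \<in> P. z \<notin> F}"
  have inQ: "inj_on ((`) f) Q"
  proof (rule inj_onI)
    fix F G assume F: "F \<in> Q" and G: "G \<in> Q" and e: "f ` F = f ` G"
    have "F \<subseteq> S2 - {z}" "G \<subseteq> S2 - {z}" using F G cell_subset unfolding Q_def P_def by blast+
    then show "F = G" using inj_on_image_eq_iff[OF inj] e by blast
  qed
  have sQ: "(`) f ` Q \<subseteq> {T. tri T}"
    using image_cell unfolding tri_def Q_def P_def by auto
  have cQ: "card Q \<le> card {T. tri T}" by (rule card_inj_on_le[OF inQ sQ finite_tri])
  have fQ: "finite Q" by (rule inj_on_finite[OF inQ sQ finite_tri])
  obtain F0 where "P \<subseteq> insert F0 Q"
  proof (cases "\<exists>F0\<in>P. z \<in> F0")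
    case True
    then obtain F0 where F0: "F0 \<in> P" "z \<in> F0" by blast
    have "F = F0" if "F \<in> P" "F \<notin> Q" for F
      using that F0 components_nonoverlap[of F "S2 - \<Union>A" F0] unfolding Q_def P_def cells_def by blast
    then show ?thesis using that[of F0] by blast
  next
    case False
    then show ?thesis using that[of "{}"] unfolding Q_def by blast
  qed
  then have "card P \<le> card (insert F0 Q)" using fQ by (intro card_mono) auto
  also have "\<dots> \<le> Suc (card Q)" by (rule card_insert_le_m1[of "Suc (card Q)"]) auto
  finally have "card P \<le> Suc (card {T. tri T})" using cQ by simp
  moreover have "card ((`) f ` A) \<le> card A" using arr(1) unfolding arrangement_def by (intro card_image_le) simp
  then have "2 * (card ((`) f ` A))\<^sup>2 + 1520 * card ((`) f ` A) \<le> 2 * (card A)\<^sup>2 + 1520 * card A"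
    by (intro add_mono mult_le_mono power_mono) auto
  ultimately show ?thesis using card_triangles unfolding p3_def P_def by simp
qed

end

theorem theorem5:
  shows "\<exists>c::real. c > 0 \<and>
    (\<forall>A. arrangement A \<and> simple_arrangement A \<and> pairwise_intersecting A \<longrightarrow>
       real (p3 A) \<le> 2/3 * real (card A)^2 + c * real (card A))"
proof (intro exI[of _ 508] conjI allI impI)
  fix A :: "(real^3) set set"
  assume A: "arrangement A \<and> simple_arrangement A \<and> pairwise_intersecting A"
  show "real (p3 A) \<le> 2/3 * real (card A)^2 + 508 * real (card A)"
  \<comment> \<open>Without curves there are no crossings; if the curves covered the sphere there
    would be no cells. Treating the latter as a case avoids showing that it cannot occur, and
    otherwise a pole is available.\<close>
  proof (cases "A = {} \<or> S2 \<subseteq> \<Union>A")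
    case True
    have "p3 A = 0"
    proof (cases "A = {}")
      case True
      then show ?thesis unfolding p3_def crossings_def by simp
    next
      case False
      then have "S2 - \<Union>A = {}" using True by blast
      then have "cells A = {}" unfolding cells_def by (simp only: components_empty)
      then show ?thesis unfolding p3_def by simp
    qed
    then show ?thesis by simp
  next
    case False
    then obtain z where z: "z \<in> S2" "z \<notin> \<Union>A" by blast
    have "(S2 - {z}) homeomorphic (UNIV :: complex set)"
      by (rule homeomorphic_punctured_sphere_affine) (use z in \<open>auto simp: affine_UNIV aff_dim_UNIV\<close>)
    then obtain f g where fg: "homeomorphism (S2 - {z}) (UNIV :: complex set) f g" unfolding homeomorphic_def by blast
    interpret spherical_arrangement A z f g
      by unfold_locales (use A z fg in auto)
    have "finite A" using A unfolding arrangement_def by blast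
    then have "card A \<ge> 1" using False by (simp add: Suc_le_eq card_gt_0_iff)
    \<comment> \<open>A nonempty arrangement absorbs the summand 3 into the linear term:
      \<open>1520 + 3 = 1523\<close>, and 508 is the least integer that is at least
      \<open>1523 / 3\<close>.\<close>
    then have "real 3 * real (p3 A) \<le> 2 * real (card A)^2 + 1523 * real (card A)"
      using p3_bound by (simp flip: of_nat_mult of_nat_power of_nat_add)
    then show ?thesis by simp
  qed
qed simp

end
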